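(* Let $f\in\mathcal L^H$. Then $f$ embeds in a flow $(f^t)_{t\in\mathbb R}$ with $f^t\in\mathcal L^H$. Moreover, if $f$ is parabolic or hyperbolic, then $f$ embeds in the $\mathcal C^1$-flow of a unique vector field $X=\xi\frac{\mathrm d}{\mathrm dx}$, $\xi\in\mathcal L$.
   Context: Write $\boldsymbol\ell=-1/\log x$. Let $\preceq$ be the lexicographic order on $\mathbb R\times\mathbb Z$. $\mathcal L$ is the set of formal series $f=\sum_{(\alpha,k)}[f]_{\alpha,k}x^\alpha\boldsymbol\ell^k$ with real coefficients whose support $\mathcal S(f)=\{(\alpha,k):[f]_{\alpha,k}\neq0\}$ is a $\preceq$-well-ordered subset of $\mathbb R_{>0}\times\mathbb Z$. $\mathrm{ord}(f)=\min\mathcal S(f)$; "h.o.t." stands for terms of strictly larger order. $\mathcal L^H$ is the set of $f\in\mathcal L$ of the form $f=\lambda x^\alpha+\text{h.o.t.}$ with $\lambda>0$, $\alpha>0$. Such an $f$ is strongly hyperbolic if $\alpha\ne1$, hyperbolic if $\alpha=1,\lambda\neq1$, parabolic if $\alpha=1,\lambda=1$. Composition: for $f=ax^\lambda(1+\varepsilon)\in\mathcal L^H$ ($\varepsilon$ containing only monomials of order $\succ(0,0)$), set $x^\alpha\circ f=a^\alpha x^{\lambda\alpha}\sum_{j\ge0}\binom{\alpha}{j}\varepsilon^j$ and $\boldsymbol\ell\circ f=-1/\log f$ with $\log f=\log a+\lambda\log x+\sum_{j\ge1}\frac{(-1)^{j+1}}{j}\varepsilon^j$, expanded in powers of $\boldsymbol\ell$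 and $\varepsilon$; then $\big(\sum c_{\alpha,k}x^\alpha\boldsymbol\ell^k\big)\circ f=\sum c_{\alpha,k}(x^\alpha\circ f)(\boldsymbol\ell\circ f)^k$. $\mathcal L^H$ is a group for composition; $\mathrm{id}$ denotes the series $x$. A family $(f^t)_{t\in\mathbb R}$ in $\mathcal L^H$ is a flow if $f^0=\mathrm{id}$ and $f^s\circ f^t=f^{s+t}$ for all $s,t\in\mathbb R$; $f$ embeds in the flow if $f=f^1$. It is a $\mathcal C^1$-flow if moreover (i) there is a well-ordered $S\subset\mathbb R_{>0}\times\mathbb Z$ with $\mathcal S(f^t)\subseteq S$ for all $t$, and (ii) $t\mapsto[f^t]_{\alpha,m}$ is $\mathcal C^1$ on $\mathbb R$ for every $(\alpha,m)\in S$. In that case, with $\xi=\frac{\mathrm df^t}{\mathrm dt}\big|_{t=0}\in\mathcal L$ (derivative taken coefficientwise), $(f^t)$ is called the $\mathcal C^1$-(formal) flow of the vector field $X=\xi\frac{\mathrm d}{\mathrm dx}$. *)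

theory Defs
  imports "HOL-Analysis.Analysis"
begin

text \<open>
  A formal series \<open>\<Sum> c(\<alpha>,k) x\<^sup>\<alpha> \<ell>\<^sup>k\<close>, where \<open>\<ell> = -1 / log x\<close>, is represented by
  its coefficient function \<open>c\<close>. Exponents range over all of \<open>\<real> \<times> \<int>\<close>, because \<open>log f\<close> and
  the powers of \<open>\<ell> \<circ> f\<close> have exponents outside of \<open>\<real>\<^sub>>\<^sub>0 \<times> \<int>\<close>.
\<close>

type_synonym series = "real \<times> int \<Rightarrow> real"

text \<open>
  The lexicographic order is spelled out because the instance of \<open>\<le>\<close> for pairs that comes
  with \<open>HOL-Analysis\<close> is the componentwise order.
\<close>

definition lex_le :: "real \<times> int \<Rightarrow> real \<times> int \<Rightarrow> bool" (infix "\<preceq>" 50) where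
  "p \<preceq> q \<longleftrightarrow> fst p < fst q \<or> fst p = fst q \<and> snd p \<le> snd q"

definition well_ordered :: "(real \<times> int) set \<Rightarrow> bool" where
  "well_ordered S \<longleftrightarrow> well_order_on S {(p, q). p \<in> S \<and> q \<in> S \<and> p \<preceq> q}"

definition supp :: "series \<Rightarrow> (real \<times> int) set" where
  "supp f = {p. f p \<noteq> 0}"

definition log_series :: "series set" where
  "log_series = {f. supp f \<subseteq> {0<..} \<times> UNIV \<and> well_ordered (supp f)}"

definition series_ord :: "series \<Rightarrow> real \<times> int" where
  "series_ord f = (THE p. p \<in> supp f \<and> (\<forall>q\<in>supp f. p \<preceq> q))"

text \<open>\<open>f = a x\<^sup>\<beta> + h.o.t.\<close>\<close>

definition starts_with :: "series \<Rightarrow> real \<Rightarrow> real \<Rightarrow> bool" where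
  "starts_with f a \<beta> \<longleftrightarrow> a \<noteq> 0 \<and> f (\<beta>, 0) = a \<and> series_ord f = (\<beta>, 0)"

definition log_series_H :: "series set" where
  "log_series_H = {f \<in> log_series. \<exists>a>0. \<exists>\<beta>>0. starts_with f a \<beta>}"

definition hyperbolic :: "series \<Rightarrow> bool" where
  "hyperbolic f \<longleftrightarrow> f \<in> log_series_H \<and> (\<exists>a. a \<noteq> 1 \<and> starts_with f a 1)"

definition parabolic :: "series \<Rightarrow> bool" where
  "parabolic f \<longleftrightarrow> f \<in> log_series_H \<and> starts_with f 1 1"

definition term_series :: "real \<Rightarrow> real \<times> int \<Rightarrow> series" where
  "term_series c p = (\<lambda>q. if q = p then c else 0)"

definition id_series :: series where
  "id_series = term_series 1 (1, 0)"

text \<open>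
  Sum of a family of series in which each exponent occurs in only finitely many members.
  For families without this property the value has no meaning.
\<close>

definition family_sum :: "('i \<Rightarrow> series) \<Rightarrow> 'i set \<Rightarrow> series" where
  "family_sum F J = (\<lambda>p. \<Sum>j | j \<in> J \<and> F j p \<noteq> 0. F j p)"

text \<open>The sum is finite if the supports of \<open>f\<close> and \<open>g\<close> are well-ordered.\<close>

definition series_mult :: "series \<Rightarrow> series \<Rightarrow> series" (infixl "\<otimes>\<^sub>s" 70) where
  "f \<otimes>\<^sub>s g = (\<lambda>r. \<Sum>p | f p \<noteq> 0 \<and> g (r - p) \<noteq> 0. f p * g (r - p))"

definition series_pow :: "series \<Rightarrow> nat \<Rightarrow> series" where
  "series_pow f n = ((\<otimes>\<^sub>s) f ^^ n) (term_series 1 (0, 0))"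

text \<open>\<open>f = c m (1 + \<epsilon>)\<close>, where \<open>c m\<close> is the leading term of \<open>f\<close>; the following is \<open>\<epsilon>\<close>.\<close>

definition series_eps :: "series \<Rightarrow> series" where
  "series_eps f =
     (\<lambda>p. if p = (0, 0) then 0 else f (series_ord f + p) / f (series_ord f))"

text \<open>\<open>1 / f = c\<^sup>-\<^sup>1 m\<^sup>-\<^sup>1 \<Sum>\<^sub>j (-\<epsilon>)\<^sup>j\<close>\<close>

definition series_inverse :: "series \<Rightarrow> series" where
  "series_inverse f =
     term_series (inverse (f (series_ord f))) (- series_ord f) \<otimes>\<^sub>s
     family_sum (\<lambda>j p. (- 1) ^ j * series_pow (series_eps f) j p) UNIV"

definition series_powi :: "series \<Rightarrow> int \<Rightarrow> series" where
  "series_powi f k =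
     (if 0 \<le> k then series_pow f (nat k) else series_pow (series_inverse f) (nat (- k)))"

text \<open>\<open>x\<^sup>\<alpha> \<circ> f\<close>\<close>

definition x_powr_comp :: "real \<Rightarrow> series \<Rightarrow> series" where
  "x_powr_comp \<alpha> f =
     term_series (f (series_ord f) powr \<alpha>) (fst (series_ord f) * \<alpha>, 0) \<otimes>\<^sub>s
     family_sum (\<lambda>j p. (\<alpha> gchoose j) * series_pow (series_eps f) j p) UNIV"

text \<open>\<open>log f = log a + \<beta> log x + log (1 + \<epsilon>)\<close>, where
  \<open>f = a x\<^sup>\<beta> (1 + \<epsilon>)\<close> and \<open>log x = - \<ell>\<^sup>-\<^sup>1\<close>\<close>

definition log_comp :: "series \<Rightarrow> series" where
  "log_comp f =
     (\<lambda>p. term_series (ln (f (series_ord f))) (0, 0) p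
        + term_series (- fst (series_ord f)) (0, - 1) p
        + family_sum (\<lambda>j p. (- 1) ^ (j + 1) / real j * series_pow (series_eps f) j p) {1..} p)"

text \<open>\<open>\<ell> \<circ> f = - 1 / log f\<close>\<close>

definition ell_comp :: "series \<Rightarrow> series" where
  "ell_comp f = (\<lambda>p. - series_inverse (log_comp f) p)"

definition series_comp :: "series \<Rightarrow> series \<Rightarrow> series" (infixl "\<circ>\<^sub>s" 55) where
  "g \<circ>\<^sub>s f =
     family_sum
       (\<lambda>(\<alpha>, k) p. g (\<alpha>, k) * (x_powr_comp \<alpha> f \<otimes>\<^sub>s series_powi (ell_comp f) k) p)
       UNIV"

definition flow :: "(real \<Rightarrow> series) \<Rightarrow> bool" where
  "flow F \<longleftrightarrow>
     (\<forall>t. F t \<in> log_series_H) \<and> F 0 = id_series \<and> (\<forall>s t. F s \<circ>\<^sub>s F t = F (s + t))"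

definition C1_flow :: "(real \<Rightarrow> series) \<Rightarrow> bool" where
  "C1_flow F \<longleftrightarrow>
     flow F \<and>
     (\<exists>S. S \<subseteq> {0<..} \<times> UNIV \<and> well_ordered S \<and> (\<forall>t. supp (F t) \<subseteq> S) \<and>
          (\<forall>p\<in>S. (\<lambda>t. F t p) C1_differentiable_on UNIV))"

text \<open>\<open>F\<close> is the \<open>C\<^sup>1\<close>-flow of the vector field \<open>\<xi> d/dx\<close>.\<close>

definition C1_flow_of :: "series \<Rightarrow> (real \<Rightarrow> series) \<Rightarrow> bool" where
  "C1_flow_of \<xi> F \<longleftrightarrow>
     C1_flow F \<and> (\<forall>p. ((\<lambda>t. F t p) has_real_derivative \<xi> p) (at 0))"

definition embeds_in :: "series \<Rightarrow> (real \<Rightarrow> series) \<Rightarrow> bool" where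
  "embeds_in f F \<longleftrightarrow> F 1 = f"

end

theory Submission
  imports Defs
begin

text \<open>
  Write every element of \<open>\<L>\<^sup>H\<close> as \<open>f = a x\<^sup>b exp v\<close> with \<open>a, b > 0\<close> and \<open>v\<close> of positive order. In these
  coordinates composition with \<open>f\<close> is a strongly linear ring homomorphism \<open>C\<^sub>f\<close>, and the group law is
  \<open>(a', b', v') \<circ> (a, b, v) = (a' a\<^sup>b\<^sup>', b b', b' v + C\<^sub>f v')\<close>.

  If \<open>b = 1\<close>, then \<open>C\<^sub>f\<close> is triangular with diagonal entries \<open>a\<^sup>\<alpha>\<close>. Hence each coefficient of the \<open>n\<close>-th
  iterate of \<open>f\<close> is an exponential polynomial in \<open>n\<close>. Replacing \<open>n\<close> by a real number gives the
  \<open>C\<^sup>1\<close>-flow: its group law holds at natural times, and exponential polynomials are determined by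
  their values there. Conversely, if two \<open>C\<^sup>1\<close>-flows through \<open>f\<close> agree below an exponent \<open>(\<alpha>, k)\<close>, the
  difference \<open>d\<close> of their coefficients at that exponent satisfies \<open>d (s + t) = d t + a\<^sup>\<alpha>\<^sup>t d s\<close> and
  \<open>d 1 = 0\<close>, which forces \<open>d = 0\<close>.

  If \<open>b > 1\<close>, the Boettcher equation \<open>\<Psi> \<circ> f = \<Psi>\<^sup>b\<close> becomes a linear triangular equation for the logarithm
  of \<open>\<Psi>\<close>, and \<open>\<Psi>\<close> conjugates \<open>f\<close> to \<open>x\<^sup>b\<close>, which embeds in the flow of the powers \<open>x powr (b powr t)\<close>. The case
  \<open>b < 1\<close> follows by passing to the inverse.
\<close>

section \<open>Well-ordered sets of exponents\<close>

text \<open>The operations on \<open>series\<close> have a meaning only under finiteness conditions.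
  The algebra is therefore done in a type of Hahn series, which is a ring, and carried back along
  \<open>ser\<close>. The obstacle is that the order on exponents is not Archimedean: \<ell> has
  positive order but real exponent 0, so powers of a series of positive order need not leave every
  bounded range of exponents. That such powers can be summed is Neumann's lemma,
  \<open>wo_gen_monoid\<close> together with \<open>finite_nsum_mem\<close>.

  In logarithmic coordinates binomial series and inverses become exponentials, and associativity of
  composition comes down to one identity for \<ell>, \<open>hw_comp\<close>.

  For b = 1 composition does not stretch exponents, so one monoid supports all iterates and the
  whole flow. This is the common support that a C1-flow asks for. Conversely, such a support forces
  leading exponent 1 at all times: leading exponents multiply along a flow, and one below 1 would
  start an infinite descent. Uniqueness begins with this fact, \<open>B_eq_1\<close>.\<close>

definition wo :: "'a::linorder set \<Rightarrow> bool" where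
  "wo S \<longleftrightarrow> (\<forall>X\<subseteq>S. X \<noteq> {} \<longrightarrow> (\<exists>m\<in>X. \<forall>x\<in>X. m \<le> x))"

lemma woI: "(\<And>X. X \<subseteq> S \<Longrightarrow> X \<noteq> {} \<Longrightarrow> \<exists>m\<in>X. \<forall>x\<in>X. m \<le> x) \<Longrightarrow> wo S"
  unfolding wo_def by blast

lemma woE:
  assumes "wo S" "X \<subseteq> S" "X \<noteq> {}"
  obtains m where "m \<in> X" "\<And>x. x \<in> X \<Longrightarrow> m \<le> x"
proof -
  have "\<exists>m\<in>X. \<forall>x\<in>X. m \<le> x" using assms unfolding wo_def by simp
  then show ?thesis using that by blast
qed

lemma wo_subset: "wo S \<Longrightarrow> T \<subseteq> S \<Longrightarrow> wo T"
  unfolding wo_def by (meson subset_trans)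

lemma wo_empty [simp]: "wo {}"
  by (auto simp: wo_def)

lemma wo_singleton [simp]: "wo {p}"
  by (auto simp: wo_def subset_singleton_iff)

lemma wo_Un:
  assumes "wo S" "wo T"
  shows "wo (S \<union> T)"
proof (rule woI)
  fix X assume X: "X \<subseteq> S \<union> T" "X \<noteq> {}"
  show "\<exists>m\<in>X. \<forall>x\<in>X. m \<le> x"
  proof (cases "X \<inter> S = {} \<or> X \<inter> T = {}")
    case True
    then have "X \<subseteq> S \<or> X \<subseteq> T" using X by auto
    then show ?thesis
    proof
      assume "X \<subseteq> S"
      with assms(1) X(2) show ?thesis unfolding wo_def by blast
    next
      assume "X \<subseteq> T"
      with assms(2) X(2) show ?thesis unfolding wo_def by blast
    qed
  next
    case False
    obtain m where m: "m \<in> X \<inter> S" "\<And>x. x \<in> X \<inter> S \<Longrightarrow> m \<le> x"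
      using woE[OF assms(1), of "X \<inter> S"] False by auto
    obtain n where n: "n \<in> X \<inter> T" "\<And>x. x \<in> X \<inter> T \<Longrightarrow> n \<le> x"
      using woE[OF assms(2), of "X \<inter> T"] False by auto
    show ?thesis
    proof (rule bexI[of _ "min m n"])
      show "min m n \<in> X" using m(1) n(1) by (simp add: min_def)
      show "\<forall>x\<in>X. min m n \<le> x"
        unfolding min_le_iff_disj using m(2) n(2) X(1) by blast
    qed
  qed
qed

lemma wo_insert [simp]: "wo (insert p S) \<longleftrightarrow> wo S"
  using wo_Un[OF wo_singleton[of p], of S] wo_subset[of "insert p S" S] by auto

lemma wo_finite_UN: "finite I \<Longrightarrow> (\<And>i. i \<in> I \<Longrightarrow> wo (S i)) \<Longrightarrow> wo (\<Union>i\<in>I. S i)"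
  by (induction I rule: finite_induct) (auto intro: wo_Un)

text \<open>A least element of X only has to be sought below some x in X. This reduces the claim to
  bounded ranges of exponents, where bounds that depend on x, such as one on the number of summands,
  are available.\<close>

lemma wo_if_initial:
  assumes "\<And>x. x \<in> S \<Longrightarrow> wo {y \<in> S. y \<le> x}"
  shows "wo S"
proof (rule woI)
  fix X assume X: "X \<subseteq> S" "X \<noteq> {}"
  then obtain x where x: "x \<in> X" by auto
  obtain m where m: "m \<in> {y \<in> X. y \<le> x}" "\<And>z. z \<in> {y \<in> X. y \<le> x} \<Longrightarrow> m \<le> z"
    using woE[OF assms[of x], of "{y \<in> X. y \<le> x}"] X x by auto
  have "m \<le> z" if "z \<in> X" for z
    using m(2)[of z] m(1) that by (cases "z \<le> x") auto
  with m(1) show "\<exists>m\<in>X. \<forall>x\<in>X. m \<le> x" by auto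
qed

lemma wo_induct [consumes 2, case_names less]:
  assumes "wo S" "p \<in> S"
    and step: "\<And>p. p \<in> S \<Longrightarrow> (\<And>q. q \<in> S \<Longrightarrow> q < p \<Longrightarrow> P q) \<Longrightarrow> P p"
  shows "P p"
proof (rule ccontr)
  assume "\<not> P p"
  then obtain m where m: "m \<in> {q \<in> S. \<not> P q}" "\<And>x. x \<in> {q \<in> S. \<not> P q} \<Longrightarrow> m \<le> x"
    using woE[OF assms(1), of "{q \<in> S. \<not> P q}"] assms(2) by blast
  have "P m"
  proof (rule step)
    fix q assume "q \<in> S" "q < m"
    then show "P q" using m(2)[of q] leD by blast
  qed (use m in auto)
  with m(1) show False by simp
qed

lemma wf_less_on_wo:
  assumes "wo W"
  shows "wf {(q, p). q \<in> W \<and> p \<in> W \<and> q < p}" (is "wf ?R")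
  unfolding wf_def
proof (intro allI impI)
  fix P x assume step: "\<forall>x. (\<forall>y. (y, x) \<in> ?R \<longrightarrow> P y) \<longrightarrow> P x"
  have "P p" if "p \<in> W" for p
    using assms that
  proof (induction p rule: wo_induct)
    case (less p)
    show ?case by (rule step[rule_format]) (use less.IH in auto)
  qed
  then show "P x" by (cases "x \<in> W") (use step in auto)
qed

lemma wo_mono_image:
  assumes "wo S" "\<And>x y. x \<in> S \<Longrightarrow> y \<in> S \<Longrightarrow> x \<le> y \<Longrightarrow> h x \<le> h y"
  shows "wo (h ` S)"
proof (rule woI)
  fix X assume X: "X \<subseteq> h ` S" "X \<noteq> {}"
  then obtain m where m: "m \<in> {x \<in> S. h x \<in> X}" "\<And>x. x \<in> {x \<in> S. h x \<in> X} \<Longrightarrow> m \<le> x"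
    using woE[OF assms(1), of "{x \<in> S. h x \<in> X}"] by blast
  have "h m \<le> y" if y: "y \<in> X" for y
  proof -
    obtain x where x: "x \<in> S" "y = h x" using y X by auto
    then show ?thesis using m y assms(2) by blast
  qed
  with m(1) show "\<exists>m\<in>X. \<forall>x\<in>X. m \<le> x" by blast
qed

section \<open>Sums of well-ordered sets and the monoids they generate\<close>

definition sumset :: "'a::plus set \<Rightarrow> 'a set \<Rightarrow> 'a set" where
  "sumset A B = {a + b | a b. a \<in> A \<and> b \<in> B}"

lemma sumsetI: "a \<in> A \<Longrightarrow> b \<in> B \<Longrightarrow> a + b \<in> sumset A B"
  by (auto simp: sumset_def)

lemma sumsetE:
  assumes "x \<in> sumset A B"
  obtains a b where "a \<in> A" "b \<in> B" "x = a + b"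
  using assms by (auto simp: sumset_def)

lemma sumset_mono: "A \<subseteq> A' \<Longrightarrow> B \<subseteq> B' \<Longrightarrow> sumset A B \<subseteq> sumset A' B'"
  by (auto simp: sumset_def)

lemma sumset_assoc: "sumset (sumset A B) C = sumset A (sumset B (C :: 'a::semigroup_add set))"
proof
  show "sumset (sumset A B) C \<subseteq> sumset A (sumset B C)"
    by (auto elim!: sumsetE simp: add.assoc) (intro sumsetI)
  show "sumset A (sumset B C) \<subseteq> sumset (sumset A B) C"
    by (auto elim!: sumsetE simp: add.assoc[symmetric]) (intro sumsetI)
qed

lemma sumset_zero [simp]: "sumset {0 :: 'a::monoid_add} A = A"
  by (auto simp: sumset_def)

text \<open>Induction along B. Take the least a that occurs in a sum belonging to X, with some
  partner c. A smaller element of X has its A-part at least a, hence its B-part less than c, so the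
  search continues with B cut off below c.\<close>

lemma wo_sumset:
  fixes A B :: "'a::linordered_ab_group_add set"
  assumes A: "wo A" and B: "wo B"
  shows "wo (sumset A B)"
proof -
  define has_min where "has_min X \<longleftrightarrow> (\<exists>m\<in>X. \<forall>x\<in>X. m \<le> x)" for X :: "'a set"
  define below where "below b = {d \<in> B. d < b}" for b
  have step: "has_min X"
    if X: "X \<subseteq> sumset A C" "X \<noteq> {}" and C: "C \<subseteq> B"
      and IH: "\<And>c Y. c \<in> C \<Longrightarrow> Y \<subseteq> sumset A (below c) \<Longrightarrow> Y \<noteq> {} \<Longrightarrow> has_min Y" for X C
  proof -
    let ?A = "{a \<in> A. \<exists>c\<in>C. a + c \<in> X}"
    have "?A \<noteq> {}" using X by (fastforce simp: sumset_def)
    then obtain a where a: "a \<in> ?A" "\<And>x. x \<in> ?A \<Longrightarrow> a \<le> x"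
      using woE[OF A, of ?A] by auto
    then obtain c where c: "c \<in> C" "a + c \<in> X" by auto
    let ?Y = "{y \<in> X. y < a + c}"
    have Y: "?Y \<subseteq> sumset A (below c)"
    proof
      fix y assume y: "y \<in> ?Y"
      then obtain a' d where ad: "a' \<in> A" "d \<in> C" "y = a' + d"
        using X unfolding sumset_def by blast
      then have "a \<le> a'" using a(2) y by blast
      then have "d < c" using y ad(3) add_mono[of a a' c d] by (auto simp: not_le[symmetric])
      then show "y \<in> sumset A (below c)"
        using ad C by (auto simp: sumset_def below_def)
    qed
    show ?thesis
    proof (cases "?Y = {}")
      case True
      then show ?thesis using c(2) by (auto simp: has_min_def not_less)
    next
      case False
      then obtain m where m: "m \<in> ?Y" "\<forall>y\<in>?Y. m \<le> y"
        using IH[OF c(1) Y] by (auto simp: has_min_def)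
      have "m \<le> x" if x: "x \<in> X" for x
      proof (cases "x < a + c")
        case True
        then show ?thesis using m(2) x by blast
      next
        case False
        then show ?thesis using m(1) by auto
      qed
      with m(1) show ?thesis by (auto simp: has_min_def)
    qed
  qed
  have "\<forall>X. X \<subseteq> sumset A (below b) \<longrightarrow> X \<noteq> {} \<longrightarrow> has_min X" if "b \<in> B" for b
    using B that
  proof (induction b rule: wo_induct)
    case (less b)
    show ?case
    proof (intro allI impI)
      fix X assume X: "X \<subseteq> sumset A (below b)" "X \<noteq> {}"
      show "has_min X"
      proof (rule step[OF X])
        fix c Y assume c: "c \<in> below b" and Y: "Y \<subseteq> sumset A (below c)" "Y \<noteq> {}"
        from c have "c \<in> B" "c < b" by (auto simp: below_def)
        from less.IH[OF this] Y show "has_min Y" by blast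
      qed (auto simp: below_def)
    qed
  qed
  then have "has_min X" if "X \<subseteq> sumset A B" "X \<noteq> {}" for X
    using step[OF that order_refl] by blast
  then show ?thesis
    unfolding has_min_def by (rule woI)
qed

text \<open>A set that is well-ordered in both directions is finite: by induction each initial
  segment is finite, since the predecessors of p have a largest element, and the maximum of S then
  covers S.\<close>

lemma finite_if_wo_and_max:
  assumes S: "wo S" and max: "\<And>X. X \<subseteq> S \<Longrightarrow> X \<noteq> {} \<Longrightarrow> \<exists>m\<in>X. \<forall>x\<in>X. x \<le> m"
  shows "finite S"
proof (cases "S = {}")
  case False
  have fin: "finite {q \<in> S. q \<le> p}" if "p \<in> S" for p
    using S that
  proof (induction p rule: wo_induct)
    case (less p)
    have eq: "{q \<in> S. q \<le> p} = insert p {q \<in> S. q < p}"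
      using less by (auto simp: order_le_less)
    show ?case
    proof (cases "{q \<in> S. q < p} = {}")
      case True
      show ?thesis unfolding eq True by simp
    next
      case False
      then obtain m where m: "m \<in> {q \<in> S. q < p}" "\<forall>x\<in>{q \<in> S. q < p}. x \<le> m"
        using max[of "{q \<in> S. q < p}"] by auto
      then have "{q \<in> S. q < p} \<subseteq> {q \<in> S. q \<le> m}" by auto
      then show ?thesis unfolding eq using less.IH[of m] m(1) finite_subset by auto
    qed
  qed
  obtain m where "m \<in> S" "\<forall>x\<in>S. x \<le> m" using max[of S] False by auto
  then show ?thesis using fin[of m] by (auto intro: finite_subset[rotated])
qed simp

text \<open>Passing from a to r - a reverses the order, so the set is well-ordered in both
  directions. This makes each coefficient of a product a finite sum.\<close>

lemma finite_decompositions: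
  fixes A B :: "'a::linordered_ab_group_add set"
  assumes A: "wo A" and B: "wo B"
  shows "finite {a \<in> A. r - a \<in> B}"
proof (rule finite_if_wo_and_max)
  show "wo {a \<in> A. r - a \<in> B}" using A by (rule wo_subset) auto
  fix X assume X: "X \<subseteq> {a \<in> A. r - a \<in> B}" "X \<noteq> {}"
  then obtain m where m: "m \<in> (\<lambda>a. r - a) ` X" "\<And>x. x \<in> (\<lambda>a. r - a) ` X \<Longrightarrow> m \<le> x"
    using woE[OF B, of "(\<lambda>a. r - a) ` X"] by blast
  then obtain a where a: "a \<in> X" "m = r - a" by auto
  have "x \<le> a" if "x \<in> X" for x
    using m(2)[of "r - x"] that a(2) by auto
  with a(1) show "\<exists>m\<in>X. \<forall>x\<in>X. x \<le> m" by blast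
qed

primrec nsum :: "'a::comm_monoid_add set \<Rightarrow> nat \<Rightarrow> 'a set" where
  "nsum W 0 = {0}"
| "nsum W (Suc n) = sumset W (nsum W n)"

definition gen_monoid :: "'a::comm_monoid_add set \<Rightarrow> 'a set" where
  "gen_monoid W = (\<Union>n. nsum W n)"

lemma wo_nsum: "wo W \<Longrightarrow> wo (nsum (W :: 'a::linordered_ab_group_add set) n)"
  by (induction n) (auto intro: wo_sumset)

lemma nsum_add: "nsum W (m + n) = sumset (nsum W m) (nsum W n)"
  by (induction m) (auto simp: sumset_assoc)

lemma gen_monoid_zero [simp]: "0 \<in> gen_monoid W"
  unfolding gen_monoid_def by (rule UN_I[of 0]) auto

lemma subset_gen_monoid: "W \<subseteq> gen_monoid W"
proof
  fix x assume "x \<in> W"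
  then have "x \<in> nsum W (Suc 0)" by (auto simp: sumset_def)
  then show "x \<in> gen_monoid W" unfolding gen_monoid_def by blast
qed

lemma gen_monoid_add: "p \<in> gen_monoid W \<Longrightarrow> q \<in> gen_monoid W \<Longrightarrow> p + q \<in> gen_monoid W"
proof -
  assume "p \<in> gen_monoid W" "q \<in> gen_monoid W"
  then obtain m n where "p \<in> nsum W m" "q \<in> nsum W n" unfolding gen_monoid_def by blast
  then have "p + q \<in> nsum W (m + n)" unfolding nsum_add by (rule sumsetI)
  then show ?thesis unfolding gen_monoid_def by blast
qed

lemma nsum_subset_gen_monoid: "nsum W n \<subseteq> gen_monoid W"
  unfolding gen_monoid_def by blast

lemma gen_monoid_least:
  assumes "0 \<in> M" "\<And>p q. p \<in> M \<Longrightarrow> q \<in> M \<Longrightarrow> p + q \<in> M" "W \<subseteq> M"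
  shows "gen_monoid W \<subseteq> M"
proof -
  have "nsum W n \<subseteq> M" for n
    by (induction n) (use assms in \<open>auto simp: sumset_def\<close>)
  then show ?thesis by (auto simp: gen_monoid_def)
qed

lemma gen_monoid_mono: "V \<subseteq> W \<Longrightarrow> gen_monoid V \<subseteq> gen_monoid W"
  by (rule gen_monoid_least) (use subset_gen_monoid[of W] in \<open>simp_all add: gen_monoid_add\<close>)

lemma nsum_pos:
  "W \<subseteq> {0<..} \<Longrightarrow> nsum W (Suc n) \<subseteq> {0 :: 'a::linordered_ab_group_add<..}"
proof (induction n)
  case (Suc n)
  then show ?case
    unfolding nsum.simps(2)[of W "Suc n"] sumset_def by (auto intro!: add_pos_pos)
qed (auto simp: sumset_def)

lemma gen_monoid_nonneg:
  "W \<subseteq> {0 :: 'a::linordered_ab_group_add..} \<Longrightarrow> gen_monoid W \<subseteq> {0..}"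
  by (intro gen_monoid_least) auto

section \<open>The exponents of \<open>x\<close> and \<open>\<ell>\<close>\<close>

datatype expo = Expo (xdeg: real) (ldeg: int)

lemma expo_eq_iff: "p = q \<longleftrightarrow> xdeg p = xdeg q \<and> ldeg p = ldeg q"
  by (cases p; cases q) auto

instantiation expo :: linordered_ab_group_add
begin

definition "0 = Expo 0 0"
definition "p + q = Expo (xdeg p + xdeg q) (ldeg p + ldeg q)"
definition "p - q = Expo (xdeg p - xdeg q) (ldeg p - ldeg q)"
definition "- p = Expo (- xdeg p) (- ldeg p)"
definition "p < q \<longleftrightarrow> xdeg p < xdeg q \<or> xdeg p = xdeg q \<and> ldeg p < ldeg q"
definition "p \<le> q \<longleftrightarrow> xdeg p < xdeg q \<or> xdeg p = xdeg q \<and> ldeg p \<le> ldeg q"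

instance
proof
  fix a b c :: expo
  show "a + b + c = a + (b + c)"
    by (simp add: plus_expo_def)
  show "a + b = b + a"
    by (simp add: plus_expo_def add.commute)
  show "0 + a = a"
    by (simp add: plus_expo_def zero_expo_def)
  show "- a + a = 0"
    by (simp add: plus_expo_def zero_expo_def uminus_expo_def)
  show "a - b = a + - b"
    by (simp add: plus_expo_def minus_expo_def uminus_expo_def)
  show "a < b \<longleftrightarrow> a \<le> b \<and> \<not> b \<le> a"
    unfolding less_expo_def less_eq_expo_def by linarith
  show "a \<le> a"
    by (simp add: less_eq_expo_def)
  show "a \<le> b \<or> b \<le> a"
    unfolding less_eq_expo_def by linarith
  show "a \<le> b \<Longrightarrow> b \<le> c \<Longrightarrow> a \<le> c"
    unfolding less_eq_expo_def by linarith
  show "a \<le> b \<Longrightarrow> b \<le> a \<Longrightarrow> a = b"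
    unfolding less_eq_expo_def expo_eq_iff by linarith
  show "a \<le> b \<Longrightarrow> c + a \<le> c + b"
    by (simp add: less_eq_expo_def plus_expo_def)
qed

end

lemma xdeg_simps [simp]:
  "xdeg 0 = 0" "xdeg (p + q) = xdeg p + xdeg q" "xdeg (p - q) = xdeg p - xdeg q"
  "xdeg (- p) = - xdeg p"
  by (simp_all add: zero_expo_def plus_expo_def minus_expo_def uminus_expo_def)

lemma ldeg_simps [simp]:
  "ldeg 0 = 0" "ldeg (p + q) = ldeg p + ldeg q" "ldeg (p - q) = ldeg p - ldeg q"
  "ldeg (- p) = - ldeg p"
  by (simp_all add: zero_expo_def plus_expo_def minus_expo_def uminus_expo_def)

lemma xdeg_mono: "p \<le> q \<Longrightarrow> xdeg p \<le> xdeg q"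
  by (auto simp: less_eq_expo_def)

lemma wo_vertical: "wo {p. xdeg p = \<rho> \<and> k \<le> ldeg p}"
proof (rule woI)
  fix X assume X: "X \<subseteq> {p. xdeg p = \<rho> \<and> k \<le> ldeg p}" "X \<noteq> {}"
  then obtain z where z: "z \<in> X" by auto
  obtain m where m: "m \<in> X" "\<And>y. y \<in> X \<Longrightarrow> nat (ldeg m - k) \<le> nat (ldeg y - k)"
    using ex_has_least_nat[of "\<lambda>y. y \<in> X" z "\<lambda>y. nat (ldeg y - k)"] z by auto
  have "m \<le> x" if "x \<in> X" for x
  proof -
    have "xdeg x = xdeg m" "k \<le> ldeg x" using X m(1) that by auto
    then show ?thesis using m(2)[OF that] by (auto simp: less_eq_expo_def nat_le_eq_zle)
  qed
  with m(1) show "\<exists>m\<in>X. \<forall>x\<in>X. m \<le> x" by blast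
qed

lemma wo_xdeg_bounded_below:
  assumes W: "wo W"
  shows "\<exists>\<delta>>0. \<forall>p\<in>W. 0 < xdeg p \<longrightarrow> \<delta> \<le> xdeg p"
proof (cases "{p \<in> W. 0 < xdeg p} = {}")
  case True
  then show ?thesis by (intro exI[of _ 1]) auto
next
  case False
  then obtain m where m: "m \<in> {p \<in> W. 0 < xdeg p}"
      "\<And>x. x \<in> {p \<in> W. 0 < xdeg p} \<Longrightarrow> m \<le> x"
    using woE[OF W, of "{p \<in> W. 0 < xdeg p}"] by blast
  have "xdeg m \<le> xdeg p" if "p \<in> W" "0 < xdeg p" for p
  proof -
    from that have "m \<le> p" using m(2) by blast
    then show ?thesis by (auto simp: less_eq_expo_def)
  qed
  with m(1) show ?thesis by blast
qed

text \<open>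
  For generators of positive real exponent the number of summands is bounded in terms of the
  real exponent of the sum; the remaining generators lie on the half-line \<open>{0} \<times> \<int>\<^sub>>\<^sub>0\<close>.
\<close>

lemma
  fixes W :: "expo set"
  assumes W: "wo W" and pos: "W \<subseteq> {0<..}"
  shows wo_gen_monoid: "wo (gen_monoid W)"
    and finite_nsum_mem: "finite {n. p \<in> nsum W n}"
proof -
  define W1 where "W1 = {p \<in> W. 0 < xdeg p}"
  define V where "V = {p. xdeg p = 0 \<and> 0 \<le> ldeg p}"
  have W1: "wo W1" using W by (rule wo_subset) (auto simp: W1_def)
  have V: "wo V" using wo_vertical[of 0 0] by (simp add: V_def)
  obtain \<delta> where \<delta>: "0 < \<delta>" "\<And>p. p \<in> W1 \<Longrightarrow> \<delta> \<le> xdeg p"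
    using wo_xdeg_bounded_below[OF W] unfolding W1_def by blast
  \<comment> \<open>j counts the summands of positive real exponent and s is their sum. Each other
    summand has \<open>ldeg\<close> at least 1, so n - j is at most the \<open>ldeg\<close> of the
    rest. The bound on j gives the well-ordering, the last inequality the finiteness.\<close>
  have dec: "\<exists>j s. s \<in> nsum W1 j \<and> q - s \<in> V \<and> real j * \<delta> \<le> xdeg q \<and>
      int n \<le> int j + ldeg (q - s)" if "q \<in> nsum W n" for n q
    using that
  proof (induction n arbitrary: q)
    case 0
    then have "q = 0" by simp
    then show ?case by (intro exI[of _ 0] exI[of _ "0 :: expo"]) (simp add: V_def)
  next
    case (Suc n)
    then obtain w r where wr: "w \<in> W" "r \<in> nsum W n" "q = w + r" by (auto simp: sumset_def)
    obtain j s where js: "s \<in> nsum W1 j" "r - s \<in> V" "real j * \<delta> \<le> xdeg r"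
        "int n \<le> int j + ldeg (r - s)" using Suc.IH[OF wr(2)] by blast
    show ?case
    proof (cases "0 < xdeg w")
      case True
      then have w: "w \<in> W1" using wr by (auto simp: W1_def)
      show ?thesis
        using js wr(3) \<delta>(2)[OF w] sumsetI[OF w js(1)]
        by (intro exI[of _ "Suc j"] exI[of _ "w + s"]) (auto simp: V_def algebra_simps)
    next
      case False
      then have "xdeg w = 0" "1 \<le> ldeg w"
        using wr(1) pos by (auto simp: less_expo_def)
      then show ?thesis using js wr(3)
        by (intro exI[of _ j] exI[of _ s]) (auto simp: V_def)
    qed
  qed
  define G where "G N = (\<Union>j\<in>{..N}. sumset (nsum W1 j) V)" for N
  have G: "wo (G N)" for N
    unfolding G_def by (intro wo_finite_UN wo_sumset wo_nsum W1 V) auto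
  have bound: "j \<le> nat \<lfloor>\<rho> / \<delta>\<rfloor>" if "real j * \<delta> \<le> \<rho>" for j \<rho>
    using that \<delta>(1) by (simp add: le_nat_floor pos_le_divide_eq)
  show "wo (gen_monoid W)"
  proof (rule wo_if_initial)
    fix x assume "x \<in> gen_monoid W"
    have "{y \<in> gen_monoid W. y \<le> x} \<subseteq> G (nat \<lfloor>xdeg x / \<delta>\<rfloor>)"
    proof
      fix y assume y: "y \<in> {y \<in> gen_monoid W. y \<le> x}"
      then obtain n where "y \<in> nsum W n" by (auto simp: gen_monoid_def)
      from dec[OF this] obtain j s where js: "s \<in> nsum W1 j" "y - s \<in> V" "real j * \<delta> \<le> xdeg y"
        by blast
      have "xdeg y \<le> xdeg x" using y by (auto simp: less_eq_expo_def)
      with js have "j \<le> nat \<lfloor>xdeg x / \<delta>\<rfloor>" by (intro bound) auto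
      moreover have "y \<in> sumset (nsum W1 j) V" using sumsetI[OF js(1,2)] by simp
      ultimately show "y \<in> G (nat \<lfloor>xdeg x / \<delta>\<rfloor>)" by (auto simp: G_def)
    qed
    then show "wo {y \<in> gen_monoid W. y \<le> x}" by (rule wo_subset[OF G])
  qed
  \<comment> \<open>Only finitely many sums s are possible for the given p, so the
    \<open>ldeg\<close> of p - s is bounded, and with it n.\<close>
  define D where "D = (\<Union>j\<le>nat \<lfloor>xdeg p / \<delta>\<rfloor>. {s \<in> nsum W1 j. p - s \<in> V})"
  have "finite D"
    unfolding D_def by (intro finite_UN_I finite_decompositions wo_nsum W1 V) auto
  define K where "K = Max (insert 0 ((\<lambda>s. ldeg (p - s)) ` D))"
  have "{n. p \<in> nsum W n} \<subseteq> {.. nat (int (nat \<lfloor>xdeg p / \<delta>\<rfloor>) + K)}"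
  proof
    fix n assume "n \<in> {n. p \<in> nsum W n}"
    then obtain j s where js: "s \<in> nsum W1 j" "p - s \<in> V" "real j * \<delta> \<le> xdeg p"
        "int n \<le> int j + ldeg (p - s)" using dec by blast
    have j: "j \<le> nat \<lfloor>xdeg p / \<delta>\<rfloor>" using js by (intro bound) auto
    then have "s \<in> D" using js by (auto simp: D_def)
    then have "ldeg (p - s) \<le> K" unfolding K_def using \<open>finite D\<close> by (intro Max_ge) auto
    with js(4) j have "int n \<le> int (nat \<lfloor>xdeg p / \<delta>\<rfloor>) + K" by linarith
    then show "n \<in> {.. nat (int (nat \<lfloor>xdeg p / \<delta>\<rfloor>) + K)}"
      unfolding atMost_iff by linarith
  qed
  then show "finite {n. p \<in> nsum W n}" by (rule finite_subset) simp
qed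

section \<open>Hahn series\<close>

lemma sum_nz_mem: "sum f A \<noteq> 0 \<Longrightarrow> \<exists>a. a \<in> A"
  by (metis all_not_in_conv sum.empty)

typedef (overloaded) 'e hahn =
  "{f :: 'e::linordered_ab_group_add \<Rightarrow> real. wo {p. f p \<noteq> 0}}"
  morphisms hcoeff Abs_hahn
  by (rule exI[of _ "\<lambda>_. 0"]) simp

definition hsupp :: "'e::linordered_ab_group_add hahn \<Rightarrow> 'e set" where
  "hsupp h = {p. hcoeff h p \<noteq> 0}"

lemma hahn_eqI: "(\<And>p. hcoeff f p = hcoeff g p) \<Longrightarrow> f = g"
  by (simp add: hcoeff_inject[symmetric] fun_eq_iff)

lemma wo_hsupp [simp]: "wo (hsupp h)"
  using hcoeff[of h] by (simp add: hsupp_def)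

lemma hcoeff_nz: "hcoeff h p \<noteq> 0 \<longleftrightarrow> p \<in> hsupp h"
  by (simp add: hsupp_def)

lemma hcoeff_eq_0: "hsupp h \<subseteq> W \<Longrightarrow> p \<notin> W \<Longrightarrow> hcoeff h p = 0"
  by (auto simp: hsupp_def)

lemma hcoeff_Abs: "wo W \<Longrightarrow> {p. f p \<noteq> 0} \<subseteq> W \<Longrightarrow> hcoeff (Abs_hahn f) = f"
  by (rule Abs_hahn_inverse) (simp add: wo_subset)

instantiation hahn :: (linordered_ab_group_add) comm_ring_1
begin

definition "0 = Abs_hahn (\<lambda>_. 0)"
definition "1 = Abs_hahn (\<lambda>p. if p = 0 then 1 else 0)"
definition "f + g = Abs_hahn (\<lambda>p. hcoeff f p + hcoeff g p)"
definition "- f = Abs_hahn (\<lambda>p. - hcoeff f p)"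
definition "f - g = Abs_hahn (\<lambda>p. hcoeff f p - hcoeff g p)"
definition "f * g =
  Abs_hahn (\<lambda>r. \<Sum>a\<in>{a \<in> hsupp f. r - a \<in> hsupp g}. hcoeff f a * hcoeff g (r - a))"

lemma hcoeff_0 [simp]: "hcoeff 0 p = 0"
  by (simp add: zero_hahn_def hcoeff_Abs[OF wo_empty])

lemma hcoeff_1: "hcoeff 1 p = (if p = 0 then 1 else 0)"
  unfolding one_hahn_def by (subst hcoeff_Abs[OF wo_singleton[of 0]]) (auto split: if_splits)

lemma hcoeff_add [simp]: "hcoeff (f + g) p = hcoeff f p + hcoeff g p"
  unfolding plus_hahn_def
  by (subst hcoeff_Abs[OF wo_Un[OF wo_hsupp[of f] wo_hsupp[of g]]]) (auto simp: hsupp_def)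

lemma hcoeff_uminus [simp]: "hcoeff (- f) p = - hcoeff f p"
  unfolding uminus_hahn_def by (subst hcoeff_Abs[OF wo_hsupp[of f]]) (auto simp: hsupp_def)

lemma hcoeff_minus [simp]: "hcoeff (f - g) p = hcoeff f p - hcoeff g p"
  unfolding minus_hahn_def
  by (subst hcoeff_Abs[OF wo_Un[OF wo_hsupp[of f] wo_hsupp[of g]]]) (auto simp: hsupp_def)

lemma hcoeff_times:
  "hcoeff (f * g) r = (\<Sum>a\<in>{a \<in> hsupp f. r - a \<in> hsupp g}. hcoeff f a * hcoeff g (r - a))"
proof -
  have "{r. (\<Sum>a\<in>{a \<in> hsupp f. r - a \<in> hsupp g}. hcoeff f a * hcoeff g (r - a)) \<noteq> 0}
      \<subseteq> sumset (hsupp f) (hsupp g)" (is "?L \<subseteq> _")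
  proof
    fix r assume "r \<in> ?L"
    then have "\<exists>a. a \<in> {a \<in> hsupp f. r - a \<in> hsupp g}"
      unfolding mem_Collect_eq[of r] by (rule sum_nz_mem)
    then obtain a where "a \<in> {a \<in> hsupp f. r - a \<in> hsupp g}" ..
    then have "a + (r - a) \<in> sumset (hsupp f) (hsupp g)" by (intro sumsetI) auto
    then show "r \<in> sumset (hsupp f) (hsupp g)" by simp
  qed
  from hcoeff_Abs[OF wo_sumset[OF wo_hsupp wo_hsupp] this] show ?thesis
    by (simp add: times_hahn_def)
qed

text \<open>The index set of the convolution may be enlarged to any finite set that contains the
  relevant splittings, so that several products can be compared over one index set.\<close>

lemma hcoeff_times_eq:
  assumes "finite F" "\<And>a. a \<in> hsupp f \<Longrightarrow> r - a \<in> hsupp g \<Longrightarrow> a \<in> F"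
  shows "hcoeff (f * g) r = (\<Sum>a\<in>F. hcoeff f a * hcoeff g (r - a))"
  unfolding hcoeff_times
  using assms by (intro sum.mono_neutral_left) (auto simp: hsupp_def)

lemma hsupp_times: "hsupp (f * g) \<subseteq> sumset (hsupp f) (hsupp g)"
proof
  fix r assume "r \<in> hsupp (f * g)"
  then have "hcoeff (f * g) r \<noteq> 0" by (simp add: hsupp_def)
  then have "\<exists>a. a \<in> {a \<in> hsupp f. r - a \<in> hsupp g}"
    unfolding hcoeff_times by (rule sum_nz_mem)
  then obtain a where "a \<in> {a \<in> hsupp f. r - a \<in> hsupp g}" ..
  then have "a + (r - a) \<in> sumset (hsupp f) (hsupp g)" by (intro sumsetI) auto
  then show "r \<in> sumset (hsupp f) (hsupp g)" by simp
qed

lemma times_hahn_commute: "f * g = g * (f :: 'a hahn)"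
proof (rule hahn_eqI)
  fix r
  show "hcoeff (f * g) r = hcoeff (g * f) r"
    unfolding hcoeff_times
    by (rule sum.reindex_bij_witness[of _ "\<lambda>a. r - a" "\<lambda>a. r - a"]) (auto simp: mult.commute)
qed

text \<open>Both sides become double sums over the same finite sets, A for the exponent of f and C
  for that of h, which determine the exponent of g. It remains to exchange the two sums.\<close>

lemma times_hahn_assoc: "f * g * h = f * (g * (h :: 'a hahn))"
proof (rule hahn_eqI)
  fix r
  define A where "A = {a \<in> hsupp f. r - a \<in> sumset (hsupp g) (hsupp h)}"
  define C where "C = {c \<in> hsupp h. r - c \<in> sumset (hsupp f) (hsupp g)}"
  have fin: "finite A" "finite C"
    unfolding A_def C_def by (intro finite_decompositions wo_sumset wo_hsupp)+
  have mem: "a \<in> A \<and> c \<in> C" if "a \<in> hsupp f" "c \<in> hsupp h" "r - c - a \<in> hsupp g" for a c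
    using that sumsetI[OF that(1,3)] sumsetI[OF that(3,2)]
    by (simp add: A_def C_def algebra_simps)
  have A: "a \<in> A" if "a \<in> hsupp f" "r - a \<in> hsupp (g * h)" for a
    using that hsupp_times by (auto simp: A_def)
  have C: "c \<in> C" if "c \<in> hsupp h" "r - c \<in> hsupp (f * g)" for c
    using that hsupp_times by (auto simp: C_def)
  have "hcoeff (f * g * h) r = (\<Sum>c\<in>C. hcoeff h c * hcoeff (f * g) (r - c))"
    unfolding times_hahn_commute[of "f * g"] by (intro hcoeff_times_eq fin C)
  also have "\<dots> = (\<Sum>c\<in>C. hcoeff h c * (\<Sum>a\<in>A. hcoeff f a * hcoeff g (r - c - a)))"
  proof (intro sum.cong refl)
    fix c assume "c \<in> C"
    then show "hcoeff h c * hcoeff (f * g) (r - c) =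
        hcoeff h c * (\<Sum>a\<in>A. hcoeff f a * hcoeff g (r - c - a))"
      using mem by (subst hcoeff_times_eq[OF fin(1)]) (auto simp: C_def)
  qed
  also have "\<dots> = (\<Sum>a\<in>A. hcoeff f a * (\<Sum>c\<in>C. hcoeff h c * hcoeff g (r - a - c)))"
    unfolding sum_distrib_left by (subst sum.swap) (simp add: algebra_simps)
  also have "\<dots> = (\<Sum>a\<in>A. hcoeff f a * hcoeff (g * h) (r - a))"
  proof (intro sum.cong refl)
    fix a assume a: "a \<in> A"
    have "c \<in> C" if "c \<in> hsupp h" "r - a - c \<in> hsupp g" for c
      using mem[of a c] that a by (simp add: A_def algebra_simps)
    then show "hcoeff f a * (\<Sum>c\<in>C. hcoeff h c * hcoeff g (r - a - c)) =
        hcoeff f a * hcoeff (g * h) (r - a)"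
      unfolding times_hahn_commute[of g] by (subst hcoeff_times_eq[OF fin(2)]) auto
  qed
  also have "\<dots> = hcoeff (f * (g * h)) r"
    by (rule hcoeff_times_eq[symmetric, OF fin(1) A])
  finally show "hcoeff (f * g * h) r = hcoeff (f * (g * h)) r" .
qed

lemma times_hahn_distrib: "(f + g) * h = f * h + g * (h :: 'a hahn)"
proof (rule hahn_eqI)
  fix r
  define A where "A = {a \<in> hsupp f \<union> hsupp g. r - a \<in> hsupp h}"
  have fin: "finite A" unfolding A_def by (intro finite_decompositions wo_Un wo_hsupp)
  have "hsupp (f + g) \<subseteq> hsupp f \<union> hsupp g" by (auto simp: hsupp_def)
  then have "hcoeff ((f + g) * h) r = (\<Sum>a\<in>A. hcoeff (f + g) a * hcoeff h (r - a))"
    by (intro hcoeff_times_eq fin) (auto simp: A_def)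
  also have "\<dots> = hcoeff (f * h) r + hcoeff (g * h) r"
    unfolding hcoeff_add distrib_right sum.distrib
    by (intro arg_cong2[of _ _ _ _ "(+)"] hcoeff_times_eq[symmetric] fin) (auto simp: A_def)
  finally show "hcoeff ((f + g) * h) r = hcoeff (f * h + g * h) r" by simp
qed

lemma times_hahn_one: "1 * f = (f :: 'a hahn)"
proof (rule hahn_eqI)
  fix r
  have "hcoeff (1 * f) r = (\<Sum>a\<in>{0}. hcoeff 1 a * hcoeff f (r - a))"
    by (rule hcoeff_times_eq) (auto simp: hsupp_def hcoeff_1 split: if_splits)
  then show "hcoeff (1 * f) r = hcoeff f r" by (simp add: hcoeff_1)
qed

instance
proof
  fix f g h :: "'a hahn"
  show "f * g * h = f * (g * h)" by (rule times_hahn_assoc)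
  show "f * g = g * f" by (rule times_hahn_commute)
  show "1 * f = f" by (rule times_hahn_one)
  show "(f + g) * h = f * h + g * h" by (rule times_hahn_distrib)
  have "hcoeff (0 :: 'a hahn) 0 \<noteq> hcoeff 1 0" by (simp add: hcoeff_1)
  then show "(0 :: 'a hahn) \<noteq> 1" by metis
qed (auto intro!: hahn_eqI)

end

instantiation hahn :: (linordered_ab_group_add) real_algebra_1
begin

definition "c *\<^sub>R f = Abs_hahn (\<lambda>p. c * hcoeff f p)"

lemma hcoeff_scaleR [simp]: "hcoeff (c *\<^sub>R f) p = c * hcoeff f p"
  unfolding scaleR_hahn_def by (subst hcoeff_Abs[OF wo_hsupp[of f]]) (auto simp: hsupp_def)

lemma times_hahn_scaleR: "c *\<^sub>R f * g = c *\<^sub>R (f * (g :: 'a hahn))"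
proof (rule hahn_eqI)
  fix r
  have "hcoeff (c *\<^sub>R f * g) r =
      (\<Sum>a\<in>{a \<in> hsupp f. r - a \<in> hsupp g}. hcoeff (c *\<^sub>R f) a * hcoeff g (r - a))"
    using hsupp_def by (intro hcoeff_times_eq finite_decompositions wo_hsupp) (auto simp: hsupp_def)
  then show "hcoeff (c *\<^sub>R f * g) r = hcoeff (c *\<^sub>R (f * g)) r"
    by (simp add: hcoeff_times sum_distrib_left mult.assoc)
qed

instance
proof
  fix a b :: real and f g :: "'a hahn"
  show "a *\<^sub>R f * g = a *\<^sub>R (f * g)" by (rule times_hahn_scaleR)
  show "f * a *\<^sub>R g = a *\<^sub>R (f * g)"
    by (simp add: times_hahn_scaleR mult.commute[of f])
qed (auto intro!: hahn_eqI simp: algebra_simps)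

end

lemma hcoeff_sum [simp]: "hcoeff (\<Sum>i\<in>I. F i) p = (\<Sum>i\<in>I. hcoeff (F i) p)"
  by (induction I rule: infinite_finite_induct) auto

lemma hsupp_add: "hsupp (f + g) \<subseteq> hsupp f \<union> hsupp g"
  by (auto simp: hsupp_def)

lemma hsupp_uminus [simp]: "hsupp (- f) = hsupp f"
  by (auto simp: hsupp_def)

lemma hsupp_scaleR: "hsupp (c *\<^sub>R f) \<subseteq> hsupp f"
  by (auto simp: hsupp_def)

lemma hsupp_0 [simp]: "hsupp 0 = {}"
  by (auto simp: hsupp_def)

lemma hsupp_1: "hsupp 1 = {0}"
  by (auto simp: hsupp_def hcoeff_1)

lemma hsupp_power:
  assumes "hsupp f \<subseteq> W"
  shows "hsupp (f ^ n) \<subseteq> nsum W n"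
proof (induction n)
  case (Suc n)
  have "hsupp (f ^ Suc n) \<subseteq> sumset (hsupp f) (hsupp (f ^ n))"
    using hsupp_times by simp
  also have "\<dots> \<subseteq> nsum W (Suc n)"
    unfolding nsum.simps by (intro sumset_mono assms Suc.IH)
  finally show ?case .
qed (simp add: hsupp_1)

definition hmonom :: "real \<Rightarrow> 'e \<Rightarrow> 'e::linordered_ab_group_add hahn" where
  "hmonom c p = Abs_hahn (\<lambda>q. if q = p then c else 0)"

lemma hcoeff_hmonom: "hcoeff (hmonom c p) q = (if q = p then c else 0)"
  unfolding hmonom_def by (subst hcoeff_Abs[OF wo_singleton[of p]]) (auto split: if_splits)

lemma hsupp_hmonom: "hsupp (hmonom c p) \<subseteq> {p}"
  by (auto simp: hsupp_def hcoeff_hmonom split: if_splits)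

lemma hcoeff_hmonom_times: "hcoeff (hmonom c p * f) r = c * hcoeff f (r - p)"
proof -
  have "hcoeff (hmonom c p * f) r = (\<Sum>a\<in>{p}. hcoeff (hmonom c p) a * hcoeff f (r - a))"
    by (rule hcoeff_times_eq) (use hsupp_hmonom[of c p] in auto)
  then show ?thesis by (simp add: hcoeff_hmonom)
qed

lemma hmonom_mult: "hmonom c p * hmonom d q = hmonom (c * d) (p + q)"
  by (rule hahn_eqI) (auto simp: hcoeff_hmonom_times hcoeff_hmonom algebra_simps)

lemma hmonom_1: "hmonom 1 0 = 1"
  by (rule hahn_eqI) (auto simp: hcoeff_hmonom hcoeff_1)

section \<open>Summable families\<close>

text \<open>Well-ordering is asked of the union of the supports, so that the coefficientwise sum is
  again a Hahn series.\<close>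

definition hsummable :: "('i \<Rightarrow> 'e::linordered_ab_group_add hahn) \<Rightarrow> 'i set \<Rightarrow> bool" where
  "hsummable F J \<longleftrightarrow> wo (\<Union>j\<in>J. hsupp (F j)) \<and> (\<forall>p. finite {j \<in> J. p \<in> hsupp (F j)})"

definition hsum :: "('i \<Rightarrow> 'e hahn) \<Rightarrow> 'i set \<Rightarrow> 'e::linordered_ab_group_add hahn" where
  "hsum F J = Abs_hahn (\<lambda>p. \<Sum>j\<in>{j \<in> J. p \<in> hsupp (F j)}. hcoeff (F j) p)"

lemma hsummableI:
  assumes "wo W" "\<And>j. j \<in> J \<Longrightarrow> hsupp (F j) \<subseteq> W" "\<And>p. finite {j \<in> J. p \<in> hsupp (F j)}"
  shows "hsummable F J"
  unfolding hsummable_def using assms(3) by (auto intro!: wo_subset[OF assms(1)] dest: assms(2))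

lemma hcoeff_hsum:
  assumes "hsummable F J"
  shows "hcoeff (hsum F J) p = (\<Sum>j\<in>{j \<in> J. p \<in> hsupp (F j)}. hcoeff (F j) p)"
proof -
  have "{p. (\<Sum>j\<in>{j \<in> J. p \<in> hsupp (F j)}. hcoeff (F j) p) \<noteq> 0} \<subseteq> (\<Union>j\<in>J. hsupp (F j))"
    (is "?L \<subseteq> _")
  proof
    fix p assume "p \<in> ?L"
    then have "\<exists>j. j \<in> {j \<in> J. p \<in> hsupp (F j)}"
      unfolding mem_Collect_eq[of p] by (rule sum_nz_mem)
    then show "p \<in> (\<Union>j\<in>J. hsupp (F j))" by blast
  qed
  with assms show ?thesis
    unfolding hsum_def hsummable_def by (subst hcoeff_Abs) auto
qed

lemma hcoeff_hsum_eq: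
  assumes "hsummable F J" "finite K" "K \<subseteq> J" "\<And>j. j \<in> J \<Longrightarrow> p \<in> hsupp (F j) \<Longrightarrow> j \<in> K"
  shows "hcoeff (hsum F J) p = (\<Sum>j\<in>K. hcoeff (F j) p)"
  unfolding hcoeff_hsum[OF assms(1)]
  using assms(2-4) by (intro sum.mono_neutral_left) (auto simp: hsupp_def)

lemma hsupp_hsum:
  assumes "hsummable F J" "\<And>j. j \<in> J \<Longrightarrow> hsupp (F j) \<subseteq> W"
  shows "hsupp (hsum F J) \<subseteq> W"
proof
  fix p assume "p \<in> hsupp (hsum F J)"
  then have "hcoeff (hsum F J) p \<noteq> 0" by (simp add: hsupp_def)
  then have "\<exists>j. j \<in> {j \<in> J. p \<in> hsupp (F j)}"
    unfolding hcoeff_hsum[OF assms(1)] by (rule sum_nz_mem)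
  then show "p \<in> W" using assms(2) by blast
qed

lemma hsum_cong:
  assumes "\<And>j. j \<in> J \<Longrightarrow> F j = G j"
  shows "hsum F J = hsum G J"
proof -
  have "{j \<in> J. p \<in> hsupp (F j)} = {j \<in> J. p \<in> hsupp (G j)}" for p using assms by auto
  then show ?thesis unfolding hsum_def using assms by (auto intro!: arg_cong[of _ _ Abs_hahn] sum.cong)
qed

lemma hsummable_subset: "hsummable F J \<Longrightarrow> I \<subseteq> J \<Longrightarrow> hsummable F I"
  unfolding hsummable_def
  by (auto intro: wo_subset finite_subset[of "{j \<in> I. _ j}" "{j \<in> J. _ j}"])

lemma hsum_mono_neutral:
  assumes "hsummable F J" "I \<subseteq> J" "\<And>j. j \<in> J - I \<Longrightarrow> F j = 0"
  shows "hsum F I = hsum F J"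
proof (rule hahn_eqI)
  fix p
  have fin: "finite {j \<in> I. p \<in> hsupp (F j)}"
    using hsummable_subset[OF assms(1,2)] by (simp add: hsummable_def)
  show "hcoeff (hsum F I) p = hcoeff (hsum F J) p"
    unfolding hcoeff_hsum[OF hsummable_subset[OF assms(1,2)]]
    by (rule hcoeff_hsum_eq[symmetric, OF assms(1) fin])
      (use assms(2,3) in \<open>fastforce simp: hsupp_def\<close>)+
qed

lemma hsummable_finite: "finite J \<Longrightarrow> hsummable F J"
  by (auto simp: hsummable_def intro: wo_finite_UN)

lemma hsum_finite: "finite J \<Longrightarrow> hsum F J = sum F J"
  by (rule hahn_eqI) (simp add: hcoeff_hsum_eq[OF hsummable_finite])

lemma hsum_add:
  assumes F: "hsummable F J" and G: "hsummable G J"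
  shows "hsummable (\<lambda>j. F j + G j) J" "hsum (\<lambda>j. F j + G j) J = hsum F J + hsum G J"
proof -
  have fin: "finite ({j \<in> J. p \<in> hsupp (F j)} \<union> {j \<in> J. p \<in> hsupp (G j)})" for p
    using F G by (simp add: hsummable_def)
  show *: "hsummable (\<lambda>j. F j + G j) J"
  proof (rule hsummableI)
    show "wo ((\<Union>j\<in>J. hsupp (F j)) \<union> (\<Union>j\<in>J. hsupp (G j)))"
      using F G by (auto simp: hsummable_def intro: wo_Un)
    show "hsupp (F j + G j) \<subseteq> (\<Union>j\<in>J. hsupp (F j)) \<union> (\<Union>j\<in>J. hsupp (G j))" if "j \<in> J" for j
      using hsupp_add[of "F j" "G j"] that by blast
    show "finite {j \<in> J. p \<in> hsupp (F j + G j)}" for p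
      by (rule finite_subset[OF _ fin[of p]]) (auto simp: hsupp_def)
  qed
  show "hsum (\<lambda>j. F j + G j) J = hsum F J + hsum G J"
  proof (rule hahn_eqI)
    fix p
    let ?K = "{j \<in> J. p \<in> hsupp (F j)} \<union> {j \<in> J. p \<in> hsupp (G j)}"
    have "hcoeff (hsum (\<lambda>j. F j + G j) J) p = (\<Sum>j\<in>?K. hcoeff (F j + G j) p)"
      by (rule hcoeff_hsum_eq[OF * fin]) (auto simp: hsupp_def)
    also have "\<dots> = hcoeff (hsum F J) p + hcoeff (hsum G J) p"
      unfolding hcoeff_add sum.distrib
      by (intro arg_cong2[of _ _ _ _ "(+)"] hcoeff_hsum_eq[symmetric] F G fin) auto
    finally show "hcoeff (hsum (\<lambda>j. F j + G j) J) p = hcoeff (hsum F J + hsum G J) p" by simp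
  qed
qed

lemma hsum_times:
  assumes F: "hsummable F I" and G: "hsummable G J"
  shows "hsummable (\<lambda>(i, j). F i * G j) (I \<times> J)"
    and "hsum (\<lambda>(i, j). F i * G j) (I \<times> J) = hsum F I * hsum G J"
proof -
  define A where "A = (\<Union>i\<in>I. hsupp (F i))"
  define B where "B = (\<Union>j\<in>J. hsupp (G j))"
  have A: "wo A" and B: "wo B" using F G by (auto simp: A_def B_def hsummable_def)
  have AB: "hsupp (hsum F I) \<subseteq> A" "hsupp (hsum G J) \<subseteq> B"
    by (rule hsupp_hsum[OF F] hsupp_hsum[OF G]; auto simp: A_def B_def)+
  \<comment> \<open>At a fixed exponent r only the finitely many splittings in \<open>D r\<close>
    matter, and each meets finitely many indices. \<open>I' r\<close> and \<open>J' r\<close>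
    collect these, and the claim becomes a rearrangement of finite sums.\<close>
  define D where "D r = {a \<in> A. r - a \<in> B}" for r
  have D: "finite (D r)" for r unfolding D_def by (rule finite_decompositions[OF A B])
  define I' where "I' r = (\<Union>a\<in>D r. {i \<in> I. a \<in> hsupp (F i)})" for r
  define J' where "J' r = (\<Union>a\<in>D r. {j \<in> J. r - a \<in> hsupp (G j)})" for r
  have fin: "finite (I' r)" "finite (J' r)" for r
    using D F G by (auto simp: I'_def J'_def hsummable_def)
  have sub: "I' r \<subseteq> I" "J' r \<subseteq> J" for r by (auto simp: I'_def J'_def)
  have mem: "i \<in> I' r \<and> j \<in> J' r \<and> a \<in> D r"
    if "i \<in> I" "j \<in> J" "a \<in> hsupp (F i)" "r - a \<in> hsupp (G j)" for i j a r
    using that unfolding I'_def J'_def D_def A_def B_def by blast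
  have ex: "\<exists>a. a \<in> hsupp (F i) \<and> r - a \<in> hsupp (G j)" if "r \<in> hsupp (F i * G j)" for i j r
  proof -
    from that hsupp_times have "r \<in> sumset (hsupp (F i)) (hsupp (G j))" ..
    then obtain a b where "a \<in> hsupp (F i)" "b \<in> hsupp (G j)" "r = a + b" by (rule sumsetE)
    then show ?thesis by (intro exI[of _ a]) simp
  qed
  have pairs: "(i, j) \<in> I' r \<times> J' r" if "i \<in> I" "j \<in> J" "r \<in> hsupp (F i * G j)" for i j r
    using ex[OF that(3)] mem[OF that(1,2)] by blast
  show *: "hsummable (\<lambda>(i, j). F i * G j) (I \<times> J)"
  proof (rule hsummableI[OF wo_sumset[OF A B]])
    fix ij assume "ij \<in> I \<times> J"
    then obtain i j where ij: "ij = (i, j)" "i \<in> I" "j \<in> J" by auto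
    have "hsupp (F i * G j) \<subseteq> sumset (hsupp (F i)) (hsupp (G j))" by (rule hsupp_times)
    also have "\<dots> \<subseteq> sumset A B" using ij by (intro sumset_mono) (auto simp: A_def B_def)
    finally show "hsupp (case ij of (i, j) \<Rightarrow> F i * G j) \<subseteq> sumset A B" using ij by simp
  next
    fix r
    have "{ij \<in> I \<times> J. r \<in> hsupp (case ij of (i, j) \<Rightarrow> F i * G j)} \<subseteq> I' r \<times> J' r"
      using pairs by auto
    then show "finite {ij \<in> I \<times> J. r \<in> hsupp (case ij of (i, j) \<Rightarrow> F i * G j)}"
      by (rule finite_subset) (simp add: fin)
  qed
  show "hsum (\<lambda>(i, j). F i * G j) (I \<times> J) = hsum F I * hsum G J"
  proof (rule hahn_eqI)
    fix r
    have "hcoeff (hsum (\<lambda>(i, j). F i * G j) (I \<times> J)) r =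
        (\<Sum>ij\<in>I' r \<times> J' r. hcoeff (case ij of (i, j) \<Rightarrow> F i * G j) r)"
      by (rule hcoeff_hsum_eq[OF * _ Sigma_mono[OF sub]]) (use fin pairs in auto)
    also have "\<dots> = (\<Sum>i\<in>I' r. \<Sum>j\<in>J' r. hcoeff (F i * G j) r)"
      by (simp add: sum.cartesian_product split_def)
    also have "\<dots> = (\<Sum>i\<in>I' r. \<Sum>j\<in>J' r. \<Sum>a\<in>D r. hcoeff (F i) a * hcoeff (G j) (r - a))"
    proof (intro sum.cong refl hcoeff_times_eq D)
      fix i j a assume "i \<in> I' r" "j \<in> J' r" "a \<in> hsupp (F i)" "r - a \<in> hsupp (G j)"
      then show "a \<in> D r" using mem[of i j a r] sub[of r] by blast
    qed
    also have "\<dots> = (\<Sum>i\<in>I' r. \<Sum>a\<in>D r. \<Sum>j\<in>J' r. hcoeff (F i) a * hcoeff (G j) (r - a))"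
      by (intro sum.cong refl sum.swap)
    also have "\<dots> = (\<Sum>a\<in>D r. \<Sum>i\<in>I' r. \<Sum>j\<in>J' r. hcoeff (F i) a * hcoeff (G j) (r - a))"
      by (rule sum.swap)
    also have "\<dots> = (\<Sum>a\<in>D r. (\<Sum>i\<in>I' r. hcoeff (F i) a) * (\<Sum>j\<in>J' r. hcoeff (G j) (r - a)))"
      by (simp add: sum_product)
    also have "\<dots> = (\<Sum>a\<in>D r. hcoeff (hsum F I) a * hcoeff (hsum G J) (r - a))"
    proof (intro sum.cong refl arg_cong2[of _ _ _ _ "(*)"])
      fix a assume "a \<in> D r"
      then show "(\<Sum>i\<in>I' r. hcoeff (F i) a) = hcoeff (hsum F I) a"
        by (intro hcoeff_hsum_eq[symmetric] F fin sub) (auto simp: I'_def)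
      show "(\<Sum>j\<in>J' r. hcoeff (G j) (r - a)) = hcoeff (hsum G J) (r - a)"
        using \<open>a \<in> D r\<close> by (intro hcoeff_hsum_eq[symmetric] G fin sub) (auto simp: J'_def)
    qed
    also have "\<dots> = hcoeff (hsum F I * hsum G J) r"
      by (rule hcoeff_times_eq[symmetric, OF D]) (use AB in \<open>auto simp: D_def\<close>)
    finally show "hcoeff (hsum (\<lambda>(i, j). F i * G j) (I \<times> J)) r = hcoeff (hsum F I * hsum G J) r" .
  qed
qed

lemma hsum_reindex:
  assumes "inj_on h I"
  shows "hsummable F (h ` I) \<longleftrightarrow> hsummable (\<lambda>i. F (h i)) I"
    and "hsum F (h ` I) = hsum (\<lambda>i. F (h i)) I"
proof -
  have eq: "{j \<in> h ` I. p \<in> hsupp (F j)} = h ` {i \<in> I. p \<in> hsupp (F (h i))}" for p by auto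
  have inj: "inj_on h {i \<in> I. p \<in> hsupp (F (h i))}" for p
    by (rule inj_on_subset[OF assms]) auto
  show "hsummable F (h ` I) \<longleftrightarrow> hsummable (\<lambda>i. F (h i)) I"
    unfolding hsummable_def eq by (simp add: finite_image_iff[OF inj])
  show "hsum F (h ` I) = hsum (\<lambda>i. F (h i)) I"
    unfolding hsum_def eq by (simp add: sum.reindex[OF inj])
qed

lemma hsum_times_left:
  assumes "hsummable F J"
  shows "hsummable (\<lambda>j. c * F j) J" "hsum (\<lambda>j. c * F j) J = c * hsum F J"
proof -
  \<comment> \<open>The factor c is treated as a family over one index, so that the product rule for
    families applies.\<close>
  have inj: "inj_on (Pair (0::nat)) J" by (auto simp: inj_on_def)
  have im: "{0} \<times> J = Pair (0::nat) ` J" by auto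
  have fin: "hsummable (\<lambda>_. c) {0::nat}" by (rule hsummable_finite) simp
  show "hsummable (\<lambda>j. c * F j) J"
    using hsum_times(1)[OF fin assms] unfolding im hsum_reindex(1)[OF inj] by simp
  show "hsum (\<lambda>j. c * F j) J = c * hsum F J"
    using hsum_times(2)[OF fin assms] unfolding im hsum_reindex(2)[OF inj]
    by (simp add: hsum_finite)
qed

lemma hsum_scaleR:
  assumes "hsummable F J"
  shows "hsummable (\<lambda>j. c *\<^sub>R F j) J" "hsum (\<lambda>j. c *\<^sub>R F j) J = c *\<^sub>R hsum F J"
  using hsum_times_left[OF assms, of "c *\<^sub>R 1"] by simp_all

text \<open>Fubini for summable families. At an exponent p only the finite set \<open>K p\<close> of
  pairs contributes, and this set is itself fibred over its first components.\<close>

lemma hsum_Sigma: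
  assumes F: "hsummable F (Sigma I J)"
  shows "\<And>i. i \<in> I \<Longrightarrow> hsummable (\<lambda>j. F (i, j)) (J i)"
    and "hsummable (\<lambda>i. hsum (\<lambda>j. F (i, j)) (J i)) I"
    and "hsum F (Sigma I J) = hsum (\<lambda>i. hsum (\<lambda>j. F (i, j)) (J i)) I"
proof -
  define W where "W = (\<Union>ij\<in>Sigma I J. hsupp (F ij))"
  have W: "wo W" using F by (simp add: W_def hsummable_def)
  define K where "K p = {ij \<in> Sigma I J. p \<in> hsupp (F ij)}" for p
  have K: "finite (K p)" for p using F by (simp add: K_def hsummable_def)
  show inner: "hsummable (\<lambda>j. F (i, j)) (J i)" if i: "i \<in> I" for i
  proof (rule hsummableI[OF W])
    show "hsupp (F (i, j)) \<subseteq> W" if "j \<in> J i" for j using that i by (auto simp: W_def)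
    show "finite {j \<in> J i. p \<in> hsupp (F (i, j))}" for p
      by (rule finite_subset[OF _ finite_imageI[OF K[of p], of snd]])
        (use i in \<open>force simp: K_def\<close>)
  qed
  have supp: "hsupp (hsum (\<lambda>j. F (i, j)) (J i)) \<subseteq> W" if i: "i \<in> I" for i
    by (rule hsupp_hsum[OF inner[OF i]]) (use i in \<open>auto simp: W_def\<close>)
  have fst: "i \<in> fst ` K p" if "i \<in> I" "p \<in> hsupp (hsum (\<lambda>j. F (i, j)) (J i))" for i p
  proof -
    from that(2) have "hcoeff (hsum (\<lambda>j. F (i, j)) (J i)) p \<noteq> 0" by (simp add: hsupp_def)
    then have "\<exists>j. j \<in> {j \<in> J i. p \<in> hsupp (F (i, j))}"
      unfolding hcoeff_hsum[OF inner[OF that(1)]] by (rule sum_nz_mem)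
    then obtain j where "j \<in> {j \<in> J i. p \<in> hsupp (F (i, j))}" ..
    then have "(i, j) \<in> K p" using that(1) by (auto simp: K_def)
    then show ?thesis by force
  qed
  show outer: "hsummable (\<lambda>i. hsum (\<lambda>j. F (i, j)) (J i)) I"
  proof (rule hsummableI[OF W supp])
    show "finite {i \<in> I. p \<in> hsupp (hsum (\<lambda>j. F (i, j)) (J i))}" for p
      by (rule finite_subset[OF _ finite_imageI[OF K[of p], of fst]]) (use fst in auto)
  qed
  show "hsum F (Sigma I J) = hsum (\<lambda>i. hsum (\<lambda>j. F (i, j)) (J i)) I"
  proof (rule hahn_eqI)
    fix p
    have *: "K p = Sigma (fst ` K p) (\<lambda>i. {j \<in> J i. p \<in> hsupp (F (i, j))})"
      by (force simp: K_def)
    have finJ: "finite {j \<in> J i. p \<in> hsupp (F (i, j))}" if "i \<in> I" for i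
      using inner[OF that] by (simp add: hsummable_def)
    have sub: "fst ` K p \<subseteq> I" by (auto simp: K_def)
    have "hcoeff (hsum F (Sigma I J)) p = (\<Sum>ij\<in>K p. hcoeff (F ij) p)"
      unfolding hcoeff_hsum[OF F] K_def ..
    also have "\<dots> = (\<Sum>i\<in>fst ` K p. \<Sum>j\<in>{j \<in> J i. p \<in> hsupp (F (i, j))}. hcoeff (F (i, j)) p)"
      by (subst *, subst sum.Sigma) (use K finJ sub in auto)
    also have "\<dots> = (\<Sum>i\<in>fst ` K p. hcoeff (hsum (\<lambda>j. F (i, j)) (J i)) p)"
      using sub by (intro sum.cong refl hcoeff_hsum[symmetric] inner) auto
    also have "\<dots> = hcoeff (hsum (\<lambda>i. hsum (\<lambda>j. F (i, j)) (J i)) I) p"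
      by (rule hcoeff_hsum_eq[symmetric, OF outer]) (use K fst sub in auto)
    finally show "hcoeff (hsum F (Sigma I J)) p =
        hcoeff (hsum (\<lambda>i. hsum (\<lambda>j. F (i, j)) (J i)) I) p" .
  qed
qed

lemma hsum_swap:
  assumes F: "hsummable (\<lambda>(i, j). F i j) (I \<times> J)"
  shows "hsum (\<lambda>i. hsum (F i) J) I = hsum (\<lambda>j. hsum (\<lambda>i. F i j) I) J"
proof -
  have inj: "inj_on prod.swap (J \<times> I)" by (auto simp: inj_on_def)
  have im: "I \<times> J = prod.swap ` (J \<times> I)" by (simp add: product_swap)
  have F': "hsummable (\<lambda>(j, i). F i j) (J \<times> I)"
    using F unfolding im hsum_reindex(1)[OF inj] by (simp add: split_def)
  have "hsum (\<lambda>(i, j). F i j) (I \<times> J) = hsum (\<lambda>(j, i). F i j) (J \<times> I)"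
    unfolding im hsum_reindex(2)[OF inj] by (simp add: split_def)
  then show ?thesis using hsum_Sigma(3)[OF F] hsum_Sigma(3)[OF F'] by simp
qed

section \<open>Evaluation of power series\<close>

lemma hahn_scaleR_power:
  "(c *\<^sub>R h) ^ n = c ^ n *\<^sub>R (h :: 'e::linordered_ab_group_add hahn) ^ n"
  by (induction n) (simp_all add: mult.commute)

lemma hsum_Cauchy_product:
  fixes F G :: "nat \<Rightarrow> 'e::linordered_ab_group_add hahn"
  assumes F: "hsummable F UNIV" and G: "hsummable G UNIV"
  shows "hsummable (\<lambda>n. \<Sum>i\<le>n. F i * G (n - i)) UNIV"
    and "hsum F UNIV * hsum G UNIV = hsum (\<lambda>n. \<Sum>i\<le>n. F i * G (n - i)) UNIV"
proof -
  \<comment> \<open>Enumerates the pairs of indices along antidiagonals.\<close>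
  define h where "h = (\<lambda>(n :: nat, i :: nat). (i, n - i))"
  let ?S = "Sigma UNIV (\<lambda>n. {..n})"
  have inj: "inj_on h ?S" by (auto simp: inj_on_def h_def)
  have im: "UNIV \<times> UNIV = h ` ?S"
  proof -
    have "(i, j) \<in> h ` ?S" for i j by (rule image_eqI[of _ _ "(i + j, i)"]) (auto simp: h_def)
    then show ?thesis by auto
  qed
  have S: "hsummable (\<lambda>s. F (fst (h s)) * G (snd (h s))) ?S"
    using hsum_times(1)[OF F G] unfolding im hsum_reindex(1)[OF inj] by (simp add: split_def)
  have eq: "hsum (\<lambda>i. F (fst (h (n, i))) * G (snd (h (n, i)))) {..n} = (\<Sum>i\<le>n. F i * G (n - i))" for n
    by (simp add: hsum_finite h_def)
  show "hsummable (\<lambda>n. \<Sum>i\<le>n. F i * G (n - i)) UNIV"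
    using hsum_Sigma(2)[OF S] unfolding eq .
  have "hsum F UNIV * hsum G UNIV = hsum (\<lambda>s. F (fst (h s)) * G (snd (h s))) ?S"
    using hsum_times(2)[OF F G] unfolding im hsum_reindex(2)[OF inj] by (simp add: split_def)
  then show "hsum F UNIV * hsum G UNIV = hsum (\<lambda>n. \<Sum>i\<le>n. F i * G (n - i)) UNIV"
    using hsum_Sigma(3)[OF S] unfolding eq by simp
qed

definition hpos :: "expo hahn \<Rightarrow> bool" where
  "hpos h \<longleftrightarrow> hsupp h \<subseteq> {0<..}"

lemma hpos_0 [simp]: "hpos 0"
  by (simp add: hpos_def)

lemma hpos_add: "hpos f \<Longrightarrow> hpos g \<Longrightarrow> hpos (f + g)"
  using hsupp_add[of f g] unfolding hpos_def by blast

lemma hpos_uminus [simp]: "hpos (- f) \<longleftrightarrow> hpos f"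
  by (simp add: hpos_def)

lemma hpos_scaleR: "hpos f \<Longrightarrow> hpos (c *\<^sub>R f)"
  using hsupp_scaleR[of c f] unfolding hpos_def by blast

definition hev :: "real fps \<Rightarrow> expo hahn \<Rightarrow> expo hahn" where
  "hev \<phi> e = hsum (\<lambda>j. fps_nth \<phi> j *\<^sub>R e ^ j) UNIV"

text \<open>An exponent is a sum of n generators for only finitely many n, so a family graded by the
  number of factors is summable as soon as each grade has finitely many nonzero members.\<close>

lemma hsummable_powers:
  assumes "hpos e" "\<And>i. i \<in> I \<Longrightarrow> hsupp (F i) \<subseteq> nsum (hsupp e) (n i)"
    "\<And>m. finite {i \<in> I. n i = m \<and> F i \<noteq> 0}"
  shows "hsummable F I"
proof (rule hsummableI)
  show "wo (gen_monoid (hsupp e))" using assms(1) by (intro wo_gen_monoid) (auto simp: hpos_def)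
  show "hsupp (F i) \<subseteq> gen_monoid (hsupp e)" if "i \<in> I" for i
    using assms(2)[OF that] nsum_subset_gen_monoid by blast
  fix p
  have "finite {m. p \<in> nsum (hsupp e) m}"
    using assms(1) by (intro finite_nsum_mem) (auto simp: hpos_def)
  then have "finite (\<Union>m\<in>{m. p \<in> nsum (hsupp e) m}. {i \<in> I. n i = m \<and> F i \<noteq> 0})"
    using assms(3) by blast
  then show "finite {i \<in> I. p \<in> hsupp (F i)}"
  proof (rule rev_finite_subset, intro subsetI)
    fix i assume i: "i \<in> {i \<in> I. p \<in> hsupp (F i)}"
    then have "F i \<noteq> 0" by auto
    with i show "i \<in> (\<Union>m\<in>{m. p \<in> nsum (hsupp e) m}. {i \<in> I. n i = m \<and> F i \<noteq> 0})"
      using assms(2) by blast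
  qed
qed

lemma hsummable_hev: "hpos e \<Longrightarrow> hsummable (\<lambda>j. c j *\<^sub>R e ^ j) UNIV"
proof (rule hsummable_powers[where n = "\<lambda>j. j"])
  fix j
  show "hsupp (c j *\<^sub>R e ^ j) \<subseteq> nsum (hsupp e) j"
    using hsupp_scaleR[of "c j" "e ^ j"] hsupp_power[of e "hsupp e" j] by blast
qed simp_all

lemma hsupp_hev:
  assumes "hpos e" "hsupp e \<subseteq> W"
  shows "hsupp (hev \<phi> e) \<subseteq> gen_monoid W"
  unfolding hev_def
proof (rule hsupp_hsum[OF hsummable_hev[OF assms(1)]])
  fix j
  show "hsupp (fps_nth \<phi> j *\<^sub>R e ^ j) \<subseteq> gen_monoid W"
    using hsupp_scaleR[of "fps_nth \<phi> j" "e ^ j"] hsupp_power[OF assms(2), of j]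
      nsum_subset_gen_monoid[of W j] by blast
qed

lemma hpos_hev:
  assumes "hpos e" "fps_nth \<phi> 0 = 0"
  shows "hpos (hev \<phi> e)"
  unfolding hpos_def hev_def
proof (rule hsupp_hsum[OF hsummable_hev[OF assms(1)]])
  fix j
  show "hsupp (fps_nth \<phi> j *\<^sub>R e ^ j) \<subseteq> {0<..}"
  proof (cases j)
    case (Suc n)
    have "hsupp (e ^ j) \<subseteq> {0<..}"
      using hsupp_power[of e "hsupp e" j] nsum_pos[of "hsupp e" n] assms(1)
      unfolding hpos_def Suc by blast
    then show ?thesis using hsupp_scaleR[of "fps_nth \<phi> j" "e ^ j"] by blast
  qed (use assms in simp)
qed

lemma hev_add: "hpos e \<Longrightarrow> hev (\<phi> + \<psi>) e = hev \<phi> e + hev \<psi> e"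
  unfolding hev_def by (simp add: scaleR_left_distrib hsum_add(2)[OF hsummable_hev hsummable_hev])

lemma hev_mult:
  assumes "hpos e"
  shows "hev (\<phi> * \<psi>) e = hev \<phi> e * hev \<psi> e"
proof -
  have "(\<Sum>i\<le>n. fps_nth \<phi> i *\<^sub>R e ^ i * fps_nth \<psi> (n - i) *\<^sub>R e ^ (n - i)) =
      fps_nth (\<phi> * \<psi>) n *\<^sub>R e ^ n" for n
    by (simp add: fps_mult_nth atLeast0AtMost scaleR_sum_left power_add[symmetric] mult.commute)
  then show ?thesis
    unfolding hev_def hsum_Cauchy_product(2)[OF hsummable_hev[OF assms] hsummable_hev[OF assms]]
    by simp
qed

lemma hev_finite:
  assumes "hpos e" "finite J" "\<And>j. j \<notin> J \<Longrightarrow> fps_nth \<phi> j = 0"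
  shows "hev \<phi> e = (\<Sum>j\<in>J. fps_nth \<phi> j *\<^sub>R e ^ j)"
  unfolding hev_def hsum_finite[OF assms(2), symmetric]
  by (rule hsum_mono_neutral[symmetric, OF hsummable_hev[OF assms(1)]]) (use assms(3) in auto)

lemma hev_1: "hpos e \<Longrightarrow> hev 1 e = 1"
  by (subst hev_finite[of e "{0}"]) auto

lemma hev_X: "hpos e \<Longrightarrow> hev fps_X e = e"
  by (subst hev_finite[of e "{1}"]) auto

lemma hev_power: "hpos e \<Longrightarrow> hev (\<phi> ^ n) e = hev \<phi> e ^ n"
  by (induction n) (simp_all add: hev_1 hev_mult)

text \<open>As \<psi> has no constant term, the j-th coefficient of its i-th power vanishes for i >
  j. Hence the double family is summable, and interchanging the sums produces the coefficients of
  the composed power series.\<close>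

lemma hev_compose:
  assumes e: "hpos e" and \<psi>: "fps_nth \<psi> 0 = 0"
  shows "hev \<phi> (hev \<psi> e) = hev (\<phi> oo \<psi>) e"
proof -
  let ?F = "\<lambda>i j. (fps_nth \<phi> i * fps_nth (\<psi> ^ i) j) *\<^sub>R e ^ j"
  have nz: "i \<le> j" if "fps_nth (\<psi> ^ i) j \<noteq> 0" for i j
    using that \<psi> startsby_zero_power_prefix[of \<psi> i] by (meson not_le)
  have S: "hsummable (\<lambda>(i, j). ?F i j) (UNIV \<times> UNIV)"
  proof (rule hsummable_powers[OF e, where n = snd])
    fix ij :: "nat \<times> nat"
    show "hsupp (case ij of (i, j) \<Rightarrow> ?F i j) \<subseteq> nsum (hsupp e) (snd ij)"
      unfolding split_def using hsupp_scaleR hsupp_power[of e "hsupp e"] by blast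
  next
    fix m :: nat
    have "{ij \<in> UNIV \<times> UNIV. snd ij = m \<and> (case ij of (i, j) \<Rightarrow> ?F i j) \<noteq> 0} \<subseteq> {..m} \<times> {m}"
      using nz by auto
    then show "finite {ij \<in> UNIV \<times> UNIV. snd ij = m \<and> (case ij of (i, j) \<Rightarrow> ?F i j) \<noteq> 0}"
      by (rule finite_subset) simp
  qed
  have "hev \<phi> (hev \<psi> e) = hsum (\<lambda>i. hsum (?F i) UNIV) UNIV"
    unfolding hev_def[of \<phi>] hev_power[OF e, symmetric]
    unfolding hev_def hsum_scaleR(2)[OF hsummable_hev[OF e], symmetric] by simp
  also have "\<dots> = hsum (\<lambda>j. hsum (\<lambda>i. ?F i j) UNIV) UNIV"
    by (rule hsum_swap[OF S])
  also have "\<dots> = hev (\<phi> oo \<psi>) e"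
    unfolding hev_def
  proof (rule hsum_cong)
    fix j :: nat
    have inj: "inj_on (\<lambda>i. (i, j)) UNIV" by (simp add: inj_on_def)
    have "hsummable (\<lambda>i. ?F i j) UNIV"
      using hsummable_subset[OF S, of "(\<lambda>i. (i, j)) ` UNIV"]
      unfolding hsum_reindex(1)[OF inj] by simp
    then have "hsum (\<lambda>i. ?F i j) {0..j} = hsum (\<lambda>i. ?F i j) UNIV"
      by (rule hsum_mono_neutral) (use nz in \<open>auto simp: not_le[symmetric]\<close>)
    then show "hsum (\<lambda>i. ?F i j) UNIV = fps_nth (\<phi> oo \<psi>) j *\<^sub>R e ^ j"
      by (simp add: hsum_finite fps_compose_nth scaleR_sum_left)
  qed
  finally show ?thesis .
qed

text \<open>\<open>hln e\<close> is \<open>log (1 + e)\<close>.\<close>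

definition hexp :: "expo hahn \<Rightarrow> expo hahn" where
  "hexp = hev (fps_exp 1)"

definition hln :: "expo hahn \<Rightarrow> expo hahn" where
  "hln = hev (fps_ln 1)"

lemma hpos_hln: "hpos e \<Longrightarrow> hpos (hln e)"
  unfolding hln_def by (rule hpos_hev) auto

text \<open>Without its constant term the exponential series can be substituted into other power
  series by \<open>hev_compose\<close>.\<close>

lemma hexp_minus_1: "hpos v \<Longrightarrow> hexp v - 1 = hev (fps_exp 1 - 1) v"
  using hev_add[of v "fps_exp 1 - 1" 1] by (simp add: hexp_def hev_1)

lemma hpos_hexp_minus_1: "hpos v \<Longrightarrow> hpos (hexp v - 1)"
  unfolding hexp_minus_1 by (rule hpos_hev) auto

lemma fps_exp_minus_1_ln:
  "(fps_exp 1 - 1) oo fps_ln 1 = (fps_X :: real fps)" "fps_ln 1 oo (fps_exp 1 - 1) = (fps_X :: real fps)"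
  using fps_inv_right[of "fps_exp 1 - 1 :: real fps"] fps_inv[of "fps_exp 1 - 1 :: real fps"]
  by (simp_all add: fps_ln_fps_exp_inv)

lemma hexp_hln:
  assumes "hpos e"
  shows "hexp (hln e) = 1 + e"
proof -
  have "hexp (hln e) - 1 = hev ((fps_exp 1 - 1) oo fps_ln 1) e"
    unfolding hexp_minus_1[OF hpos_hln[OF assms]] unfolding hln_def
    by (rule hev_compose[OF assms]) simp
  then show ?thesis by (simp add: fps_exp_minus_1_ln hev_X[OF assms] algebra_simps)
qed

lemma hln_hexp:
  assumes "hpos v"
  shows "hln (hexp v - 1) = v"
  unfolding hexp_minus_1[OF assms] hln_def
  by (subst hev_compose[OF assms]) (simp_all add: fps_exp_minus_1_ln hev_X[OF assms])

lemma hexp_inject: "hpos v \<Longrightarrow> hpos w \<Longrightarrow> hexp v = hexp w \<Longrightarrow> v = w"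
  by (metis hln_hexp)

lemma hev_0: "hev \<phi> 0 = fps_nth \<phi> 0 *\<^sub>R 1"
proof -
  have "hsum (\<lambda>j. fps_nth \<phi> j *\<^sub>R (0 :: expo hahn) ^ j) {0} = hev \<phi> 0"
    unfolding hev_def by (rule hsum_mono_neutral[OF hsummable_hev]) (auto simp: power_0_left)
  then show ?thesis by (simp add: hsum_finite)
qed

lemma hexp_0 [simp]: "hexp 0 = 1"
  by (simp add: hexp_def hev_0)

lemma hexp_add:
  assumes "hpos v" "hpos w"
  shows "hexp (v + w) = hexp v * hexp w"
proof -
  have "(\<Sum>i\<le>n. fps_nth (fps_exp 1) i *\<^sub>R v ^ i * fps_nth (fps_exp 1) (n - i) *\<^sub>R w ^ (n - i)) =
      (1 / fact n) *\<^sub>R (v + w) ^ n" for n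
  proof -
    have "(1 / fact n) *\<^sub>R (v + w) ^ n =
        (\<Sum>i\<le>n. (1 / fact n) *\<^sub>R (real (n choose i) *\<^sub>R (v ^ i * w ^ (n - i))))"
      unfolding binomial_ring scaleR_sum_right by (simp add: scaleR_conv_of_real mult.assoc)
    also have "\<dots> = (\<Sum>i\<le>n. (1 / fact i) *\<^sub>R v ^ i * (1 / fact (n - i)) *\<^sub>R w ^ (n - i))"
      by (intro sum.cong refl) (simp add: binomial_fact field_simps)
    finally show ?thesis by (simp add: fps_exp_def)
  qed
  then show ?thesis
    unfolding hexp_def hev_def
      hsum_Cauchy_product(2)[OF hsummable_hev[OF assms(1)] hsummable_hev[OF assms(2)]]
    by (simp add: fps_exp_def)
qed

lemma hexp_power: "hpos v \<Longrightarrow> hexp v ^ n = hexp (real n *\<^sub>R v)"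
  by (induction n) (simp_all add: hexp_add[symmetric] hpos_scaleR scaleR_left_distrib algebra_simps)

lemma hexp_minus: "hpos v \<Longrightarrow> hexp v * hexp (- v) = 1"
  by (simp add: hexp_add[symmetric])

text \<open>Both sides solve (1 + X) y' = c y with y(0) = 1. The identity turns a binomial power of
  1 + e into the exponential of c log (1 + e).\<close>

lemma fps_exp_compose_ln: "fps_exp c oo fps_ln 1 = (fps_binomial c :: real fps)"
proof -
  have "fps_deriv (fps_exp c oo fps_ln 1) = (fps_const c * fps_exp c oo fps_ln 1) * inverse (1 + fps_X)"
    by (subst fps_compose_deriv) (simp_all add: fps_ln_deriv)
  also have "\<dots> = fps_const c * (fps_exp c oo fps_ln 1) / (1 + fps_X)"
    by (subst fps_divide_unit) (simp_all add: fps_const_mult_apply_left)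
  finally show ?thesis by (subst fps_binomial_ODE_unique'[symmetric]) simp
qed

lemma hev_binomial:
  assumes "hpos e"
  shows "hev (fps_binomial c) e = hexp (c *\<^sub>R hln e)"
proof -
  have "hexp (c *\<^sub>R hln e) = hev (fps_exp c) (hln e)"
    unfolding hexp_def hev_def
    by (rule hsum_cong) (simp add: fps_exp_def hahn_scaleR_power)
  also have "\<dots> = hev (fps_exp c oo fps_ln 1) e"
    unfolding hln_def by (rule hev_compose[OF assms]) simp
  finally show ?thesis by (simp add: fps_exp_compose_ln)
qed

text \<open>The alternating geometric series, which \<open>series_inverse\<close> sums, is the
  binomial series of exponent -1.\<close>

lemma hev_minus_one_powers:
  assumes "hpos e"
  shows "hev (Abs_fps (\<lambda>j. (- 1) ^ j)) e = hexp (- hln e)"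
proof -
  have "Abs_fps (\<lambda>j. (- 1) ^ j) = (fps_binomial (- 1) :: real fps)"
    by (rule fps_ext) (simp add: gbinomial_minus binomial_gbinomial[symmetric])
  then show ?thesis using hev_binomial[OF assms, of "- 1"] by simp
qed

section \<open>Composition in logarithmic coordinates\<close>

text \<open>
  Every series \<open>a x\<^sup>b (1 + \<epsilon>)\<close> is written as \<open>a x\<^sup>b exp v\<close>; for such a series \<open>f\<close>
  one has \<open>x\<^sup>\<alpha> \<circ> f = a\<^sup>\<alpha> x\<^sup>b\<^sup>\<alpha> exp (\<alpha> v)\<close> and \<open>\<ell> \<circ> f = b\<^sup>-\<^sup>1 \<ell> exp w\<close>, where \<open>w\<close> is \<open>hw a b v\<close>.
\<close>

definition fser :: "real \<Rightarrow> real \<Rightarrow> expo hahn \<Rightarrow> expo hahn" where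
  "fser a b v = hmonom a (Expo b 0) * hexp v"

text \<open>From log f = log a + b log x + v and log x = -1/\<ell> one gets log f = -(b/\<ell>) (1 +
  \<delta>) with this \<delta>. Hence \<ell> \<circ> f = (\<ell>/b) / (1 + \<delta>), and
  \<open>hw\<close> is -log (1 + \<delta>).\<close>

definition hdelta :: "real \<Rightarrow> real \<Rightarrow> expo hahn \<Rightarrow> expo hahn" where
  "hdelta a b v = hmonom (- 1 / b) (Expo 0 1) * (hmonom (ln a) 0 + v)"

definition hw :: "real \<Rightarrow> real \<Rightarrow> expo hahn \<Rightarrow> expo hahn" where
  "hw a b v = - hln (hdelta a b v)"

text \<open>The leading exponent of the composition of the monomial p with a series that begins with
  a multiple of x^b.\<close>

definition tw :: "real \<Rightarrow> expo \<Rightarrow> expo" where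
  "tw b p = Expo (b * xdeg p) (ldeg p)"

text \<open>The image of the monomial p under composition with f, as \<open>kern_ser\<close>
  confirms.\<close>

definition kern :: "real \<Rightarrow> real \<Rightarrow> expo hahn \<Rightarrow> expo \<Rightarrow> expo hahn" where
  "kern a b v p = hmonom (a powr xdeg p * b powr - real_of_int (ldeg p)) (tw b p) *
     hexp (xdeg p *\<^sub>R v + of_int (ldeg p) *\<^sub>R hw a b v)"

definition hcomp :: "real \<Rightarrow> real \<Rightarrow> expo hahn \<Rightarrow> expo hahn \<Rightarrow> expo hahn" where
  "hcomp a b v h = hsum (\<lambda>p. hcoeff h p *\<^sub>R kern a b v p) (hsupp h)"

text \<open>All exponents of \<open>kern a b v p\<close> lie in \<open>tw b p\<close> plus this
  monoid. It does not depend on p, which makes families of kernels summable.\<close>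

definition kmonoid :: "expo hahn \<Rightarrow> expo set" where
  "kmonoid v = gen_monoid (insert (Expo 0 1) (hsupp v))"

lemma Expo_0_1_pos [simp]: "0 < Expo 0 1"
  by (simp add: less_expo_def)

section \<open>Supports of the kernels\<close>

lemma hmonom_add: "hmonom c p + hmonom d p = hmonom (c + d) p"
  by (rule hahn_eqI) (simp add: hcoeff_hmonom)

lemma hmonom_scaleR: "c *\<^sub>R hmonom d p = hmonom (c * d) p"
  by (rule hahn_eqI) (simp add: hcoeff_hmonom)

lemma hsupp_hmonom_times: "hsupp (hmonom c p * h) \<subseteq> sumset {p} (hsupp h)"
  using hsupp_times[of "hmonom c p" h] sumset_mono[OF hsupp_hmonom[of c p] order_refl] by blast

lemma kmonoid_pos: "hpos v \<Longrightarrow> insert (Expo 0 1) (hsupp v) \<subseteq> {0<..}"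
  by (simp add: hpos_def)

lemma wo_kmonoid: "hpos v \<Longrightarrow> wo (kmonoid v)"
  unfolding kmonoid_def by (intro wo_gen_monoid kmonoid_pos) simp

lemma kmonoid_nonneg: "hpos v \<Longrightarrow> kmonoid v \<subseteq> {0..}"
  unfolding kmonoid_def by (intro gen_monoid_nonneg order_trans[OF kmonoid_pos]) auto

lemma hsupp_kmonoid: "hsupp v \<subseteq> kmonoid v"
  unfolding kmonoid_def using subset_gen_monoid[of "insert (Expo 0 1) (hsupp v)"] by simp

lemma ell_kmonoid: "Expo 0 1 \<in> kmonoid v"
  unfolding kmonoid_def using subset_gen_monoid[of "insert (Expo 0 1) (hsupp v)"] by simp

lemma gen_monoid_kmonoid: "W \<subseteq> kmonoid v \<Longrightarrow> gen_monoid W \<subseteq> kmonoid v"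
  unfolding kmonoid_def by (rule gen_monoid_least) (simp_all add: gen_monoid_add)

lemma hsupp_hdelta: "hsupp (hdelta a b v) \<subseteq> sumset {Expo 0 1} (insert 0 (hsupp v))"
  unfolding hdelta_def
  by (rule order_trans[OF hsupp_hmonom_times sumset_mono[OF order_refl]])
    (use hsupp_add[of "hmonom (ln a) 0" v] hsupp_hmonom[of "ln a" 0] in auto)

lemma hsupp_hdelta_kmonoid: "hsupp (hdelta a b v) \<subseteq> kmonoid v"
proof -
  have "sumset {Expo 0 1} (insert 0 (hsupp v)) \<subseteq> kmonoid v"
  proof
    fix p assume "p \<in> sumset {Expo 0 1} (insert 0 (hsupp v))"
    then obtain q where "q \<in> insert 0 (hsupp v)" "p = Expo 0 1 + q" by (auto simp: sumset_def)
    moreover from this(1) have "q \<in> kmonoid v"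
      using hsupp_kmonoid[of v] by (auto simp: kmonoid_def)
    ultimately show "p \<in> kmonoid v"
      using ell_kmonoid[of v] gen_monoid_add unfolding kmonoid_def by blast
  qed
  with hsupp_hdelta show ?thesis by blast
qed

lemma hpos_hdelta:
  assumes "hpos v"
  shows "hpos (hdelta a b v)"
  unfolding hpos_def
proof
  fix p assume "p \<in> hsupp (hdelta a b v)"
  then obtain q where q: "q \<in> insert 0 (hsupp v)" "p = Expo 0 1 + q"
    using hsupp_hdelta[of a b v] by (auto simp: sumset_def)
  then have "0 \<le> q" using assms by (auto simp: hpos_def)
  then show "p \<in> {0<..}" using q(2) add_pos_nonneg[OF Expo_0_1_pos] by simp
qed

lemma hpos_hw: "hpos v \<Longrightarrow> hpos (hw a b v)"
  unfolding hw_def by (simp add: hpos_hln hpos_hdelta)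

lemma hexp_minus_hw: "hpos v \<Longrightarrow> hexp (- hw a b v) = 1 + hdelta a b v"
  unfolding hw_def by (simp add: hexp_hln hpos_hdelta)

lemma hsupp_hw: "hpos v \<Longrightarrow> hsupp (hw a b v) \<subseteq> kmonoid v"
  unfolding hw_def hln_def hsupp_uminus
  by (rule order_trans[OF hsupp_hev[OF hpos_hdelta order_refl] gen_monoid_kmonoid])
    (auto simp: hsupp_hdelta_kmonoid)

lemma hpos_kern_exponent: "hpos v \<Longrightarrow> hpos (s *\<^sub>R v + t *\<^sub>R hw a b v)"
  by (intro hpos_add hpos_scaleR hpos_hw)

lemma hsupp_kern_exp:
  assumes "hpos v"
  shows "hsupp (hexp (s *\<^sub>R v + t *\<^sub>R hw a b v)) \<subseteq> kmonoid v"
  unfolding hexp_def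
proof (rule order_trans[OF hsupp_hev[OF hpos_kern_exponent[OF assms] order_refl] gen_monoid_kmonoid])
  show "hsupp (s *\<^sub>R v + t *\<^sub>R hw a b v) \<subseteq> kmonoid v"
    using hsupp_add[of "s *\<^sub>R v" "t *\<^sub>R hw a b v"] hsupp_scaleR[of s v]
      hsupp_scaleR[of t "hw a b v"] hsupp_hw[OF assms, of a b] hsupp_kmonoid[of v] by blast
qed

lemma hsupp_kern: "hpos v \<Longrightarrow> hsupp (kern a b v p) \<subseteq> sumset {tw b p} (kmonoid v)"
  unfolding kern_def
  by (rule order_trans[OF hsupp_hmonom_times sumset_mono[OF order_refl hsupp_kern_exp]])

lemma tw_add: "tw b (p + q) = tw b p + tw b q"
  by (simp add: tw_def expo_eq_iff algebra_simps)

lemma tw_0 [simp]: "tw b 0 = 0"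
  by (simp add: tw_def expo_eq_iff)

lemma tw_less: "0 < b \<Longrightarrow> tw b p < tw b q \<longleftrightarrow> p < q"
  by (auto simp: tw_def less_expo_def)

lemma tw_le: "0 < b \<Longrightarrow> tw b p \<le> tw b q \<longleftrightarrow> p \<le> q"
  by (auto simp: tw_def less_eq_expo_def)

lemma tw_pos: "0 < b \<Longrightarrow> 0 < tw b p \<longleftrightarrow> 0 < p"
  using tw_less[of b 0 p] by simp

lemma tw_tw: "tw b (tw c p) = tw (b * c) p"
  by (simp add: tw_def)

lemma tw_1 [simp]: "tw 1 p = p"
  by (simp add: tw_def)

text \<open>Multiplicativity on monomials; strong linearity extends it to all series in
  \<open>hcomp_times\<close>.\<close>

lemma kern_add:
  assumes "0 < a" "0 < b" "hpos v"
  shows "kern a b v (p + q) = kern a b v p * kern a b v q"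
proof -
  let ?e = "\<lambda>p. xdeg p *\<^sub>R v + of_int (ldeg p) *\<^sub>R hw a b v"
  have "hexp (?e (p + q)) = hexp (?e p) * hexp (?e q)"
    by (simp add: hexp_add[symmetric] hpos_kern_exponent assms(3) algebra_simps)
  moreover have c: "a powr xdeg (p + q) * b powr - real_of_int (ldeg (p + q)) =
      (a powr xdeg p * b powr - real_of_int (ldeg p)) * (a powr xdeg q * b powr - real_of_int (ldeg q))"
  proof -
    have eq: "- real_of_int (ldeg (p + q)) = - real_of_int (ldeg p) + - real_of_int (ldeg q)" by simp
    show ?thesis by (simp only: eq powr_add xdeg_simps mult_ac)
  qed
  then have "hmonom (a powr xdeg (p + q) * b powr - real_of_int (ldeg (p + q))) (tw b (p + q)) =
      hmonom (a powr xdeg p * b powr - real_of_int (ldeg p)) (tw b p) *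
      hmonom (a powr xdeg q * b powr - real_of_int (ldeg q)) (tw b q)"
    by (simp only: tw_add hmonom_mult)
  ultimately show ?thesis
    unfolding kern_def by (simp only: mult_ac)
qed

lemma kern_0:
  assumes "0 < a" "0 < b"
  shows "kern a b v 0 = 1"
  using assms by (simp add: kern_def hmonom_1)

lemma finite_kern_mem:
  assumes "0 < b" "hpos v" "wo S"
  shows "finite {p \<in> S. r \<in> sumset {tw b p} (kmonoid v)}"
proof -
  have "wo (tw b ` S)" using assms(1,3) by (intro wo_mono_image) (auto simp: tw_le)
  then have "finite {t \<in> tw b ` S. r - t \<in> kmonoid v}"
    by (intro finite_decompositions wo_kmonoid assms)
  moreover have "tw b ` {p \<in> S. r \<in> sumset {tw b p} (kmonoid v)} \<subseteq> {t \<in> tw b ` S. r - t \<in> kmonoid v}"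
    by (auto simp: sumset_def)
  moreover have "inj (tw b)"
    using tw_le[OF assms(1)] by (intro injI order_antisym) (metis order_refl)+
  ultimately show ?thesis
    using finite_subset finite_image_iff inj_on_subset by (metis (no_types, lifting) subset_UNIV)
qed

text \<open>The index set may differ from the set of exponents, because interchanging composition
  with an infinite sum leads to kernels indexed by pairs.\<close>

lemma hsummable_kern_family:
  assumes "0 < b" "hpos v" "wo S" "\<And>i. i \<in> I \<Longrightarrow> g i \<in> S"
    "\<And>p. finite {i \<in> I. g i = p \<and> c i \<noteq> 0}"
  shows "hsummable (\<lambda>i. c i *\<^sub>R kern a b v (g i)) I"
proof (rule hsummableI)
  show "wo (sumset (tw b ` S) (kmonoid v))"
    using assms(1-3) by (intro wo_sumset wo_kmonoid wo_mono_image) (auto simp: tw_le)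
  show "hsupp (c i *\<^sub>R kern a b v (g i)) \<subseteq> sumset (tw b ` S) (kmonoid v)" if "i \<in> I" for i
    using hsupp_scaleR[of "c i"] hsupp_kern[OF assms(2), of a b "g i"] assms(4)[OF that]
      sumset_mono[of "{tw b (g i)}" "tw b ` S" "kmonoid v" "kmonoid v"] by blast
  fix r
  have "{i \<in> I. r \<in> hsupp (c i *\<^sub>R kern a b v (g i))} \<subseteq>
      (\<Union>p\<in>{p \<in> S. r \<in> sumset {tw b p} (kmonoid v)}. {i \<in> I. g i = p \<and> c i \<noteq> 0})"
  proof
    fix i assume i: "i \<in> {i \<in> I. r \<in> hsupp (c i *\<^sub>R kern a b v (g i))}"
    then have "c i \<noteq> 0" "r \<in> hsupp (kern a b v (g i))" by (auto simp: hsupp_def)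
    then show "i \<in> (\<Union>p\<in>{p \<in> S. r \<in> sumset {tw b p} (kmonoid v)}. {i \<in> I. g i = p \<and> c i \<noteq> 0})"
      using i assms(4) hsupp_kern[OF assms(2), of a b "g i"] by blast
  qed
  then show "finite {i \<in> I. r \<in> hsupp (c i *\<^sub>R kern a b v (g i))}"
    by (rule finite_subset) (intro finite_UN_I finite_kern_mem assms)
qed

lemma hsummable_kern:
  assumes "0 < b" "hpos v" "wo S"
  shows "hsummable (\<lambda>p. c p *\<^sub>R kern a b v p) S"
  using assms by (rule hsummable_kern_family) (auto intro: finite_subset[of _ "{_}"])

section \<open>Composition as a strongly linear ring homomorphism\<close>

lemma hcomp_eq:
  assumes "0 < b" "hpos v" "wo S" "hsupp h \<subseteq> S"
  shows "hcomp a b v h = hsum (\<lambda>p. hcoeff h p *\<^sub>R kern a b v p) S"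
  unfolding hcomp_def
  by (rule hsum_mono_neutral[OF hsummable_kern[OF assms(1-3)] assms(4)]) (auto simp: hsupp_def)

lemma hsupp_hcomp:
  assumes "0 < b" "hpos v" "hsupp h \<subseteq> S"
  shows "hsupp (hcomp a b v h) \<subseteq> sumset (tw b ` S) (kmonoid v)"
  unfolding hcomp_def
proof (rule hsupp_hsum[OF hsummable_kern[OF assms(1,2) wo_hsupp]])
  fix p assume "p \<in> hsupp h"
  then show "hsupp (hcoeff h p *\<^sub>R kern a b v p) \<subseteq> sumset (tw b ` S) (kmonoid v)"
    using hsupp_scaleR[of "hcoeff h p"] hsupp_kern[OF assms(2), of a b p] assms(3)
      sumset_mono[of "{tw b p}" "tw b ` S" "kmonoid v" "kmonoid v"] by blast
qed

lemma hpos_hcomp: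
  assumes "0 < b" "hpos v" "hpos h"
  shows "hpos (hcomp a b v h)"
  unfolding hpos_def
proof
  fix r assume "r \<in> hsupp (hcomp a b v h)"
  then obtain p q where pq: "p \<in> hsupp h" "q \<in> kmonoid v" "r = tw b p + q"
    using hsupp_hcomp[OF assms(1,2) order_refl, where h = h and a = a] by (auto simp: sumset_def)
  then have "0 < tw b p" "0 \<le> q"
    using assms kmonoid_nonneg[OF assms(2)] by (auto simp: hpos_def tw_pos)
  then show "r \<in> {0<..}" using pq(3) by (simp add: add_pos_nonneg)
qed

lemma hcomp_add:
  assumes "0 < b" "hpos v"
  shows "hcomp a b v (f + g) = hcomp a b v f + hcomp a b v g"
proof -
  let ?S = "hsupp f \<union> hsupp g"
  have S: "wo ?S" by (intro wo_Un wo_hsupp)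
  have "hsupp (f + g) \<subseteq> ?S" by (rule hsupp_add)
  note * = hcomp_eq[OF assms S]
  show ?thesis
    unfolding *[OF \<open>hsupp (f + g) \<subseteq> ?S\<close>] *[OF Un_upper1] *[OF Un_upper2]
    by (simp add: scaleR_left_distrib hsum_add(2)[OF hsummable_kern hsummable_kern] assms S)
qed

lemma hcomp_scaleR:
  assumes "0 < b" "hpos v"
  shows "hcomp a b v (c *\<^sub>R f) = c *\<^sub>R hcomp a b v f"
  unfolding hcomp_eq[OF assms wo_hsupp hsupp_scaleR] hcomp_eq[OF assms wo_hsupp order_refl, where h = f]
  by (simp add: hsum_scaleR(2)[OF hsummable_kern, symmetric] assms)

lemma hcomp_hmonom:
  assumes "0 < b" "hpos v"
  shows "hcomp a b v (hmonom c p) = c *\<^sub>R kern a b v p"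
  unfolding hcomp_eq[OF assms wo_singleton hsupp_hmonom]
  by (simp add: hsum_finite hcoeff_hmonom)

lemma hcomp_1: "0 < a \<Longrightarrow> 0 < b \<Longrightarrow> hpos v \<Longrightarrow> hcomp a b v 1 = 1"
  using hcomp_hmonom[of b v a 1 0] by (simp add: kern_0 hmonom_1)

lemma hcomp_uminus: "0 < b \<Longrightarrow> hpos v \<Longrightarrow> hcomp a b v (- f) = - hcomp a b v f"
  using hcomp_scaleR[of b v a "-1" f] by simp

text \<open>Strong linearity. An exponent p occurs in only finitely many F j, so the weighted
  kernels form a summable double family, and its two iterated sums are the two sides.\<close>

lemma hcomp_hsum:
  assumes b: "0 < b" "hpos v" and F: "hsummable F J"
  shows "hcomp a b v (hsum F J) = hsum (\<lambda>j. hcomp a b v (F j)) J"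
proof -
  define S where "S = (\<Union>j\<in>J. hsupp (F j))"
  have S: "wo S" using F by (simp add: S_def hsummable_def)
  have "hsummable (\<lambda>jp. hcoeff (F (fst jp)) (snd jp) *\<^sub>R kern a b v (snd jp)) (J \<times> S)"
  proof (rule hsummable_kern_family[OF b S])
    fix p
    have "finite ((\<lambda>j. (j, p)) ` {j \<in> J. p \<in> hsupp (F j)})" using F by (simp add: hsummable_def)
    then show "finite {jp \<in> J \<times> S. snd jp = p \<and> hcoeff (F (fst jp)) (snd jp) \<noteq> 0}"
      by (rule rev_finite_subset) (auto simp: hsupp_def)
  qed auto
  then have S2: "hsummable (\<lambda>(j, p). hcoeff (F j) p *\<^sub>R kern a b v p) (J \<times> S)"
    by (simp add: split_def)
  have "hsum (\<lambda>j. hcomp a b v (F j)) J = hsum (\<lambda>j. hsum (\<lambda>p. hcoeff (F j) p *\<^sub>R kern a b v p) S) J"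
    by (intro hsum_cong hcomp_eq b S) (auto simp: S_def)
  also have "\<dots> = hsum (\<lambda>p. hsum (\<lambda>j. hcoeff (F j) p *\<^sub>R kern a b v p) J) S"
    by (rule hsum_swap[OF S2])
  also have "\<dots> = hsum (\<lambda>p. hcoeff (hsum F J) p *\<^sub>R kern a b v p) S"
  proof (rule hsum_cong)
    fix p assume "p \<in> S"
    let ?J = "{j \<in> J. p \<in> hsupp (F j)}"
    have fin: "finite ?J" using F by (simp add: hsummable_def)
    have "hsummable (\<lambda>j. hcoeff (F j) p *\<^sub>R kern a b v p) J"
    proof (rule hsummableI[OF wo_hsupp[of "kern a b v p"]])
      show "finite {j \<in> J. r \<in> hsupp (hcoeff (F j) p *\<^sub>R kern a b v p)}" for r
        by (rule finite_subset[OF _ fin]) (auto simp: hsupp_def)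
    qed (rule hsupp_scaleR)
    then have "hsum (\<lambda>j. hcoeff (F j) p *\<^sub>R kern a b v p) ?J = hsum (\<lambda>j. hcoeff (F j) p *\<^sub>R kern a b v p) J"
      by (rule hsum_mono_neutral) (auto simp: hsupp_def)
    then show "hsum (\<lambda>j. hcoeff (F j) p *\<^sub>R kern a b v p) J = hcoeff (hsum F J) p *\<^sub>R kern a b v p"
      by (simp add: hsum_finite[OF fin] hcoeff_hsum[OF F] scaleR_sum_left)
  qed
  also have "\<dots> = hcomp a b v (hsum F J)"
    by (rule hcomp_eq[symmetric, OF b S hsupp_hsum[OF F]]) (auto simp: S_def)
  finally show ?thesis ..
qed

lemma hcoeff_hcomp_kern:
  assumes "0 < b" "hpos v" "wo S" "hsupp h \<subseteq> S"
  shows "finite {q \<in> S. hcoeff (kern a b v q) p \<noteq> 0}"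
    and "hcoeff (hcomp a b v h) p =
      (\<Sum>q\<in>{q \<in> S. hcoeff (kern a b v q) p \<noteq> 0}. hcoeff (kern a b v q) p * hcoeff h q)"
proof -
  show fin: "finite {q \<in> S. hcoeff (kern a b v q) p \<noteq> 0}"
  proof (rule finite_subset[OF _ finite_kern_mem[OF assms(1-3), of p]])
    show "{q \<in> S. hcoeff (kern a b v q) p \<noteq> 0} \<subseteq> {q \<in> S. p \<in> sumset {tw b q} (kmonoid v)}"
      using hsupp_kern[OF assms(2), of a b] unfolding hcoeff_nz by blast
  qed
  have "hcoeff (hcomp a b v h) p = (\<Sum>q\<in>{q \<in> S. hcoeff (kern a b v q) p \<noteq> 0}.
      hcoeff (hcoeff h q *\<^sub>R kern a b v q) p)"
    unfolding hcomp_eq[OF assms]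
    by (rule hcoeff_hsum_eq[OF hsummable_kern[OF assms(1-3)] fin]) (auto simp: hsupp_def)
  then show "hcoeff (hcomp a b v h) p =
      (\<Sum>q\<in>{q \<in> S. hcoeff (kern a b v q) p \<noteq> 0}. hcoeff (kern a b v q) p * hcoeff h q)"
    by (simp add: mult.commute)
qed

lemma hsum_hmonom:
  "hsummable (\<lambda>p. hmonom (hcoeff h p) p) (hsupp h)" "hsum (\<lambda>p. hmonom (hcoeff h p) p) (hsupp h) = h"
proof -
  have sub: "{q \<in> hsupp h. p \<in> hsupp (hmonom (hcoeff h q) q)} \<subseteq> {p}" for p
    using hsupp_hmonom by fast
  show *: "hsummable (\<lambda>p. hmonom (hcoeff h p) p) (hsupp h)"
  proof (rule hsummableI[OF wo_hsupp[of h]])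
    show "hsupp (hmonom (hcoeff h p) p) \<subseteq> hsupp h" if "p \<in> hsupp h" for p
      using hsupp_hmonom[of "hcoeff h p" p] that by auto
    show "finite {q \<in> hsupp h. p \<in> hsupp (hmonom (hcoeff h q) q)}" for p
      using sub by (rule finite_subset) simp
  qed
  show "hsum (\<lambda>p. hmonom (hcoeff h p) p) (hsupp h) = h"
  proof (rule hahn_eqI)
    fix p
    have "hcoeff (hsum (\<lambda>p. hmonom (hcoeff h p) p) (hsupp h)) p =
        (\<Sum>q\<in>(if p \<in> hsupp h then {p} else {}). hcoeff (hmonom (hcoeff h q) q) p)"
      by (rule hcoeff_hsum_eq[OF *]) (auto simp: hsupp_def hcoeff_hmonom split: if_splits)
    then show "hcoeff (hsum (\<lambda>p. hmonom (hcoeff h p) p) (hsupp h)) p = hcoeff h p"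
      by (auto simp: hcoeff_hmonom hsupp_def split: if_splits)
  qed
qed

lemma hcomp_times:
  assumes a: "0 < a" and b: "0 < b" "hpos v"
  shows "hcomp a b v (f * g) = hcomp a b v f * hcomp a b v g"
proof -
  note S = hsum_times[OF hsum_hmonom(1)[of f] hsum_hmonom(1)[of g], unfolded hsum_hmonom(2)]
  have "hcomp a b v (f * g) = hsum (\<lambda>pq. hcomp a b v (case pq of (p, q) \<Rightarrow>
      hmonom (hcoeff f p) p * hmonom (hcoeff g q) q)) (hsupp f \<times> hsupp g)"
    unfolding S(2)[symmetric] by (rule hcomp_hsum[OF b S(1)])
  also have "\<dots> = hsum (\<lambda>(p, q). (hcoeff f p *\<^sub>R kern a b v p) * (hcoeff g q *\<^sub>R kern a b v q))
      (hsupp f \<times> hsupp g)"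
    by (rule hsum_cong) (auto simp: hmonom_mult hcomp_hmonom b kern_add a)
  also have "\<dots> = hcomp a b v f * hcomp a b v g"
    unfolding hcomp_def by (rule hsum_times(2)[OF hsummable_kern hsummable_kern]) (simp_all add: b)
  finally show ?thesis .
qed

lemma hcomp_power:
  assumes "0 < a" "0 < b" "hpos v"
  shows "hcomp a b v (f ^ n) = hcomp a b v f ^ n"
  by (induction n) (simp_all add: hcomp_1 hcomp_times assms)

lemma hcomp_hev:
  assumes "0 < a" "0 < b" "hpos v" "hpos e"
  shows "hcomp a b v (hev \<phi> e) = hev \<phi> (hcomp a b v e)"
  unfolding hev_def
  by (subst hcomp_hsum[OF assms(2,3) hsummable_hev[OF assms(4)]])
    (simp add: hcomp_scaleR hcomp_power assms)

lemma hcomp_xpow: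
  assumes "0 < a" "0 < b" "hpos v"
  shows "hcomp a b v (hmonom c (Expo s 0)) = hmonom (c * a powr s) (Expo (b * s) 0) * hexp (s *\<^sub>R v)"
  unfolding hcomp_hmonom[OF assms(2,3)] kern_def
  using assms by (simp add: tw_def hmonom_scaleR flip: mult_scaleR_left)

lemma hcomp_const:
  assumes "0 < a" "0 < b" "hpos v"
  shows "hcomp a b v (hmonom c 0) = hmonom c 0"
  using hcomp_hmonom[of b v a c 0] assms by (simp add: kern_0 hmonom_scaleR flip: hmonom_1)

lemma hcomp_ell:
  assumes "0 < a" "0 < b" "hpos v"
  shows "hcomp a b v (hmonom c (Expo 0 1)) = hmonom (c / b) (Expo 0 1) * hexp (hw a b v)"
proof -
  have "b powr - 1 = 1 / b" using assms by (simp add: powr_minus field_simps)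
  then show ?thesis
    unfolding hcomp_hmonom[OF assms(2,3)] kern_def
    using assms by (simp add: tw_def hmonom_scaleR flip: mult_scaleR_left)
qed

lemma hcomp_fser:
  assumes "0 < a" "0 < b" "hpos v" "hpos v'"
  shows "hcomp a b v (fser a' b' v') = fser (a' * a powr b') (b * b') (b' *\<^sub>R v + hcomp a b v v')"
proof -
  have "hcomp a b v (hexp v') = hexp (hcomp a b v v')"
    unfolding hexp_def by (rule hcomp_hev[OF assms])
  then show ?thesis
    unfolding fser_def
    by (simp only: hcomp_times[OF assms(1-3)] hcomp_xpow[OF assms(1-3)] mult.assoc
      hexp_add[OF hpos_scaleR[OF assms(3)] hpos_hcomp[OF assms(2-4)]])
qed

text \<open>The cocycle rule behind the associative law for \<ell>. Both sides w are compared
  through exp (-w) = 1 + \<delta>, where \<delta> is linear in log a and v;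
  \<open>hexp_inject\<close> then removes the exponential.\<close>

lemma hw_comp:
  assumes a: "0 < a" "0 < a'" and b: "0 < b" "0 < b'" and v: "hpos v" "hpos v'"
  shows "hw (a' * a powr b') (b * b') (b' *\<^sub>R v + hcomp a b v v') = hw a b v + hcomp a b v (hw a' b' v')"
proof -
  let ?C = "hcomp a b v" and ?l = "Expo 0 1"
  let ?d = "hmonom (- 1 / (b * b')) ?l"
  have pos: "hpos (b' *\<^sub>R v + ?C v')" "hpos (hw a b v)" "hpos (?C (hw a' b' v'))"
    by (intro hpos_add hpos_scaleR hpos_hcomp hpos_hw b v)+
  have "hexp (- ?C (hw a' b' v')) = ?C (hexp (- hw a' b' v'))"
    unfolding hexp_def by (subst hcomp_hev) (simp_all add: a b v hpos_hw hcomp_uminus)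
  also have "\<dots> = 1 + ?C (hdelta a' b' v')"
    by (simp add: hexp_minus_hw v hcomp_add hcomp_1 a b)
  also have "?C (hdelta a' b' v') = ?d * hexp (hw a b v) * (hmonom (ln a') 0 + ?C v')"
  proof -
    have "- 1 / b' / b = - 1 / (b * b')" by simp
    then show ?thesis
      unfolding hdelta_def
      by (simp only: hcomp_times hcomp_add hcomp_const hcomp_ell a b v)
  qed
  finally have e: "hexp (- ?C (hw a' b' v')) = 1 + ?d * hexp (hw a b v) * (hmonom (ln a') 0 + ?C v')" .
  have "hexp (- (hw a b v + ?C (hw a' b' v'))) = hexp (- hw a b v) * hexp (- ?C (hw a' b' v'))"
    using hexp_add[of "- hw a b v" "- ?C (hw a' b' v')"] pos by simp
  also have "\<dots> = hexp (- hw a b v) * (1 + ?d * hexp (hw a b v) * (hmonom (ln a') 0 + ?C v'))"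
    unfolding e ..
  also have "\<dots> = hexp (- hw a b v) + hexp (hw a b v) * hexp (- hw a b v) * ?d * (hmonom (ln a') 0 + ?C v')"
    by (simp add: algebra_simps)
  also have "\<dots> = 1 + hdelta a b v + ?d * (hmonom (ln a') 0 + ?C v')"
    unfolding hexp_minus[OF pos(2)] unfolding hexp_minus_hw[OF v(1)] by (simp only: mult_1_left)
  \<comment> \<open>With the common factor -\<ell>/(b b') the two contributions add up to log (a'
    a^b') plus the new third coordinate.\<close>
  also have "hdelta a b v = ?d * (hmonom (b' * ln a) 0 + b' *\<^sub>R v)"
  proof -
    have "hmonom (- 1 / b) ?l = b' *\<^sub>R ?d" using b by (simp add: hmonom_scaleR)
    then show ?thesis unfolding hdelta_def by (simp add: distrib_left hmonom_scaleR[symmetric])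
  qed
  also have "1 + ?d * (hmonom (b' * ln a) 0 + b' *\<^sub>R v) + ?d * (hmonom (ln a') 0 + ?C v') =
      1 + ?d * (hmonom (ln a' + b' * ln a) 0 + (b' *\<^sub>R v + ?C v'))"
    unfolding hmonom_add[symmetric] by (simp add: algebra_simps)
  also have "\<dots> = 1 + hdelta (a' * a powr b') (b * b') (b' *\<^sub>R v + ?C v')"
    unfolding hdelta_def using a by (simp add: ln_mult)
  also have "\<dots> = hexp (- hw (a' * a powr b') (b * b') (b' *\<^sub>R v + ?C v'))"
    by (rule hexp_minus_hw[symmetric, OF pos(1)])
  finally have "- (hw a b v + ?C (hw a' b' v')) = - hw (a' * a powr b') (b * b') (b' *\<^sub>R v + ?C v')"
    by (rule hexp_inject[rotated 2]) (simp_all only: hpos_uminus hpos_add[OF pos(2,3)] hpos_hw[OF pos(1)])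
  then show ?thesis by (simp only: neg_equal_iff_equal)
qed

text \<open>Associativity on a single monomial: the power of x follows the group law of the
  coordinates, the power of \<ell> follows \<open>hw_comp\<close>.\<close>

lemma kern_comp:
  assumes a: "0 < a" "0 < a'" and b: "0 < b" "0 < b'" and v: "hpos v" "hpos v'"
  shows "hcomp a b v (kern a' b' v' p) = kern (a' * a powr b') (b * b') (b' *\<^sub>R v + hcomp a b v v') p"
proof -
  let ?C = "hcomp a b v" and ?s = "xdeg p" and ?t = "real_of_int (ldeg p)"
  let ?c = "a' powr ?s * b' powr - ?t"
  have pos: "hpos (?C v')" "hpos (hw a b v)" "hpos (?C (hw a' b' v'))"
    by (intro hpos_hcomp hpos_hw b v)+
  have "?C (hexp (?s *\<^sub>R v' + ?t *\<^sub>R hw a' b' v')) = hexp (?s *\<^sub>R ?C v' + ?t *\<^sub>R ?C (hw a' b' v'))"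
    unfolding hexp_def
    by (subst hcomp_hev) (simp_all add: a b v hpos_kern_exponent hcomp_add hcomp_scaleR)
  then have "?C (kern a' b' v' p) =
      ?c *\<^sub>R kern a b v (tw b' p) * hexp (?s *\<^sub>R ?C v' + ?t *\<^sub>R ?C (hw a' b' v'))"
    unfolding kern_def[of a'] by (simp add: hcomp_times hcomp_hmonom a b v)
  also have "\<dots> = hmonom (?c * (a powr (b' * ?s) * b powr - ?t)) (tw (b * b') p) *
      (hexp ((b' * ?s) *\<^sub>R v + ?t *\<^sub>R hw a b v) * hexp (?s *\<^sub>R ?C v' + ?t *\<^sub>R ?C (hw a' b' v')))"
    unfolding kern_def[of a] by (simp add: tw_tw hmonom_scaleR[symmetric] mult.assoc) (simp add: tw_def)
  also have "hexp ((b' * ?s) *\<^sub>R v + ?t *\<^sub>R hw a b v) * hexp (?s *\<^sub>R ?C v' + ?t *\<^sub>R ?C (hw a' b' v')) =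
      hexp (?s *\<^sub>R (b' *\<^sub>R v + ?C v') + ?t *\<^sub>R (hw a b v + ?C (hw a' b' v')))"
    by (subst hexp_add[symmetric])
      (simp_all add: hpos_add hpos_scaleR pos v algebra_simps)
  also have "?c * (a powr (b' * ?s) * b powr - ?t) = (a' * a powr b') powr ?s * (b * b') powr - ?t"
    using a b by (simp add: powr_mult powr_powr)
  finally show ?thesis unfolding kern_def[of "a' * a powr b'"] hw_comp[OF assms] .
qed

text \<open>Strong linearity extends \<open>kern_comp\<close> from monomials to all series.\<close>

lemma hcomp_comp:
  assumes a: "0 < a" "0 < a'" and b: "0 < b" "0 < b'" and v: "hpos v" "hpos v'"
  shows "hcomp a b v (hcomp a' b' v' h) = hcomp (a' * a powr b') (b * b') (b' *\<^sub>R v + hcomp a b v v') h"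
  unfolding hcomp_def[of a'] hcomp_def[of "a' * a powr b'"]
  by (subst hcomp_hsum[OF b(1) v(1) hsummable_kern[OF b(2) v(2) wo_hsupp]])
    (simp add: hcomp_scaleR b v kern_comp[OF assms])

lemma hcomp_id: "hcomp 1 1 0 h = h"
proof -
  have "hmonom 0 (0::expo) = 0" by (rule hahn_eqI) (simp add: hcoeff_hmonom)
  then have "hw 1 1 0 = 0" by (simp add: hw_def hdelta_def hln_def hev_0)
  then have "kern 1 1 0 p = hmonom 1 p" for p by (simp add: kern_def)
  then show ?thesis unfolding hcomp_def using hsum_hmonom(2)[of h] by (simp add: hmonom_scaleR)
qed

section \<open>Formal series as Hahn series\<close>

definition expo_of :: "real \<times> int \<Rightarrow> expo" where
  "expo_of p = Expo (fst p) (snd p)"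

definition ser :: "expo hahn \<Rightarrow> series" where
  "ser h = (\<lambda>p. hcoeff h (expo_of p))"

lemma expo_of_simps [simp]:
  "expo_of (p + q) = expo_of p + expo_of q" "expo_of (p - q) = expo_of p - expo_of q" "expo_of (- p) = - expo_of p"
  by (simp_all add: expo_of_def expo_eq_iff)

lemma expo_of_Pair [simp]: "expo_of (\<alpha>, k) = Expo \<alpha> k"
  by (simp add: expo_of_def)

lemma expo_of_eq_iff [simp]: "expo_of p = expo_of q \<longleftrightarrow> p = q"
  by (simp add: expo_of_def prod_eq_iff)

lemma expo_of_le_iff: "expo_of p \<le> expo_of q \<longleftrightarrow> p \<preceq> q"
  by (simp add: expo_of_def less_eq_expo_def lex_le_def)

lemma expo_of_surj: "\<exists>p. e = expo_of p"
  by (rule exI[of _ "(xdeg e, ldeg e)"]) (simp add: expo_of_def)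

lemma range_expo_of: "range expo_of = UNIV"
  using expo_of_surj by blast

lemma expo_of_image_vimage: "expo_of ` (expo_of -` X) = X"
  by (simp add: image_vimage_eq range_expo_of)

lemma inj_expo_of: "inj_on expo_of A"
  by (simp add: inj_on_def)

lemma Expo_0_0: "Expo 0 0 = 0"
  by (simp add: zero_expo_def)

text \<open>The relation is a linear order on every S, so only well-foundedness of its strict part
  is at stake, and this is the existence of least elements.\<close>

lemma well_ordered_iff_wo: "well_ordered S \<longleftrightarrow> wo (expo_of ` S)"
proof -
  let ?r = "{(p, q). p \<in> S \<and> q \<in> S \<and> p \<preceq> q}"
  let ?R = "{(q, p). q \<in> expo_of ` S \<and> p \<in> expo_of ` S \<and> q < p}"
  have lin: "linear_order_on S ?r"
    unfolding linear_order_on_def partial_order_on_def preorder_on_def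
      refl_on_def trans_def antisym_def total_on_def expo_of_le_iff[symmetric]
    by (auto dest: order_trans order_antisym)
  have "wf (?r - Id) \<longleftrightarrow> wo (expo_of ` S)"
  proof
    assume wf: "wf (?r - Id)"
    show "wo (expo_of ` S)"
    proof (rule woI)
      fix X assume X: "X \<subseteq> expo_of ` S" "X \<noteq> {}"
      have Y: "expo_of -` X \<subseteq> S" using X(1) by force
      from X(2) expo_of_image_vimage[of X] obtain z where z: "z \<in> expo_of -` X" by blast
      have "\<exists>m\<in>expo_of -` X. \<forall>y. (y, m) \<in> ?r - Id \<longrightarrow> y \<notin> expo_of -` X"
        by (rule wf[unfolded wf_eq_minimal, THEN spec, THEN spec, THEN mp, OF z])
      then obtain m where m: "m \<in> expo_of -` X" "\<forall>y. (y, m) \<in> ?r - Id \<longrightarrow> y \<notin> expo_of -` X" ..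
      have "expo_of m \<le> x" if "x \<in> X" for x
      proof (rule ccontr)
        assume lt: "\<not> expo_of m \<le> x"
        obtain y where y: "x = expo_of y" using expo_of_surj by blast
        then have "y \<preceq> m" "y \<noteq> m" using lt by (auto simp: expo_of_le_iff[symmetric])
        then have "(y, m) \<in> ?r - Id" using Y m(1) y that by blast
        with m(2) y that show False by blast
      qed
      with m(1) show "\<exists>m\<in>X. \<forall>x\<in>X. m \<le> x" by blast
    qed
  next
    assume "wo (expo_of ` S)"
    then have "wf (inv_image ?R expo_of)" by (intro wf_inv_image wf_less_on_wo)
    moreover have "?r - Id \<subseteq> inv_image ?R expo_of"
      by (auto simp: inv_image_def expo_of_le_iff[symmetric] order_le_less)
    ultimately show "wf (?r - Id)" by (rule wf_subset)
  qed
  with lin show ?thesis by (simp add: well_ordered_def well_order_on_def)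
qed

lemma supp_ser: "supp (ser h) = expo_of -` hsupp h"
  by (auto simp: supp_def ser_def hsupp_def)

lemma expo_of_image_supp: "expo_of ` supp (ser h) = hsupp h"
  by (simp add: supp_ser expo_of_image_vimage range_expo_of)

lemma well_ordered_supp_ser: "well_ordered (supp (ser h))"
  by (simp add: well_ordered_iff_wo expo_of_image_supp)

lemma ser_eq_iff [simp]: "ser f = ser g \<longleftrightarrow> f = g"
proof
  assume "ser f = ser g"
  then have "ser f p = ser g p" for p by (rule fun_cong)
  then have "hcoeff f (expo_of p) = hcoeff g (expo_of p)" for p unfolding ser_def .
  then have "hcoeff f e = hcoeff g e" for e using expo_of_surj[of e] by auto
  then show "f = g" by (rule hahn_eqI)
qed simp

lemma ser_surj:
  assumes "well_ordered (supp f)"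
  shows "\<exists>h. f = ser h"
proof
  let ?f = "\<lambda>e. f (xdeg e, ldeg e)"
  have "{e. ?f e \<noteq> 0} \<subseteq> expo_of ` supp f"
  proof
    fix e assume "e \<in> {e. ?f e \<noteq> 0}"
    then show "e \<in> expo_of ` supp f"
      by (intro image_eqI[of _ _ "(xdeg e, ldeg e)"]) (simp_all add: supp_def)
  qed
  then have "hcoeff (Abs_hahn ?f) = ?f"
    using assms unfolding well_ordered_iff_wo by (rule hcoeff_Abs[rotated])
  then show "f = ser (Abs_hahn ?f)" by (simp add: ser_def expo_of_def)
qed

section \<open>Translation of the operations on formal series\<close>

lemma ser_hmonom: "term_series c p = ser (hmonom c (expo_of p))"
  by (auto simp: term_series_def ser_def hcoeff_hmonom)

lemma ser_times: "ser f \<otimes>\<^sub>s ser g = ser (f * g)"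
proof
  fix r
  have "{a \<in> hsupp f. expo_of r - a \<in> hsupp g} = expo_of ` {p. ser f p \<noteq> 0 \<and> ser g (r - p) \<noteq> 0}"
  proof
    show "{a \<in> hsupp f. expo_of r - a \<in> hsupp g} \<subseteq> expo_of ` {p. ser f p \<noteq> 0 \<and> ser g (r - p) \<noteq> 0}"
    proof
      fix a assume a: "a \<in> {a \<in> hsupp f. expo_of r - a \<in> hsupp g}"
      obtain p where "a = expo_of p" using expo_of_surj by blast
      with a show "a \<in> expo_of ` {p. ser f p \<noteq> 0 \<and> ser g (r - p) \<noteq> 0}"
        by (intro image_eqI[of _ _ p]) (simp_all add: ser_def hsupp_def)
    qed
  qed (auto simp: ser_def hsupp_def)
  then show "(ser f \<otimes>\<^sub>s ser g) r = ser (f * g) r"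
    unfolding series_mult_def ser_def[of "f * g"] hcoeff_times
    by (simp add: sum.reindex[OF inj_expo_of]) (simp add: ser_def)
qed

lemma ser_power: "series_pow (ser f) n = ser (f ^ n)"
proof (induction n)
  case 0
  then show ?case by (simp add: series_pow_def ser_hmonom Expo_0_0 hmonom_1)
next
  case (Suc n)
  then show ?case by (simp add: series_pow_def ser_times)
qed

lemma ser_scaleR: "(\<lambda>p. c * ser f p) = ser (c *\<^sub>R f)"
  by (simp add: ser_def)

lemma ser_uminus: "(\<lambda>p. - ser f p) = ser (- f)"
  by (simp add: ser_def)

lemma family_sum_cong:
  assumes "\<And>j. j \<in> J \<Longrightarrow> F j = G j"
  shows "family_sum F J = family_sum G J"
proof
  fix p
  have "{j. j \<in> J \<and> F j p \<noteq> 0} = {j. j \<in> J \<and> G j p \<noteq> 0}"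
    using assms by (simp cong: conj_cong)
  then show "family_sum F J p = family_sum G J p"
    unfolding family_sum_def using assms by (intro sum.cong) simp_all
qed

lemma ser_family_sum:
  assumes "hsummable F J"
  shows "family_sum (\<lambda>j. ser (F j)) J = ser (hsum F J)"
  unfolding family_sum_def ser_def by (simp add: hcoeff_hsum[OF assms] hsupp_def)

lemma ser_hev:
  assumes "hpos e"
  shows "family_sum (\<lambda>j p. fps_nth \<phi> j * series_pow (ser e) j p) UNIV = ser (hev \<phi> e)"
  unfolding hev_def ser_power ser_scaleR by (rule ser_family_sum[OF hsummable_hev[OF assms]])

context
  fixes c :: real and m :: "real \<times> int" and e h :: "expo hahn"
  assumes c: "c \<noteq> 0" and e: "hpos e" and h: "h = hmonom c (expo_of m) * (1 + e)"
begin

lemma ser_lead: "ser h m = c"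
  using e by (auto simp: ser_def h hcoeff_hmonom_times hcoeff_1 hpos_def hsupp_def)

lemma series_ord_ser: "series_ord (ser h) = m"
  unfolding series_ord_def
proof (rule the_equality)
  have le: "m \<preceq> q" if "q \<in> supp (ser h)" for q
  proof -
    have "hcoeff 1 (expo_of q - expo_of m) + hcoeff e (expo_of q - expo_of m) \<noteq> 0"
      using that by (auto simp: supp_def ser_def h hcoeff_hmonom_times)
    then have "expo_of q - expo_of m = 0 \<or> expo_of q - expo_of m \<in> hsupp e"
      by (auto simp: hcoeff_1 hsupp_def split: if_splits)
    then have "0 \<le> expo_of q - expo_of m" using e by (auto simp: hpos_def)
    then show ?thesis by (simp add: expo_of_le_iff)
  qed
  with c show *: "m \<in> supp (ser h) \<and> (\<forall>q\<in>supp (ser h). m \<preceq> q)"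
    by (simp add: supp_def ser_lead)
  show "p = m" if "p \<in> supp (ser h) \<and> (\<forall>q\<in>supp (ser h). p \<preceq> q)" for p
    using that * order_antisym[of "expo_of p" "expo_of m"] by (simp add: expo_of_le_iff)
qed

lemma series_eps_ser: "series_eps (ser h) = ser e"
proof
  fix p
  have "p = 0 \<longleftrightarrow> expo_of p = 0" by (simp add: expo_of_def zero_expo_def zero_prod_def prod_eq_iff)
  moreover have "hcoeff e 0 = 0" using e by (auto simp: hpos_def hsupp_def)
  ultimately show "series_eps (ser h) p = ser e p"
    unfolding series_eps_def series_ord_ser ser_lead using c
    by (auto simp: ser_def h hcoeff_hmonom_times hcoeff_1 zero_prod_def[symmetric])
qed

lemma series_inverse_ser: "series_inverse (ser h) = ser (hmonom (inverse c) (- expo_of m) * hexp (- hln e))"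
  using ser_hev[OF e, of "Abs_fps (\<lambda>j. (- 1) ^ j)"]
  unfolding series_inverse_def series_ord_ser ser_lead series_eps_ser hev_minus_one_powers[OF e]
  by (simp add: ser_hmonom ser_times)

end

lemma hmonom_power_ell: "hmonom c (Expo 0 s) ^ n = hmonom (c ^ n) (Expo 0 (int n * s))"
  by (induction n)
    (simp_all add: hmonom_mult hmonom_1 Expo_0_0 plus_expo_def algebra_simps)

lemma series_powi_ser:
  assumes "0 < b" "hpos w"
  shows "series_powi (ser (hmonom (1 / b) (Expo 0 1) * hexp w)) k =
    ser (hmonom (b powr - real_of_int k) (Expo 0 k) * hexp (real_of_int k *\<^sub>R w))"
proof (cases "0 \<le> k")
  case True
  then obtain n where n: "k = int n" using zero_le_imp_eq_int by blast
  have "(1 / b) ^ n = b powr - real n"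
    using assms by (simp add: powr_minus powr_realpow field_simps)
  then show ?thesis
    unfolding series_powi_def n
    by (simp add: ser_power power_mult_distrib hmonom_power_ell hexp_power assms)
next
  case False
  define n where "n = nat (- k)"
  have n: "k = - int n" using False by (simp add: n_def)
  have "b ^ n = b powr real n" using assms by (simp add: powr_realpow)
  \<comment> \<open>Relative to the leading monomial the remainder is exp w - 1, with log (1 + (exp
    w - 1)) = w, so the inverse is again a monomial times an exponential.\<close>
  moreover have "series_inverse (ser (hmonom (1 / b) (Expo 0 1) * hexp w)) =
      ser (hmonom b (Expo 0 (- 1)) * hexp (- w))"
    using series_inverse_ser[of "1 / b" "hexp w - 1" _ "(0, 1)"] assms
    by (simp add: hpos_hexp_minus_1 hln_hexp uminus_expo_def)
  ultimately show ?thesis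
    using False unfolding series_powi_def n_def[symmetric]
    by (simp add: ser_power power_mult_distrib hmonom_power_ell hexp_power assms n)
qed

context
  fixes a b :: real and v :: "expo hahn"
  assumes a: "0 < a" and b: "0 < b" and v: "hpos v"
begin

lemma fser_lead: "fser a b v = hmonom a (expo_of (b, 0)) * (1 + (hexp v - 1))"
  by (simp add: fser_def)

lemma a_nz: "a \<noteq> 0"
  using a by simp

lemmas fser_simps = ser_lead[OF a_nz hpos_hexp_minus_1[OF v] fser_lead]
  series_ord_ser[OF a_nz hpos_hexp_minus_1[OF v] fser_lead]
  series_eps_ser[OF a_nz hpos_hexp_minus_1[OF v] fser_lead]

lemma x_powr_comp_ser:
  "x_powr_comp \<alpha> (ser (fser a b v)) = ser (hmonom (a powr \<alpha>) (Expo (b * \<alpha>) 0) * hexp (\<alpha> *\<^sub>R v))"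
  using ser_hev[OF hpos_hexp_minus_1[OF v], of "fps_binomial \<alpha>"]
  unfolding x_powr_comp_def fser_simps hev_binomial[OF hpos_hexp_minus_1[OF v]] hln_hexp[OF v]
  by (simp add: ser_hmonom ser_times)

lemma log_comp_ser:
  "log_comp (ser (fser a b v)) = ser (hmonom (- b) (expo_of (0, - 1)) * (1 + hdelta a b v))"
proof -
  let ?e = "hexp v - 1"
  \<comment> \<open>\<open>log_comp\<close> starts its sum at j = 1 and \<open>hev\<close> at j = 0;
    the constant term of log (1 + X) vanishes.\<close>
  have "hsum (\<lambda>j. fps_nth (fps_ln 1) j *\<^sub>R ?e ^ j) {1..} = hln ?e"
    unfolding hln_def hev_def
    by (rule hsum_mono_neutral[OF hsummable_hev[OF hpos_hexp_minus_1[OF v]]])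
      (auto simp: Suc_le_eq)
  moreover have "family_sum (\<lambda>j. ser (fps_nth (fps_ln 1) j *\<^sub>R ?e ^ j)) {1..} =
      ser (hsum (\<lambda>j. fps_nth (fps_ln 1) j *\<^sub>R ?e ^ j) {1..})"
    by (intro ser_family_sum hsummable_subset[OF hsummable_hev[OF hpos_hexp_minus_1[OF v]]]) simp
  moreover have "family_sum (\<lambda>j p. (- 1) ^ (j + 1) / real j * series_pow (ser ?e) j p) {1..} =
      family_sum (\<lambda>j. ser (fps_nth (fps_ln 1) j *\<^sub>R ?e ^ j)) {1..}"
  proof -
    have "(\<lambda>p. (- 1) ^ (j + 1) / real j * series_pow (ser ?e) j p) =
        ser (fps_nth (fps_ln 1) j *\<^sub>R ?e ^ j)" if "j \<in> {1..}" for j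
      unfolding ser_power ser_scaleR using that by (cases j) (simp_all add: fps_ln_nth)
    then show ?thesis by (rule family_sum_cong)
  qed
  ultimately have "log_comp (ser (fser a b v)) =
      ser (hmonom (ln a) 0 + hmonom (- b) (Expo 0 (- 1)) + v)"
    unfolding log_comp_def fser_simps hln_hexp[OF v] ser_hmonom
    by (simp add: ser_def Expo_0_0)
  moreover have "hmonom (- b) (Expo 0 (- 1)) * hdelta a b v = hmonom (ln a) 0 + v"
    unfolding hdelta_def mult.assoc[symmetric] hmonom_mult
    using b by (simp add: plus_expo_def Expo_0_0 hmonom_1)
  ultimately show ?thesis by (simp add: distrib_left add_ac)
qed

lemma ell_comp_ser:
  "ell_comp (ser (fser a b v)) = ser (hmonom (1 / b) (Expo 0 1) * hexp (hw a b v))"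
proof -
  have "- b \<noteq> 0" using b by simp
  have "series_inverse (log_comp (ser (fser a b v))) =
      ser (hmonom (inverse (- b)) (- expo_of (0, - 1)) * hexp (- hln (hdelta a b v)))"
    unfolding log_comp_ser by (rule series_inverse_ser[OF \<open>- b \<noteq> 0\<close> hpos_hdelta[OF v] refl])
  moreover have m: "- hmonom (inverse (- b)) (- expo_of (0, - 1)) = hmonom (1 / b) (Expo 0 1)"
    by (rule hahn_eqI) (simp add: hcoeff_hmonom uminus_expo_def inverse_eq_divide)
  ultimately show ?thesis
    unfolding ell_comp_def hw_def by (simp only: ser_uminus mult_minus_left[symmetric] m)
qed

lemma kern_ser:
  "x_powr_comp \<alpha> (ser (fser a b v)) \<otimes>\<^sub>s series_powi (ell_comp (ser (fser a b v))) k =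
    ser (kern a b v (Expo \<alpha> k))"
proof -
  let ?x = "hmonom (a powr \<alpha>) (Expo (b * \<alpha>) 0)" and ?l = "hmonom (b powr - real_of_int k) (Expo 0 k)"
  have "?x * hexp (\<alpha> *\<^sub>R v) * (?l * hexp (real_of_int k *\<^sub>R hw a b v)) =
      ?x * ?l * (hexp (\<alpha> *\<^sub>R v) * hexp (real_of_int k *\<^sub>R hw a b v))"
    by (simp only: mult_ac)
  also have "\<dots> = kern a b v (Expo \<alpha> k)"
    unfolding kern_def hmonom_mult hexp_add[OF hpos_scaleR[OF v] hpos_scaleR[OF hpos_hw[OF v]], symmetric]
    by (simp add: tw_def plus_expo_def)
  finally show ?thesis
    unfolding x_powr_comp_ser ell_comp_ser series_powi_ser[OF b hpos_hw[OF v]] ser_times by simp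
qed

text \<open>The bridge between the two notions of composition: outside the support of g the members
  of the sum vanish, and on it the family is summable by \<open>hsummable_kern\<close>.\<close>

lemma ser_comp: "ser g \<circ>\<^sub>s ser (fser a b v) = ser (hcomp a b v g)"
proof -
  let ?F = "\<lambda>p. ser (hcoeff g (expo_of p) *\<^sub>R kern a b v (expo_of p))"
  have "ser g \<circ>\<^sub>s ser (fser a b v) = family_sum ?F UNIV"
    unfolding series_comp_def kern_ser
    by (intro arg_cong2[of _ _ _ _ family_sum] refl ext) (auto simp: ser_def split: prod.splits)
  also have "\<dots> = family_sum ?F (expo_of -` hsupp g)"
  proof -
    have "{j \<in> UNIV. ?F j p \<noteq> 0} = {j \<in> expo_of -` hsupp g. ?F j p \<noteq> 0}" for p
      by (auto simp: ser_def hsupp_def)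
    then show ?thesis unfolding family_sum_def by simp
  qed
  also have "\<dots> = ser (hsum (\<lambda>p. hcoeff g (expo_of p) *\<^sub>R kern a b v (expo_of p)) (expo_of -` hsupp g))"
  proof (rule ser_family_sum)
    show "hsummable (\<lambda>p. hcoeff g (expo_of p) *\<^sub>R kern a b v (expo_of p)) (expo_of -` hsupp g)"
      using hsummable_kern[OF b v wo_hsupp, of "hcoeff g" a g]
        hsum_reindex(1)[OF inj_expo_of, of "\<lambda>p. hcoeff g p *\<^sub>R kern a b v p" "expo_of -` hsupp g"]
      unfolding expo_of_image_vimage by simp
  qed
  also have "\<dots> = ser (hcomp a b v g)"
    using hsum_reindex(2)[OF inj_expo_of, of "\<lambda>p. hcoeff g p *\<^sub>R kern a b v p" "expo_of -` hsupp g"]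
    unfolding expo_of_image_vimage by (simp add: hcomp_def)
  finally show ?thesis .
qed

lemma fser_in_log_series_H: "ser (fser a b v) \<in> log_series_H"
proof -
  have "supp (ser (fser a b v)) \<subseteq> {0<..} \<times> UNIV"
  proof
    fix p assume "p \<in> supp (ser (fser a b v))"
    then have "expo_of p \<in> hsupp (fser a b v)" by (simp add: supp_ser)
    then obtain q where q: "q \<in> hsupp (hexp v)" "expo_of p = Expo b 0 + q"
      using hsupp_hmonom_times[of a "Expo b 0" "hexp v"] unfolding fser_def sumset_def by blast
    have "0 \<le> q"
    proof (cases "q = 0")
      case False
      then have "q \<in> hsupp (hexp v - 1)" using q(1) by (simp add: hsupp_def hcoeff_1)
      then show ?thesis using hpos_hexp_minus_1[OF v] by (auto simp: hpos_def)
    qed simp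
    then have "0 \<le> xdeg q" by (auto simp: less_eq_expo_def)
    then have "0 < xdeg (expo_of p)" using q(2) b by simp
    then show "p \<in> {0<..} \<times> UNIV" by (cases p) simp
  qed
  moreover have "starts_with (ser (fser a b v)) a b"
    using a by (simp add: starts_with_def fser_simps)
  ultimately show ?thesis
    using a b well_ordered_supp_ser unfolding log_series_H_def log_series_def by blast
qed

lemma starts_with_fser: "starts_with (ser (fser a b v)) a' b' \<longleftrightarrow> a' = a \<and> b' = b"
  unfolding starts_with_def fser_simps(2) using fser_simps(1) a
  by (metis Pair_inject less_irrefl)

end

text \<open>Division by the leading term leaves 1 + e with e of positive order, and v is log (1 +
  e).\<close>

lemma log_series_H_fser:
  assumes "f \<in> log_series_H"
  obtains a b v where "0 < a" "0 < b" "hpos v" "f = ser (fser a b v)"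
proof -
  obtain a b where ab: "0 < a" "0 < b" "starts_with f a b" and f: "f \<in> log_series"
    using assms unfolding log_series_H_def by blast
  obtain h where h: "f = ser h" using f ser_surj unfolding log_series_def by blast
  let ?m = "Expo b 0"
  have fa: "hcoeff h ?m = a" using ab(3) by (simp add: starts_with_def h ser_def)
  have "?m \<in> hsupp h" using fa ab(1) by (simp add: hsupp_def)
  then have "\<exists>m\<in>hsupp h. \<forall>q\<in>hsupp h. m \<le> q"
    by (intro wo_hsupp[of h, unfolded wo_def, THEN spec, THEN mp, THEN mp]) auto
  then obtain m where m: "m \<in> hsupp h" "\<And>q. q \<in> hsupp h \<Longrightarrow> m \<le> q" by blast
  obtain p where p: "m = expo_of p" using expo_of_surj by blast
  have "series_ord f = p"
    unfolding series_ord_def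
  proof (rule the_equality)
    show *: "p \<in> supp f \<and> (\<forall>q\<in>supp f. p \<preceq> q)"
      using m(1) m(2)[of "expo_of _"] unfolding p h supp_ser by (simp add: expo_of_le_iff)
    show "q = p" if "q \<in> supp f \<and> (\<forall>r\<in>supp f. q \<preceq> r)" for q
      using that * order_antisym[of "expo_of p" "expo_of q"] by (simp add: expo_of_le_iff)
  qed
  then have m_eq: "m = ?m" using ab(3) p by (simp add: starts_with_def)
  define e where "e = hmonom (1 / a) (- ?m) * h - 1"
  have e: "hpos e"
    unfolding hpos_def
  proof
    fix q assume "q \<in> hsupp e"
    then have nz: "1 / a * hcoeff h (q + ?m) - hcoeff 1 q \<noteq> 0"
      by (simp add: hsupp_def e_def hcoeff_hmonom_times)
    have "q \<noteq> 0"
    proof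
      assume "q = 0"
      with nz fa ab(1) show False by (simp add: hcoeff_1)
    qed
    moreover from this nz have "q + ?m \<in> hsupp h" by (auto simp: hcoeff_1 hsupp_def)
    then have "0 \<le> q" using m(2)[of "q + ?m"] m_eq by simp
    ultimately show "q \<in> {0<..}" by (simp add: less_le)
  qed
  have "fser a b (hln e) = hmonom a ?m * hmonom (1 / a) (- ?m) * h"
    unfolding fser_def hexp_hln[OF e] by (simp add: e_def mult.assoc)
  also have "\<dots> = h" using ab(1) by (simp add: hmonom_mult hmonom_1)
  finally show ?thesis using that[OF ab(1,2) hpos_hln[OF e]] h by simp
qed

lemma fser_inject:
  assumes "0 < a" "0 < b" "hpos v" "0 < a'" "0 < b'" "hpos v'" "fser a b v = fser a' b' v'"
  shows "a = a' \<and> b = b' \<and> v = v'"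
proof -
  have ab: "a = a' \<and> b = b'"
    using starts_with_fser[OF assms(1-3), of a b] starts_with_fser[OF assms(4-6), of a b] assms(7)
    by simp
  have "hmonom (1 / a) (Expo (- b) 0) * fser a b v = hmonom (1 / a) (Expo (- b) 0) * fser a b v'"
    using ab assms(7) by simp
  then have "hexp v = hexp v'"
    unfolding fser_def mult.assoc[symmetric] hmonom_mult
    using assms(1) by (simp add: plus_expo_def Expo_0_0 hmonom_1)
  then show ?thesis using ab hexp_inject[OF assms(3,6)] by simp
qed

lemma id_series_fser: "id_series = ser (fser 1 1 0)"
  by (simp add: id_series_def ser_hmonom fser_def)

lemma fser_comp_ser:
  assumes "0 < a" "0 < b" "hpos v" "hpos v'"
  shows "ser (fser a' b' v') \<circ>\<^sub>s ser (fser a b v) =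
    ser (fser (a' * a powr b') (b * b') (b' *\<^sub>R v + hcomp a b v v'))"
  by (simp add: ser_comp hcomp_fser assms)

section \<open>Families of series with coefficients in a function algebra\<close>

text \<open>For b = 1 the kernel at q is the monomial q times a^\<alpha> times this factor, where
  \<alpha> is the real exponent of q. The factor has constant term 1.\<close>

definition kexp :: "real \<Rightarrow> expo hahn \<Rightarrow> expo \<Rightarrow> expo hahn" where
  "kexp a v q = hexp (xdeg q *\<^sub>R v + of_int (ldeg q) *\<^sub>R hw a 1 v)"

text \<open>For b = 1 a monoid that contains the exponent of \<ell> and the support of v is
  respected by composition (\<open>hsupp_hcomp_M\<close>), so one M can serve for all times of a
  flow.\<close>

locale exp_monoid =
  fixes M :: "expo set"
  assumes wo_M: "wo M" and M_nonneg: "M \<subseteq> {0..}" and zero_M: "0 \<in> M"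
    and add_M: "p \<in> M \<Longrightarrow> q \<in> M \<Longrightarrow> p + q \<in> M" and ell_M: "Expo 0 1 \<in> M"
begin

lemma gen_monoid_M: "W \<subseteq> M \<Longrightarrow> gen_monoid W \<subseteq> M"
  by (rule gen_monoid_least) (simp_all add: zero_M add_M)

lemma kmonoid_M: "hsupp v \<subseteq> M \<Longrightarrow> kmonoid v \<subseteq> M"
  unfolding kmonoid_def by (rule gen_monoid_M) (simp add: ell_M)

lemma hsupp_times_M: "hsupp f \<subseteq> M \<Longrightarrow> hsupp g \<subseteq> M \<Longrightarrow> hsupp (f * g) \<subseteq> M"
proof -
  assume "hsupp f \<subseteq> M" "hsupp g \<subseteq> M"
  then have "sumset (hsupp f) (hsupp g) \<subseteq> M" by (auto simp: sumset_def intro: add_M)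
  with hsupp_times show ?thesis by blast
qed

lemma hsupp_kexp: "hpos v \<Longrightarrow> hsupp v \<subseteq> M \<Longrightarrow> hsupp (kexp a v q) \<subseteq> M"
  unfolding kexp_def using hsupp_kern_exp kmonoid_M by blast

lemma finite_splits: "finite {q \<in> M. p - q \<in> M}"
  by (intro finite_decompositions wo_M)

text \<open>The triangular form of composition for b = 1: p - q in M forces q \<le> p, and the term
  q = p has the factor a^\<alpha>, with \<alpha> the real exponent of p.\<close>

lemma hcoeff_hcomp:
  assumes a: "0 < a" and v: "hpos v" "hsupp v \<subseteq> M" and h: "hsupp h \<subseteq> M"
  shows "hcoeff (hcomp a 1 v h) p =
    (\<Sum>q\<in>{q \<in> M. p - q \<in> M}. hcoeff h q * (a powr xdeg q * hcoeff (kexp a v q) (p - q)))"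
proof -
  have kern: "hcoeff (kern a 1 v q) p = a powr xdeg q * hcoeff (kexp a v q) (p - q)" for q
    by (simp add: kern_def kexp_def hcoeff_hmonom_times)
  have "{q \<in> M. hcoeff (kern a 1 v q) p \<noteq> 0} \<subseteq> {q \<in> M. p - q \<in> M}"
    using hsupp_kexp[OF v] by (auto simp: kern hsupp_def)
  then show ?thesis
    unfolding hcoeff_hcomp_kern(2)[OF zero_less_one v(1) wo_M h] kern[symmetric]
    using finite_splits by (subst mult.commute, intro sum.mono_neutral_left) auto
qed

lemma hsupp_hcomp_M:
  assumes v: "hpos v" "hsupp v \<subseteq> M" and h: "hsupp h \<subseteq> M"
  shows "hsupp (hcomp a 1 v h) \<subseteq> M"
proof -
  have "sumset (tw 1 ` M) (kmonoid v) \<subseteq> M"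
    using kmonoid_M[OF v(2)] by (auto simp: sumset_def intro: add_M)
  then show ?thesis using hsupp_hcomp[of 1 v h M a] v h by auto
qed

end

lemma exp_monoid_gen:
  assumes "wo W" "W \<subseteq> {0<..}" "Expo 0 1 \<in> W"
  shows "exp_monoid (gen_monoid W)"
proof
  show "wo (gen_monoid W)" by (rule wo_gen_monoid[OF assms(1,2)])
  show "gen_monoid W \<subseteq> {0..}"
    by (rule gen_monoid_nonneg) (use assms(2) in \<open>auto simp: less_imp_le\<close>)
  show "Expo 0 1 \<in> gen_monoid W" using assms(3) subset_gen_monoid by blast
qed (simp_all add: gen_monoid_add)

lemma exp_monoid_kmonoid: "hpos v \<Longrightarrow> exp_monoid (kmonoid v)"
  unfolding kmonoid_def by (intro exp_monoid_gen kmonoid_pos) simp_all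

lemma hcoeff_hexp_0:
  assumes "hpos v"
  shows "hcoeff (hexp v) 0 = 1"
proof -
  have "hcoeff (hexp v - 1) 0 = 0"
    by (rule hcoeff_eq_0[OF hpos_hexp_minus_1[OF assms, unfolded hpos_def]]) simp
  then show ?thesis by (simp add: hcoeff_1)
qed

lemma hcoeff_kexp_0: "hpos v \<Longrightarrow> hcoeff (kexp a v q) 0 = 1"
  unfolding kexp_def by (intro hcoeff_hexp_0 hpos_kern_exponent)

text \<open>\<open>'x\<close> is a parameter such as time, \<open>A\<close> the kind of dependence
  on it that is to be preserved. Apart from log a and powers of a, each coefficient of a result is a
  polynomial in finitely many coefficients of the arguments at exponents that are not larger, so
  closure under sums and products suffices, and \<open>D\<close> only has to be closed
  downwards.\<close>

locale coeff_algebra = exp_monoid +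
  fixes A :: "('x \<Rightarrow> real) set" and D :: "expo set"
  assumes const_A: "(\<lambda>_. c) \<in> A"
    and add_A: "f \<in> A \<Longrightarrow> g \<in> A \<Longrightarrow> (\<lambda>x. f x + g x) \<in> A"
    and mult_A: "f \<in> A \<Longrightarrow> g \<in> A \<Longrightarrow> (\<lambda>x. f x * g x) \<in> A"
    and D_down: "p \<in> D \<Longrightarrow> q \<le> p \<Longrightarrow> q \<in> D"
begin

definition fam :: "('x \<Rightarrow> expo hahn) \<Rightarrow> bool" where
  "fam H \<longleftrightarrow> (\<forall>x. hsupp (H x) \<subseteq> M) \<and> (\<forall>p\<in>D. (\<lambda>x. hcoeff (H x) p) \<in> A)"

lemma famI:
  "(\<And>x. hsupp (H x) \<subseteq> M) \<Longrightarrow> (\<And>p. p \<in> D \<Longrightarrow> (\<lambda>x. hcoeff (H x) p) \<in> A) \<Longrightarrow> fam H"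
  by (simp add: fam_def)

lemma famD: "fam H \<Longrightarrow> hsupp (H x) \<subseteq> M" "fam H \<Longrightarrow> p \<in> D \<Longrightarrow> (\<lambda>x. hcoeff (H x) p) \<in> A"
  by (simp_all add: fam_def)

lemma sum_A: "(\<And>i. i \<in> I \<Longrightarrow> f i \<in> A) \<Longrightarrow> (\<lambda>x. \<Sum>i\<in>I. f i x) \<in> A"
  by (induction I rule: infinite_finite_induct) (simp_all add: const_A add_A)

lemma fam_const: "hsupp h \<subseteq> M \<Longrightarrow> fam (\<lambda>_. h)"
  by (simp add: fam_def const_A)

lemma fam_hmonom: "c \<in> A \<Longrightarrow> p \<in> M \<Longrightarrow> fam (\<lambda>x. hmonom (c x) p)"
proof (rule famI)
  assume c: "c \<in> A" and p: "p \<in> M"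
  show "hsupp (hmonom (c x) p) \<subseteq> M" for x using hsupp_hmonom[of "c x" p] p by blast
  show "(\<lambda>x. hcoeff (hmonom (c x) p) q) \<in> A" for q
    using c by (cases "q = p") (simp_all add: hcoeff_hmonom const_A)
qed

lemma fam_add: "fam H \<Longrightarrow> fam K \<Longrightarrow> fam (\<lambda>x. H x + K x)"
  using hsupp_add by (intro famI) (auto simp: add_A fam_def, blast)

lemma fam_scaleR: "c \<in> A \<Longrightarrow> fam H \<Longrightarrow> fam (\<lambda>x. c x *\<^sub>R H x)"
  using hsupp_scaleR by (intro famI) (auto simp: mult_A fam_def, blast)

lemma fam_uminus: "fam H \<Longrightarrow> fam (\<lambda>x. - H x)"
  using fam_scaleR[OF const_A[of "- 1"]] by simp

lemma splits_D:
  assumes "p \<in> D" "q \<in> M" "p - q \<in> M"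
  shows "q \<in> D" "p - q \<in> D"
proof -
  have "0 \<le> q" "0 \<le> p - q" using assms M_nonneg by auto
  then show "q \<in> D" "p - q \<in> D" using D_down[OF assms(1)] by simp_all
qed

lemma fam_times:
  assumes "fam H" "fam K"
  shows "fam (\<lambda>x. H x * K x)"
proof (rule famI)
  show "hsupp (H x * K x) \<subseteq> M" for x by (intro hsupp_times_M famD assms)
  fix p assume p: "p \<in> D"
  have "hcoeff (H x * K x) p = (\<Sum>q\<in>{q \<in> M. p - q \<in> M}. hcoeff (H x) q * hcoeff (K x) (p - q))" for x
    using famD(1)[OF assms(1)] famD(1)[OF assms(2)]
    by (intro hcoeff_times_eq finite_splits) auto
  then show "(\<lambda>x. hcoeff (H x * K x) p) \<in> A"
    using splits_D[OF p] by (auto intro!: sum_A mult_A famD(2) assms)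
qed

lemma fam_power: "fam H \<Longrightarrow> fam (\<lambda>x. H x ^ n)"
  by (induction n) (simp_all add: fam_times fam_const hsupp_1 zero_M)

lemma fam_hev:
  assumes H: "fam H" and pos: "\<And>x. hpos (H x)"
  shows "fam (\<lambda>x. hev \<phi> (H x))"
proof (rule famI)
  show "hsupp (hev \<phi> (H x)) \<subseteq> M" for x
    using hsupp_hev[OF pos famD(1)[OF H]] gen_monoid_M[OF order_refl] by blast
  fix p assume p: "p \<in> D"
  \<comment> \<open>The powers that can reach p are determined by M, so one finite range of n serves
    for all x.\<close>
  let ?W = "M \<inter> {0<..}"
  have fin: "finite {n. p \<in> nsum ?W n}"
    by (intro finite_nsum_mem) (auto intro: wo_subset[OF wo_M])
  have sub: "hsupp (H x) \<subseteq> ?W" for x using pos famD(1)[OF H] by (auto simp: hpos_def)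
  have "hcoeff (hev \<phi> (H x)) p = (\<Sum>n\<in>{n. p \<in> nsum ?W n}. fps_nth \<phi> n * hcoeff (H x ^ n) p)" for x
  proof -
    have "hcoeff (hev \<phi> (H x)) p = (\<Sum>n\<in>{n. p \<in> nsum ?W n}. hcoeff (fps_nth \<phi> n *\<^sub>R H x ^ n) p)"
      unfolding hev_def
    proof (rule hcoeff_hsum_eq[OF hsummable_hev[OF pos] fin])
      fix n assume "p \<in> hsupp (fps_nth \<phi> n *\<^sub>R H x ^ n)"
      then have "p \<in> hsupp (H x ^ n)" using hsupp_scaleR by blast
      then show "n \<in> {n. p \<in> nsum ?W n}" using hsupp_power[OF sub] by blast
    qed simp
    then show ?thesis by simp
  qed
  then show "(\<lambda>x. hcoeff (hev \<phi> (H x)) p) \<in> A"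
    by (simp add: sum_A mult_A const_A famD(2)[OF fam_power[OF H] p])
qed

lemma fam_hw:
  assumes V: "fam V" "\<And>x. hpos (V x)" and a: "(\<lambda>x. ln (a x)) \<in> A"
  shows "fam (\<lambda>x. hw (a x) 1 (V x))"
proof -
  have "fam (\<lambda>x. hdelta (a x) 1 (V x))"
    unfolding hdelta_def
    by (intro fam_times fam_add fam_hmonom const_A a V zero_M ell_M)
  then show ?thesis
    unfolding hw_def hln_def by (intro fam_uminus fam_hev hpos_hdelta V)
qed

lemma fam_kexp:
  assumes V: "fam V" "\<And>x. hpos (V x)" and a: "(\<lambda>x. ln (a x)) \<in> A"
  shows "fam (\<lambda>x. kexp (a x) (V x) q)"
  unfolding kexp_def hexp_def
  by (intro fam_hev fam_add fam_scaleR const_A V fam_hw a hpos_kern_exponent)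

lemma fam_hcomp:
  assumes V: "fam V" "\<And>x. hpos (V x)" and H: "fam H"
    and a: "\<And>x. 0 < a x" "(\<lambda>x. ln (a x)) \<in> A" "\<And>s. (\<lambda>x. a x powr s) \<in> A"
  shows "fam (\<lambda>x. hcomp (a x) 1 (V x) (H x))"
proof (rule famI)
  show "hsupp (hcomp (a x) 1 (V x) (H x)) \<subseteq> M" for x
    by (intro hsupp_hcomp_M V famD H)
  fix p assume p: "p \<in> D"
  show "(\<lambda>x. hcoeff (hcomp (a x) 1 (V x) (H x)) p) \<in> A"
    unfolding hcoeff_hcomp[OF a(1) V(2) famD(1)[OF V(1)] famD(1)[OF H]]
    using splits_D[OF p] by (auto intro!: sum_A mult_A famD(2) H a(3) fam_kexp V a(2))
qed

end

context exp_monoid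
begin

text \<open>
  The functions on the two-element type \<open>bool\<close> that are constant form an algebra, so closure
  of the families over \<open>D = {s. s < r}\<close> says that the coefficients below \<open>r\<close> of the result only
  depend on the coefficients below \<open>r\<close> of the arguments.
\<close>

lemma hcoeff_kexp_cong:
  assumes v: "hpos v" "hsupp v \<subseteq> M" "hpos v'" "hsupp v' \<subseteq> M"
    and eq: "\<And>s. s < r \<Longrightarrow> hcoeff v s = hcoeff v' s" and s: "s < r"
  shows "hcoeff (kexp a v q) s = hcoeff (kexp a v' q) s"
proof -
  interpret coeff_algebra M "{\<phi> :: bool \<Rightarrow> real. \<phi> True = \<phi> False}" "{s. s < r}"
    by unfold_locales auto
  let ?V = "\<lambda>x. if x then v else v'"
  have "fam ?V" using v eq by (intro famI) auto
  then have "fam (\<lambda>x. kexp a (?V x) q)" by (rule fam_kexp) (use v in auto)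
  then show ?thesis using famD(2)[of "\<lambda>x. kexp a (?V x) q" s] s by simp
qed

text \<open>In \<open>hcoeff_hcomp\<close> the terms with 0 < q < r agree, since q and r - q are
  both less than r. The term q = 0, which would involve v and v' at r, vanishes because h and h'
  have no constant term. Only q = r remains.\<close>

lemma hcoeff_hcomp_diff:
  assumes a: "0 < a" and v: "hpos v" "hsupp v \<subseteq> M" "hpos v'" "hsupp v' \<subseteq> M"
    and h: "hpos h" "hsupp h \<subseteq> M" "hpos h'" "hsupp h' \<subseteq> M" and r: "r \<in> M"
    and eq: "\<And>s. s < r \<Longrightarrow> hcoeff v s = hcoeff v' s" "\<And>s. s < r \<Longrightarrow> hcoeff h s = hcoeff h' s"
  shows "hcoeff (hcomp a 1 v h) r - hcoeff (hcomp a 1 v' h') r =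
    a powr xdeg r * (hcoeff h r - hcoeff h' r)"
proof -
  let ?Q = "{q \<in> M. r - q \<in> M}"
  have term_eq: "hcoeff h q * (a powr xdeg q * hcoeff (kexp a v q) (r - q)) -
      hcoeff h' q * (a powr xdeg q * hcoeff (kexp a v' q) (r - q)) =
      (if q = r then a powr xdeg r * (hcoeff h r - hcoeff h' r) else 0)" if q: "q \<in> ?Q" for q
  proof (cases "q = r")
    case True
    then show ?thesis using v by (simp add: hcoeff_kexp_0 algebra_simps)
  next
    case False
    have "0 \<le> q" "0 \<le> r - q" using q M_nonneg by auto
    then have "q < r" using False by simp
    then have hq: "hcoeff h q = hcoeff h' q" by (rule eq(2))
    show ?thesis
    proof (cases "q = 0")
      case True
      then have "hcoeff h q = 0" using h(1) by (auto simp: hpos_def hsupp_def)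
      then show ?thesis using False hq by simp
    next
      case q0: False
      then have "r - q < r" using \<open>0 \<le> q\<close> by simp
      then have "hcoeff (kexp a v q) (r - q) = hcoeff (kexp a v' q) (r - q)"
        using hcoeff_kexp_cong[OF v eq(1)] by blast
      then show ?thesis using False hq by simp
    qed
  qed
  have "hcoeff (hcomp a 1 v h) r - hcoeff (hcomp a 1 v' h') r =
      (\<Sum>q\<in>?Q. if q = r then a powr xdeg r * (hcoeff h r - hcoeff h' r) else 0)"
    unfolding hcoeff_hcomp[OF a v(1,2) h(2)] hcoeff_hcomp[OF a v(3,4) h(4)] sum_subtractf[symmetric]
    by (rule sum.cong[OF refl term_eq])
  also have "\<dots> = a powr xdeg r * (hcoeff h r - hcoeff h' r)"
    using r zero_M finite_splits[of r] by (simp add: sum.delta)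
  finally show ?thesis .
qed

end

section \<open>Exponential polynomials\<close>

text \<open>Only real rates \<kappa> occur, since the multipliers are powers of a > 0. This matters
  for \<open>EP_zero\<close>: oscillating functions such as sin (\<pi> t) vanish at all natural
  numbers.\<close>

inductive_set EP :: "(real \<Rightarrow> real) set" where
  base: "(\<lambda>t. c * t ^ m * exp (\<kappa> * t)) \<in> EP"
| add: "f \<in> EP \<Longrightarrow> g \<in> EP \<Longrightarrow> (\<lambda>t. f t + g t) \<in> EP"

lemma EP_const: "(\<lambda>_. c) \<in> EP"
  using EP.base[of c 0 0] by simp

lemma EP_id: "(\<lambda>t. t) \<in> EP"
  using EP.base[of 1 1 0] by simp

lemma EP_exp: "(\<lambda>t. exp (\<kappa> * t)) \<in> EP"
  using EP.base[of 1 0 \<kappa>] by simp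

lemma EP_mult:
  assumes "f \<in> EP" "g \<in> EP"
  shows "(\<lambda>t. f t * g t) \<in> EP"
  using assms(1)
proof induction
  case (base c m \<kappa>)
  show ?case using assms(2)
  proof induction
    case (base d n \<mu>)
    have "(\<lambda>t. c * t ^ m * exp (\<kappa> * t) * (d * t ^ n * exp (\<mu> * t))) =
        (\<lambda>t. (c * d) * t ^ (m + n) * exp ((\<kappa> + \<mu>) * t))"
      by (simp add: fun_eq_iff power_add distrib_right exp_add)
    then show ?case using EP.base[of "c * d" "m + n" "\<kappa> + \<mu>"] by simp
  next
    case (add f g)
    then show ?case using EP.add[OF add.IH] by (simp add: distrib_left)
  qed
next
  case (add f g)
  then show ?case using EP.add[OF add.IH] by (simp add: distrib_right)
qed

lemma EP_sum: "(\<And>i. i \<in> I \<Longrightarrow> f i \<in> EP) \<Longrightarrow> (\<lambda>t. \<Sum>i\<in>I. f i t) \<in> EP"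
  by (induction I rule: infinite_finite_induct) (simp_all add: EP_const EP.add)

lemma EP_power: "f \<in> EP \<Longrightarrow> (\<lambda>t. f t ^ n) \<in> EP"
  by (induction n) (simp_all add: EP_const EP_mult)

lemma EP_diff: "f \<in> EP \<Longrightarrow> g \<in> EP \<Longrightarrow> (\<lambda>t. f t - g t) \<in> EP"
  using EP.add[OF _ EP_mult[OF EP_const[of "- 1"]], of f g] by simp

lemma EP_shift:
  assumes "f \<in> EP"
  shows "(\<lambda>t. f (t + s)) \<in> EP"
  using assms
proof induction
  case (base c m \<kappa>)
  have "(\<lambda>t. (c * exp (\<kappa> * s)) * ((t + s) ^ m * exp (\<kappa> * t))) \<in> EP"
    by (intro EP_mult EP_const EP_power EP.add EP_id EP_exp)
  then show ?case by (simp add: distrib_left exp_add mult_ac)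
next
  case (add f g)
  from EP.add[OF add.IH] show ?case .
qed

lemma EP_deriv:
  assumes "f \<in> EP"
  shows "\<exists>f'\<in>EP. \<forall>t. (f has_real_derivative f' t) (at t)"
  using assms
proof induction
  case (base c m \<kappa>)
  let ?f' = "\<lambda>t. c * (real m * t ^ (m - 1)) * exp (\<kappa> * t) + c * t ^ m * exp (\<kappa> * t) * \<kappa>"
  have "?f' \<in> EP"
    by (intro EP_mult EP.add EP_const EP_power EP_id EP_exp)
  moreover have "((\<lambda>t. c * t ^ m * exp (\<kappa> * t)) has_real_derivative ?f' t) (at t)" for t
    by (auto intro!: derivative_eq_intros)
  ultimately show ?case by (intro bexI[of _ ?f'] allI)
next
  case (add f g)
  then obtain f' g' where "f' \<in> EP" "g' \<in> EP" "\<And>t. (f has_real_derivative f' t) (at t)"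
      "\<And>t. (g has_real_derivative g' t) (at t)" by blast
  then show ?case
    by (intro bexI[of _ "\<lambda>t. f' t + g' t"]) (auto intro!: derivative_intros EP.add)
qed

lemma EP_C1:
  assumes "f \<in> EP"
  shows "f C1_differentiable_on UNIV"
proof -
  obtain f' where f': "f' \<in> EP" "\<And>t. (f has_real_derivative f' t) (at t)"
    using EP_deriv[OF assms] by blast
  obtain f'' where "\<And>t. (f' has_real_derivative f'' t) (at t)"
    using EP_deriv[OF f'(1)] by blast
  then have "continuous_on UNIV f'"
    by (meson DERIV_isCont continuous_at_imp_continuous_on)
  then show ?thesis
    unfolding C1_differentiable_on_def
    using f'(2) by (auto simp: has_real_derivative_iff_has_vector_derivative)
qed

text \<open>Indexing by a set of pairs (\<kappa>, m) merges equal terms, so distinct indices have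
  distinct growth.\<close>

lemma EP_normal_form:
  assumes "f \<in> EP"
  shows "\<exists>I c. finite I \<and> f = (\<lambda>t. \<Sum>i\<in>I. c i * t ^ snd i * exp (fst i * t))"
  using assms
proof induction
  case (base c m \<kappa>)
  show ?case by (rule exI[of _ "{(\<kappa>, m)}"], rule exI[of _ "\<lambda>_. c"]) simp
next
  case (add f g)
  then obtain I c J d where I: "finite I" "f = (\<lambda>t. \<Sum>i\<in>I. c i * t ^ snd i * exp (fst i * t))"
    and J: "finite J" "g = (\<lambda>t. \<Sum>i\<in>J. d i * t ^ snd i * exp (fst i * t))" by blast
  let ?c = "\<lambda>i. (if i \<in> I then c i else 0) + (if i \<in> J then d i else 0)"
  have "f t + g t = (\<Sum>i\<in>I \<union> J. ?c i * t ^ snd i * exp (fst i * t))" for t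
  proof -
    have "f t = (\<Sum>i\<in>I \<union> J. (if i \<in> I then c i else 0) * t ^ snd i * exp (fst i * t))"
      unfolding I(2) using I(1) J(1) by (intro sum.mono_neutral_cong_left) auto
    moreover have "g t = (\<Sum>i\<in>I \<union> J. (if i \<in> J then d i else 0) * t ^ snd i * exp (fst i * t))"
      unfolding J(2) using I(1) J(1) by (intro sum.mono_neutral_cong_left) auto
    ultimately show ?thesis by (simp add: sum.distrib[symmetric] distrib_right)
  qed
  then show ?case using I(1) J(1) by (intro exI[of _ "I \<union> J"] exI[of _ ?c]) auto
qed

lemma power_times_exp_tendsto_0:
  assumes "0 < (\<delta> :: real)"
  shows "(\<lambda>n. real n ^ m * exp (- (\<delta> * real n))) \<longlonglongrightarrow> 0"
proof -
  have "filterlim (\<lambda>n. \<delta> * real n) at_top sequentially"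
    using assms by (intro filterlim_tendsto_pos_mult_at_top[OF tendsto_const] filterlim_real_sequentially)
  then have "(\<lambda>n. (\<delta> * real n) ^ m / exp (\<delta> * real n)) \<longlonglongrightarrow> 0"
    by (rule filterlim_compose[OF tendsto_power_div_exp_0])
  then have "(\<lambda>n. (1 / \<delta> ^ m) * ((\<delta> * real n) ^ m / exp (\<delta> * real n))) \<longlonglongrightarrow> (1 / \<delta> ^ m) * 0"
    by (rule tendsto_mult_left)
  then show ?thesis
    using assms by (simp add: power_mult_distrib exp_minus divide_inverse mult_ac)
qed

text \<open>After division by the fastest growing term all other terms tend to 0 along the natural
  numbers, so the coefficient of that term is a limit of zeros.\<close>

lemma EP_zero:
  assumes "f \<in> EP" and zero: "\<And>n. f (real n) = 0"
  shows "f t = 0"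
proof -
  obtain I c where I: "finite I" and f: "f = (\<lambda>t. \<Sum>i\<in>I. c i * t ^ snd i * exp (fst i * t))"
    using EP_normal_form[OF assms(1)] by blast
  define J where "J = {i \<in> I. c i \<noteq> 0}"
  have J: "finite J" using I by (simp add: J_def)
  have fJ: "f t = (\<Sum>i\<in>J. c i * t ^ snd i * exp (fst i * t))" for t
    unfolding f using I by (intro sum.mono_neutral_right) (auto simp: J_def)
  have "J = {}"
  proof (rule ccontr)
    assume ne: "J \<noteq> {}"
    define \<kappa> where "\<kappa> = Max (fst ` J)"
    define N where "N = {m. (\<kappa>, m) \<in> J}"
    have "N \<subseteq> snd ` J" by (force simp: N_def)
    then have N: "finite N" by (rule finite_subset) (simp add: J)
    have "\<kappa> \<in> fst ` J" unfolding \<kappa>_def using J ne by (intro Max_in) auto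
    then have Nne: "N \<noteq> {}" by (auto simp: N_def)
    define m where "m = Max N"
    have m: "(\<kappa>, m) \<in> J" using Max_in[OF N Nne] by (simp add: m_def N_def)
    let ?g = "\<lambda>i n. real n ^ snd i * exp (fst i * real n) / (real n ^ m * exp (\<kappa> * real n))"
    have lim: "?g i \<longlonglongrightarrow> (if i = (\<kappa>, m) then 1 else 0)" if i: "i \<in> J" for i
    proof -
      have \<kappa>_le: "fst i \<le> \<kappa>" unfolding \<kappa>_def using J i by (intro Max_ge) auto
      consider "fst i < \<kappa>" | "fst i = \<kappa>" "snd i < m" | "i = (\<kappa>, m)"
      proof (cases "fst i = \<kappa>")
        case True
        then have "snd i \<in> N" using i by (auto simp: N_def prod_eq_iff)
        then have "snd i \<le> m" unfolding m_def using N by simp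
        with True that(2,3) show ?thesis by (cases "snd i = m") (auto simp: prod_eq_iff)
      qed (use \<kappa>_le that(1) in simp)
      then show ?thesis
      proof cases
        case 1
        have "?g i \<longlonglongrightarrow> 0"
        proof (rule Lim_null_comparison)
          show "(\<lambda>n. real n ^ snd i * exp (- ((\<kappa> - fst i) * real n))) \<longlonglongrightarrow> 0"
            using 1 by (intro power_times_exp_tendsto_0) simp
          show "\<forall>\<^sub>F n in sequentially. norm (?g i n) \<le> real n ^ snd i * exp (- ((\<kappa> - fst i) * real n))"
          proof (rule eventually_sequentiallyI)
            fix n :: nat assume "1 \<le> n"
            then have "1 \<le> real n ^ m" by simp
            then have "real n ^ snd i * exp (- ((\<kappa> - fst i) * real n)) / real n ^ m \<le>
                real n ^ snd i * exp (- ((\<kappa> - fst i) * real n)) / 1"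
              using \<open>1 \<le> n\<close> by (intro divide_left_mono) simp_all
            moreover have "exp (- ((\<kappa> - fst i) * real n)) = exp (fst i * real n) / exp (\<kappa> * real n)"
              by (simp add: exp_diff[symmetric] algebra_simps)
            ultimately show "norm (?g i n) \<le> real n ^ snd i * exp (- ((\<kappa> - fst i) * real n))"
              by (simp add: mult.commute)
          qed
        qed
        then show ?thesis using 1 by auto
      next
        case 2
        have "(\<lambda>n. (1 / real n) ^ (m - snd i)) \<longlonglongrightarrow> 0 ^ (m - snd i)"
          by (intro tendsto_power lim_1_over_n)
        then have "(\<lambda>n. (1 / real n) ^ (m - snd i)) \<longlonglongrightarrow> 0" using 2 by (simp add: power_0_left)
        moreover have "\<forall>\<^sub>F n in sequentially. (1 / real n) ^ (m - snd i) = ?g i n"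
        proof (rule eventually_sequentiallyI)
          fix n :: nat assume "1 \<le> n"
          have "real n ^ m = real n ^ (m - snd i) * real n ^ snd i"
            using 2 by (simp add: power_add[symmetric])
          then show "(1 / real n) ^ (m - snd i) = ?g i n"
            using 2 \<open>1 \<le> n\<close> by (simp add: power_divide)
        qed
        ultimately have "?g i \<longlonglongrightarrow> 0" by (rule Lim_transform_eventually)
        moreover have "i \<noteq> (\<kappa>, m)" using 2 by (metis less_irrefl snd_conv)
        ultimately show ?thesis by simp
      next
        case 3
        have "\<forall>\<^sub>F n in sequentially. 1 = ?g i n"
          by (rule eventually_sequentiallyI[of 1]) (simp add: 3)
        then show ?thesis using 3 by (auto intro: Lim_transform_eventually[OF tendsto_const])
      qed
    qed
    have "(\<lambda>n. \<Sum>i\<in>J. c i * ?g i n) \<longlonglongrightarrow> (\<Sum>i\<in>J. c i * (if i = (\<kappa>, m) then 1 else 0))"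
      by (intro tendsto_sum tendsto_mult_left lim)
    moreover have "(\<Sum>i\<in>J. c i * ?g i n) = 0" for n
    proof -
      have "(\<Sum>i\<in>J. c i * ?g i n) = f (real n) / (real n ^ m * exp (\<kappa> * real n))"
        unfolding fJ sum_divide_distrib by (simp add: mult.assoc)
      then show ?thesis by (simp add: zero)
    qed
    moreover have "(\<Sum>i\<in>J. c i * (if i = (\<kappa>, m) then 1 else 0)) = c (\<kappa>, m)"
      using J m by (simp add: sum.delta mult_delta_right)
    ultimately have "c (\<kappa>, m) = 0" by (simp add: LIMSEQ_const_iff)
    with m show False by (simp add: J_def)
  qed
  then show ?thesis by (simp add: fJ)
qed

lemma EP_eqI:
  assumes "f \<in> EP" "g \<in> EP" "\<And>n. f (real n) = g (real n)"
  shows "f t = g t"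
  using EP_zero[OF EP_diff[OF assms(1,2)]] assms(3) by simp

section \<open>Linear difference equations with exponential polynomials\<close>

definition solvable :: "real \<Rightarrow> (real \<Rightarrow> real) \<Rightarrow> bool" where
  "solvable \<mu> e \<longleftrightarrow> (\<exists>w\<in>EP. \<forall>t. w (t + 1) - exp \<mu> * w t = e t)"

lemma solvable_add: "solvable \<mu> f \<Longrightarrow> solvable \<mu> g \<Longrightarrow> solvable \<mu> (\<lambda>t. f t + g t)"
proof -
  assume "solvable \<mu> f" "solvable \<mu> g"
  then obtain v w where "v \<in> EP" "w \<in> EP" "\<And>t. v (t + 1) - exp \<mu> * v t = f t"
      "\<And>t. w (t + 1) - exp \<mu> * w t = g t" unfolding solvable_def by blast
  then show ?thesis
    unfolding solvable_def
    by (intro bexI[of _ "\<lambda>t. v t + w t"]) (auto intro: EP.add simp: algebra_simps)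
qed

lemma solvable_sum: "(\<And>i. i \<in> I \<Longrightarrow> solvable \<mu> (f i)) \<Longrightarrow> solvable \<mu> (\<lambda>t. \<Sum>i\<in>I. f i t)"
proof (induction I rule: infinite_finite_induct)
  case (insert i I)
  then show ?case by (simp add: solvable_add)
qed (auto simp: solvable_def intro!: bexI[OF _ EP_const[of 0]])

lemma solvable_EP_difference:
  assumes "w \<in> EP" "solvable \<mu> (\<lambda>t. e t - (w (t + 1) - exp \<mu> * w t))"
  shows "solvable \<mu> e"
proof -
  have "solvable \<mu> (\<lambda>t. w (t + 1) - exp \<mu> * w t)"
    unfolding solvable_def using assms(1) by blast
  from solvable_add[OF this assms(2)] show ?thesis by simp
qed

lemma power_Suc_expand:
  fixes t :: real
  shows "(t + 1) ^ m = t ^ m + (\<Sum>j<m. real (m choose j) * t ^ j)"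
proof -
  have "(t + 1) ^ m = (\<Sum>j\<le>m. real (m choose j) * t ^ j)"
    by (subst binomial_ring) simp
  then show ?thesis by (simp add: lessThan_Suc_atMost[symmetric])
qed

text \<open>Induction on the degree: a multiple of one term reproduces the top term of the
  right-hand side, and the error \<open>P\<close> consists of terms of lower degree with the same
  rate.\<close>

lemma solvable_base: "solvable \<mu> (\<lambda>t. c * t ^ m * exp (\<kappa> * t))"
proof (induction m arbitrary: c rule: less_induct)
  case (less m)
  define P where "P b n k = (\<lambda>t. \<Sum>j<k. (b * real (n choose j)) * t ^ j * exp (\<kappa> * t))" for b n k
  have P: "solvable \<mu> (P b n m)" for b n
    unfolding P_def by (intro solvable_sum less.IH) simp
  show ?case
  proof (cases "\<kappa> = \<mu>")
    case False
    \<comment> \<open>Without resonance the difference operator multiplies the top term by this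
      number.\<close>
    define d where "d = exp \<kappa> - exp \<mu>"
    have d: "d \<noteq> 0" using False by (simp add: d_def)
    let ?w = "\<lambda>t. (c / d) * t ^ m * exp (\<kappa> * t)"
    have "c * t ^ m * exp (\<kappa> * t) - (?w (t + 1) - exp \<mu> * ?w t) = P (- (c / d) * exp \<kappa>) m m t" for t
    proof -
      have "?w (t + 1) = (c / d) * exp \<kappa> * (t ^ m + (\<Sum>j<m. real (m choose j) * t ^ j)) * exp (\<kappa> * t)"
        unfolding power_Suc_expand by (simp add: distrib_left exp_add mult_ac)
      moreover have "c * t ^ m * exp (\<kappa> * t) = (c / d) * (exp \<kappa> - exp \<mu>) * t ^ m * exp (\<kappa> * t)"
        using d by (simp add: d_def[symmetric])
      moreover have "P (- (c / d) * exp \<kappa>) m m t =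
          - (c / d) * exp \<kappa> * (\<Sum>j<m. real (m choose j) * t ^ j) * exp (\<kappa> * t)"
        by (simp add: P_def sum_distrib_left sum_distrib_right mult_ac)
      ultimately show ?thesis by (simp add: algebra_simps)
    qed
    with P have "solvable \<mu> (\<lambda>t. c * t ^ m * exp (\<kappa> * t) - (?w (t + 1) - exp \<mu> * ?w t))" by simp
    then show ?thesis by (rule solvable_EP_difference[OF EP.base])
  next
    case True
    \<comment> \<open>With resonance the top term cancels, so w has degree one higher; d is the
      factor with which the term of degree m then appears.\<close>
    define d where "d = real (Suc m) * exp \<mu>"
    have d: "d \<noteq> 0" by (simp add: d_def)
    let ?w = "\<lambda>t. (c / d) * t ^ Suc m * exp (\<kappa> * t)"
    have "c * t ^ m * exp (\<kappa> * t) - (?w (t + 1) - exp \<mu> * ?w t) =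
        P (- (c / d) * exp \<mu>) (Suc m) m t" for t
    proof -
      let ?S = "\<Sum>j<m. real (Suc m choose j) * t ^ j"
      have "?w (t + 1) = (c / d) * exp \<mu> * (t ^ Suc m + (?S + real (Suc m) * t ^ m)) * exp (\<kappa> * t)"
        unfolding power_Suc_expand by (simp add: True distrib_left exp_add mult_ac)
      moreover have "c * t ^ m * exp (\<kappa> * t) = (c / d) * (real (Suc m) * exp \<mu>) * t ^ m * exp (\<kappa> * t)"
        using d unfolding d_def[symmetric] by simp
      moreover have "P (- (c / d) * exp \<mu>) (Suc m) m t = - (c / d) * exp \<mu> * ?S * exp (\<kappa> * t)"
        by (simp add: P_def sum_distrib_left sum_distrib_right mult_ac)
      ultimately show ?thesis by (simp add: algebra_simps)
    qed
    with P have "solvable \<mu> (\<lambda>t. c * t ^ m * exp (\<kappa> * t) - (?w (t + 1) - exp \<mu> * ?w t))" by simp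
    then show ?thesis by (rule solvable_EP_difference[OF EP.base])
  qed
qed

lemma solvable_EP: "e \<in> EP \<Longrightarrow> solvable \<mu> e"
  by (induction rule: EP.induct) (simp_all add: solvable_base solvable_add)

text \<open>A particular solution is corrected by a multiple of exp (\<mu> n), the solution of the
  homogeneous equation, so as to match the initial value.\<close>

lemma EP_recurrence:
  assumes e: "e \<in> EP" and rec: "\<And>n. u (Suc n) = exp \<mu> * u n + e (real n)"
  shows "\<exists>w\<in>EP. \<forall>n. u n = w (real n)"
proof -
  obtain w where w: "w \<in> EP" "\<And>t. w (t + 1) - exp \<mu> * w t = e t"
    using solvable_EP[OF e] unfolding solvable_def by blast
  have "u n = w (real n) + (u 0 - w 0) * exp (\<mu> * real n)" for n
  proof (induction n)
    case (Suc n)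
    have "w (real n + 1) = exp \<mu> * w (real n) + e (real n)" using w(2)[of "real n"] by simp
    then show ?case
      using rec[of n] Suc by (simp add: add.commute distrib_left exp_add algebra_simps)
  qed simp
  moreover have "(\<lambda>t. w t + (u 0 - w 0) * exp (\<mu> * t)) \<in> EP"
    by (intro EP.add EP_mult EP_const EP_exp w(1))
  ultimately show ?thesis
    by (intro bexI[of _ "\<lambda>t. w t + (u 0 - w 0) * exp (\<mu> * t)"] allI)
qed

text \<open>Membership in each variable separately lets an identity on pairs of natural numbers be
  extended first in one variable, then in the other.\<close>

definition EP2 :: "(real \<times> real \<Rightarrow> real) set" where
  "EP2 = {h. (\<forall>s. (\<lambda>t. h (s, t)) \<in> EP) \<and> (\<forall>t. (\<lambda>s. h (s, t)) \<in> EP)}"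

lemma EP2_eqI:
  assumes "f \<in> EP2" "g \<in> EP2" "\<And>m n. f (real m, real n) = g (real m, real n)"
  shows "f (s, t) = g (s, t)"
proof -
  have fg: "(\<lambda>t. f (s, t)) \<in> EP" "(\<lambda>t. g (s, t)) \<in> EP" "(\<lambda>s. f (s, t)) \<in> EP" "(\<lambda>s. g (s, t)) \<in> EP" for s t
    using assms(1,2) by (auto simp: EP2_def)
  have "f (s, real n) = g (s, real n)" for n
    using EP_eqI[OF fg(3,4), of "real n" "real n" s] assms(3) by simp
  then show ?thesis using EP_eqI[OF fg(1,2), of s s t] by simp
qed

section \<open>The flow of a parabolic or hyperbolic series\<close>

lemma hcomp_0 [simp]: "hcomp a b v 0 = 0"
  by (simp add: hcomp_def hsum_finite)

lemma (in exp_monoid) coeff_algebra_EP: "coeff_algebra M EP UNIV"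
  by unfold_locales (simp_all add: EP_const EP.add EP_mult)

lemma (in exp_monoid) coeff_algebra_EP2: "coeff_algebra M EP2 UNIV"
  by unfold_locales (simp_all add: EP2_def EP_const EP.add EP_mult)

locale near_identity =
  fixes a :: real and v :: "expo hahn"
  assumes a: "0 < a" and v: "hpos v"
begin

abbreviation "M \<equiv> kmonoid v"

sublocale exp_monoid M
  by (rule exp_monoid_kmonoid[OF v])

text \<open>The \<open>n\<close>-th iterate of \<open>a x exp v\<close> is \<open>a\<^sup>n x exp (vs n)\<close>.\<close>

primrec vs :: "nat \<Rightarrow> expo hahn" where
  "vs 0 = 0"
| "vs (Suc n) = v + hcomp a 1 v (vs n)"

lemma hpos_vs: "hpos (vs n)"
  by (induction n) (simp_all add: hpos_add hpos_hcomp v)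

lemma hsupp_vs: "hsupp (vs n) \<subseteq> M"
proof (induction n)
  case (Suc n)
  have "hsupp (hcomp a 1 v (vs n)) \<subseteq> M" by (intro hsupp_hcomp_M v hsupp_kmonoid Suc)
  then show ?case using hsupp_add[of v "hcomp a 1 v (vs n)"] hsupp_kmonoid[of v] by auto
qed simp

text \<open>The third coordinate of the law f^(m+n) = f^m \<circ> f^n; the induction step is
  associativity, \<open>hcomp_comp\<close>.\<close>

lemma vs_add: "vs (m + n) = vs n + hcomp (a ^ n) 1 (vs n) (vs m)"
proof (induction n)
  case (Suc n)
  have "vs (m + Suc n) = v + hcomp a 1 v (vs n + hcomp (a ^ n) 1 (vs n) (vs m))"
    using Suc by simp
  also have "\<dots> = vs (Suc n) + hcomp a 1 v (hcomp (a ^ n) 1 (vs n) (vs m))"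
    by (simp add: hcomp_add v add.assoc)
  also have "hcomp a 1 v (hcomp (a ^ n) 1 (vs n) (vs m)) = hcomp (a ^ Suc n) 1 (vs (Suc n)) (vs m)"
    using hcomp_comp[of a "a ^ n" 1 1 v "vs n" "vs m"] a v hpos_vs by (simp add: mult.commute)
  finally show ?case .
qed (simp add: hcomp_id)

text \<open>Let \<alpha> be the real exponent of p. By triangularity the coefficient at p of the
  next iterate is a^\<alpha> times the present one plus contributions of smaller exponents, which
  are exponential polynomials by induction. So \<open>EP_recurrence\<close> applies with \<mu> =
  \<alpha> log a.\<close>

lemma vs_exponential_polynomial:
  assumes "p \<in> M"
  shows "\<exists>e\<in>EP. \<forall>n. hcoeff (vs n) p = e (real n)"
  using wo_M assms
proof (induction p rule: wo_induct)
  case (less p)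
  let ?Q = "{q \<in> M. p - q \<in> M} - {p}"
  let ?K = "\<lambda>q. a powr xdeg q * hcoeff (kexp a v q) (p - q)"
  have "\<forall>q\<in>?Q. \<exists>e. e \<in> EP \<and> (\<forall>n. hcoeff (vs n) q = e (real n))"
  proof
    fix q assume q: "q \<in> ?Q"
    then have "0 \<le> p - q" using M_nonneg by auto
    then have "q < p" using q by auto
    then show "\<exists>e. e \<in> EP \<and> (\<forall>n. hcoeff (vs n) q = e (real n))" using less.IH[of q] q by blast
  qed
  from bchoice[OF this] obtain e
    where e': "\<forall>q\<in>?Q. e q \<in> EP \<and> (\<forall>n. hcoeff (vs n) q = e q (real n))" ..
  then have e: "q \<in> ?Q \<Longrightarrow> e q \<in> EP" "q \<in> ?Q \<Longrightarrow> hcoeff (vs n) q = e q (real n)" for q n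
    by blast+
  have p: "p \<in> {q \<in> M. p - q \<in> M}" using less.hyps zero_M by simp
  have "hcoeff (vs (Suc n)) p =
      exp (xdeg p * ln a) * hcoeff (vs n) p + (hcoeff v p + (\<Sum>q\<in>?Q. e q (real n) * ?K q))" for n
  proof -
    have "hcoeff (vs (Suc n)) p = hcoeff v p + (hcoeff (vs n) p * ?K p + (\<Sum>q\<in>?Q. hcoeff (vs n) q * ?K q))"
      using hcoeff_hcomp[OF a v hsupp_kmonoid hsupp_vs, of n p]
        sum.remove[OF finite_splits p, of "\<lambda>q. hcoeff (vs n) q * ?K q"]
      by (simp only: vs.simps hcoeff_add)
    moreover have "(\<Sum>q\<in>?Q. hcoeff (vs n) q * ?K q) = (\<Sum>q\<in>?Q. e q (real n) * ?K q)"
      using e(2) by (intro sum.cong refl) simp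
    ultimately show ?thesis
      using a by (simp add: hcoeff_kexp_0 v powr_def mult.commute)
  qed
  then show ?case
    by (intro EP_recurrence[where e = "\<lambda>t. hcoeff v p + (\<Sum>q\<in>?Q. e q t * ?K q)"])
      (auto intro!: EP.add EP_const EP_sum EP_mult e(1))
qed

text \<open>For p in M the chosen interpolation is unique by \<open>EP_eqI\<close>.\<close>

definition E :: "expo \<Rightarrow> real \<Rightarrow> real" where
  "E p = (SOME e. e \<in> EP \<and> (\<forall>n. hcoeff (vs n) p = e (real n)))"

definition V :: "real \<Rightarrow> expo hahn" where
  "V t = Abs_hahn (\<lambda>p. if p \<in> M then E p t else 0)"

lemma E: "p \<in> M \<Longrightarrow> E p \<in> EP" "p \<in> M \<Longrightarrow> hcoeff (vs n) p = E p (real n)"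
  using someI_ex[OF vs_exponential_polynomial[unfolded Bex_def], of p] unfolding E_def by blast+

lemma hcoeff_V: "hcoeff (V t) p = (if p \<in> M then E p t else 0)"
  unfolding V_def by (subst hcoeff_Abs[OF wo_M]) auto

lemma V_nat: "V (real n) = vs n"
  by (rule hahn_eqI) (use E(2) hcoeff_eq_0[OF hsupp_vs] in \<open>auto simp: hcoeff_V\<close>)

lemma hsupp_V: "hsupp (V t) \<subseteq> M"
  by (auto simp: hsupp_def hcoeff_V split: if_splits)

lemma hcoeff_V_EP: "(\<lambda>t. hcoeff (V t) p) \<in> EP"
  by (cases "p \<in> M") (simp_all add: hcoeff_V E(1) EP_const)

text \<open>The constant coefficient is 0 at all natural times, hence at all times by
  \<open>EP_zero\<close>.\<close>

lemma hpos_V: "hpos (V t)"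
  unfolding hpos_def
proof
  fix p assume p: "p \<in> hsupp (V t)"
  then have "0 \<le> p" using hsupp_V[of t] M_nonneg by auto
  moreover have "p \<noteq> 0"
  proof
    assume "p = 0"
    have "hcoeff (V (real n)) 0 = 0" for n
      using hpos_vs[of n] unfolding V_nat by (auto simp: hpos_def hsupp_def)
    then have "hcoeff (V t) 0 = 0" using EP_zero[OF hcoeff_V_EP] by blast
    with p \<open>p = 0\<close> show False by (simp add: hsupp_def)
  qed
  ultimately show "p \<in> {0<..}" by (simp add: less_le)
qed

text \<open>At natural times this is \<open>vs_add\<close>. The coefficients of both sides are in
  \<open>EP2\<close>, those on the right because composition stays within a function algebra, so the
  identity extends to real times.\<close>

lemma V_add: "V (s + t) = V t + hcomp (a powr t) 1 (V t) (V s)"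
proof (rule hahn_eqI)
  fix p
  interpret c: coeff_algebra M EP2 UNIV by (rule coeff_algebra_EP2)
  have snd_EP2: "(\<lambda>x. e (snd x)) \<in> EP2" if "e \<in> EP" for e
    using that EP_const by (simp add: EP2_def)
  have fst_EP2: "(\<lambda>x. e (fst x)) \<in> EP2" if "e \<in> EP" for e
    using that EP_const by (simp add: EP2_def)
  have fam2: "c.fam (\<lambda>x. V (snd x))"
    using hsupp_V snd_EP2[OF hcoeff_V_EP] by (intro c.famI)
  have fam1: "c.fam (\<lambda>x. V (fst x))"
    using hsupp_V fst_EP2[OF hcoeff_V_EP] by (intro c.famI)
  have "(\<lambda>t. t * ln a) \<in> EP" by (intro EP_mult EP_id EP_const)
  then have ln: "(\<lambda>x. ln (a powr snd x)) \<in> EP2" using snd_EP2 a by (simp add: ln_powr)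
  have powr: "(\<lambda>x. (a powr snd x) powr r) \<in> EP2" for r
    using snd_EP2[OF EP_exp[of "r * ln a"]] a by (simp add: powr_powr powr_def mult_ac)
  have "c.fam (\<lambda>x. V (snd x) + hcomp (a powr snd x) 1 (V (snd x)) (V (fst x)))"
    by (intro c.fam_add c.fam_hcomp fam1 fam2 hpos_V ln powr) (use a in simp)
  from c.famD(2)[OF this UNIV_I, of p]
  have R: "(\<lambda>x. hcoeff (V (snd x) + hcomp (a powr snd x) 1 (V (snd x)) (V (fst x))) p) \<in> EP2" .
  have L: "(\<lambda>x. hcoeff (V (fst x + snd x)) p) \<in> EP2"
    unfolding EP2_def
  proof (intro CollectI conjI allI)
    fix u :: real
    show "(\<lambda>t. hcoeff (V (fst (u, t) + snd (u, t))) p) \<in> EP"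
      using EP_shift[OF hcoeff_V_EP, of u p] by (simp add: add.commute)
    show "(\<lambda>s. hcoeff (V (fst (s, u) + snd (s, u))) p) \<in> EP"
      using EP_shift[OF hcoeff_V_EP, of u p] by simp
  qed
  have "hcoeff (V (real m + real n)) p =
      hcoeff (V (real n) + hcomp (a powr real n) 1 (V (real n)) (V (real m))) p" for m n
  proof -
    have "V (real m + real n) = vs (m + n)" using V_nat[of "m + n"] by simp
    then show ?thesis unfolding vs_add V_nat using a by (simp add: powr_realpow)
  qed
  then show "hcoeff (V (s + t)) p = hcoeff (V t + hcomp (a powr t) 1 (V t) (V s)) p"
    using EP2_eqI[OF L R, of s t] by simp
qed

definition F :: "real \<Rightarrow> series" where
  "F t = ser (fser (a powr t) 1 (V t))"

lemma flow_F: "flow F"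
  unfolding flow_def
proof (intro conjI allI)
  show "F t \<in> log_series_H" for t
    unfolding F_def using a hpos_V by (intro fser_in_log_series_H) simp_all
  show "F 0 = id_series"
    using V_nat[of 0] a by (simp add: F_def id_series_fser)
  show "F s \<circ>\<^sub>s F t = F (s + t)" for s t
    unfolding F_def using a by (simp add: fser_comp_ser hpos_V V_add powr_add)
qed

lemma F_1: "F 1 = ser (fser a 1 v)"
  using V_nat[of 1] a by (simp add: F_def)

lemma hcoeff_F_EP: "(\<lambda>t. F t p) \<in> EP"
proof -
  interpret c: coeff_algebra M EP UNIV by (rule coeff_algebra_EP)
  have "c.fam V" using hsupp_V hcoeff_V_EP by (intro c.famI)
  then have "c.fam (\<lambda>t. hexp (V t))" unfolding hexp_def by (intro c.fam_hev hpos_V)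
  then have "(\<lambda>t. hcoeff (hexp (V t)) (expo_of p - Expo 1 0)) \<in> EP" by (rule c.famD(2)) simp
  then have "(\<lambda>t. exp (ln a * t) * hcoeff (hexp (V t)) (expo_of p - Expo 1 0)) \<in> EP"
    by (intro EP_mult EP_exp)
  moreover have "F t p = exp (ln a * t) * hcoeff (hexp (V t)) (expo_of p - Expo 1 0)" for t
    using a by (simp add: F_def ser_def fser_def hcoeff_hmonom_times powr_def mult.commute[of t])
  ultimately show ?thesis by simp
qed

definition S :: "(real \<times> int) set" where
  "S = expo_of -` sumset {Expo 1 0} M"

lemma supp_F: "supp (F t) \<subseteq> S"
proof -
  have "hsupp (hexp (V t)) \<subseteq> M"
    unfolding hexp_def
    by (rule order_trans[OF hsupp_hev[OF hpos_V hsupp_V] gen_monoid_M[OF order_refl]])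
  then have "hsupp (fser (a powr t) 1 (V t)) \<subseteq> sumset {Expo 1 0} M"
    unfolding fser_def by (rule order_trans[OF hsupp_hmonom_times sumset_mono[OF order_refl]])
  then show ?thesis by (auto simp: F_def supp_ser S_def)
qed

lemma well_ordered_S: "well_ordered S"
  unfolding well_ordered_iff_wo S_def expo_of_image_vimage
  by (intro wo_sumset wo_M wo_singleton)

lemma S_pos: "S \<subseteq> {0<..} \<times> UNIV"
proof
  fix p assume "p \<in> S"
  then obtain q where q: "q \<in> M" "expo_of p = Expo 1 0 + q" by (auto simp: S_def sumset_def)
  from q(1) have "0 \<le> q" using M_nonneg by auto
  then have "0 \<le> xdeg q" by (auto simp: less_eq_expo_def)
  then have "0 < xdeg (expo_of p)" using q(2) by simp
  then show "p \<in> {0<..} \<times> UNIV" by (cases p) simp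
qed

lemma C1_flow_F: "C1_flow F"
  unfolding C1_flow_def
  using flow_F supp_F well_ordered_S S_pos EP_C1[OF hcoeff_F_EP] by blast

lemma C1_flow_of_F: "\<exists>\<xi>\<in>log_series. C1_flow_of \<xi> F"
proof -
  define \<xi> where "\<xi> p = (SOME d. ((\<lambda>t. F t p) has_real_derivative d) (at 0))" for p
  have \<xi>: "((\<lambda>t. F t p) has_real_derivative \<xi> p) (at 0)" for p
  proof -
    obtain f' where "\<forall>t. ((\<lambda>t. F t p) has_real_derivative f' t) (at t)"
      using EP_deriv[OF hcoeff_F_EP, of p] by blast
    then have "\<exists>d. ((\<lambda>t. F t p) has_real_derivative d) (at 0)" by blast
    then show ?thesis unfolding \<xi>_def by (rule someI_ex)
  qed
  have "supp \<xi> \<subseteq> S"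
  proof
    fix p assume p: "p \<in> supp \<xi>"
    show "p \<in> S"
    proof (rule ccontr)
      assume "p \<notin> S"
      have "F t p = 0" for t
      proof -
        from \<open>p \<notin> S\<close> have "p \<notin> supp (F t)" using supp_F[of t] by blast
        then show ?thesis by (simp add: supp_def)
      qed
      then have "((\<lambda>_. 0) has_real_derivative \<xi> p) (at 0)" using \<xi>[of p] by simp
      then have "\<xi> p = 0" by (rule DERIV_unique[OF _ DERIV_const])
      with p show False by (simp add: supp_def)
    qed
  qed
  then have "supp \<xi> \<subseteq> {0<..} \<times> UNIV" "well_ordered (supp \<xi>)"
    using S_pos well_ordered_S wo_subset[of "expo_of ` S" "expo_of ` supp \<xi>"]
    by (simp_all add: well_ordered_iff_wo image_mono)
  then have "\<xi> \<in> log_series" by (simp add: log_series_def)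
  then show ?thesis using C1_flow_F \<xi> unfolding C1_flow_of_def by blast
qed

end

section \<open>Uniqueness of the flow\<close>

text \<open>\<phi> vanishes at the integers, so n \<phi>(t) = \<phi>(n t) = \<phi>(frac (n t)) is
  bounded in n, since \<phi> is bounded on [0, 1].\<close>

lemma additive_continuous_eq_0:
  fixes \<phi> :: "real \<Rightarrow> real"
  assumes add: "\<And>s t. \<phi> (s + t) = \<phi> s + \<phi> t" and cont: "continuous_on UNIV \<phi>" and one: "\<phi> 1 = 0"
  shows "\<phi> t = 0"
proof -
  have zero: "\<phi> 0 = 0" using add[of 0 0] by simp
  have neg: "\<phi> (- s) = - \<phi> s" for s using add[of s "- s"] zero by simp
  have mult: "\<phi> (real n * s) = real n * \<phi> s" for n s
    by (induction n) (simp_all add: zero add distrib_right)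
  have nat: "\<phi> (real n) = 0" for n using mult[of n 1] one by simp
  have int: "\<phi> (real_of_int k) = 0" for k
  proof (cases "0 \<le> k")
    case True
    then show ?thesis using nat[of "nat k"] by simp
  next
    case False
    then have "\<phi> (- real_of_int k) = 0" using nat[of "nat (- k)"] by simp
    then show ?thesis using neg[of "real_of_int k"] by simp
  qed
  have "bounded (\<phi> ` {0..1})"
    by (intro compact_imp_bounded compact_continuous_image continuous_on_subset[OF cont]) auto
  then obtain B where "\<forall>s\<in>{0..1}. \<bar>\<phi> s\<bar> \<le> B"
    unfolding bounded_iff by auto
  then have B: "\<bar>\<phi> s\<bar> \<le> B" if "s \<in> {0..1}" for s using that by blast
  have bd: "real n * \<bar>\<phi> t\<bar> \<le> B" for n
  proof -
    have "real n * \<phi> t = \<phi> (real n * t)" by (simp add: mult)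
    also have "\<dots> = \<phi> (frac (real n * t)) + \<phi> (real_of_int \<lfloor>real n * t\<rfloor>)"
      by (subst add[symmetric]) (simp add: frac_def)
    also have "\<dots> = \<phi> (frac (real n * t))" by (simp add: int)
    finally have "real n * \<bar>\<phi> t\<bar> = \<bar>\<phi> (frac (real n * t))\<bar>" by (metis abs_mult abs_of_nat)
    also have "\<dots> \<le> B" by (intro B) (simp add: frac_lt_1 less_imp_le)
    finally show ?thesis .
  qed
  show ?thesis
  proof (rule ccontr)
    assume "\<phi> t \<noteq> 0"
    then obtain n where "B < real n * \<bar>\<phi> t\<bar>" using reals_Archimedean3[of "\<bar>\<phi> t\<bar>"] by auto
    with bd[of n] show False by simp
  qed
qed

definition cont_funs :: "(real \<Rightarrow> real) set" where
  "cont_funs = {f. continuous_on UNIV f}"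

lemma (in exp_monoid) coeff_algebra_cont: "coeff_algebra M cont_funs UNIV"
  by unfold_locales (auto simp: cont_funs_def intro: continuous_intros)

text \<open>S is a parameter so that two flows can be compared inside one common support.\<close>

locale continuous_flow =
  fixes F :: "real \<Rightarrow> series" and S :: "(real \<times> int) set"
  assumes flow: "flow F" and S: "well_ordered S" and supp: "supp (F t) \<subseteq> S"
    and cont: "continuous_on UNIV (\<lambda>t. F t p)"
begin

definition coords :: "real \<Rightarrow> real \<times> real \<times> expo hahn" where
  "coords t = (SOME (a, b, v). 0 < a \<and> 0 < b \<and> hpos v \<and> F t = ser (fser a b v))"

definition "A t = fst (coords t)"
definition "B t = fst (snd (coords t))"
definition "V t = snd (snd (coords t))"

lemma ABV: "0 < A t" "0 < B t" "hpos (V t)" "F t = ser (fser (A t) (B t) (V t))"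
proof -
  have "F t \<in> log_series_H" using flow by (simp add: flow_def)
  then obtain a b v where "0 < a" "0 < b" "hpos v" "F t = ser (fser a b v)"
    by (rule log_series_H_fser)
  let ?P = "\<lambda>(a, b, v). 0 < a \<and> 0 < b \<and> hpos v \<and> F t = ser (fser a b v)"
  have "?P (a, b, v)"
    using \<open>0 < a\<close> \<open>0 < b\<close> \<open>hpos v\<close> \<open>F t = ser (fser a b v)\<close> by (simp only: prod.case simp_thms)
  then have "?P (coords t)" unfolding coords_def by (rule someI[of ?P])
  then show "0 < A t" "0 < B t" "hpos (V t)" "F t = ser (fser (A t) (B t) (V t))"
    unfolding A_def B_def V_def split_def by blast+
qed

lemma group_law:
  "A (s + t) = A s * A t powr B s \<and> B (s + t) = B t * B s \<and>
    V (s + t) = B s *\<^sub>R V t + hcomp (A t) (B t) (V t) (V s)"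
proof -
  have "F s \<circ>\<^sub>s F t = F (s + t)" using flow by (simp add: flow_def)
  then have "fser (A (s + t)) (B (s + t)) (V (s + t)) =
      fser (A s * A t powr B s) (B t * B s) (B s *\<^sub>R V t + hcomp (A t) (B t) (V t) (V s))"
    using fser_comp_ser[OF ABV(1-3)[of t] ABV(3)[of s], of "A s" "B s"]
    unfolding ABV(4)[symmetric] by (simp add: ABV(4)[of "s + t"])
  moreover have "0 < A s * A t powr B s" using ABV(1)[of s] ABV(1)[of t] by simp
  moreover have "0 < B t * B s" by (intro mult_pos_pos ABV)
  moreover have "hpos (B s *\<^sub>R V t + hcomp (A t) (B t) (V t) (V s))"
    by (intro hpos_add hpos_scaleR hpos_hcomp ABV)
  ultimately show ?thesis using fser_inject[OF ABV(1-3)] by blast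
qed

lemma B_0: "B 0 = 1"
proof -
  have "fser (A 0) (B 0) (V 0) = fser 1 1 0"
    using flow ABV(4)[of 0] unfolding flow_def id_series_fser by simp
  from fser_inject[OF ABV(1-3) _ _ _ this] show ?thesis by simp
qed

text \<open>If B t < 1, the leading exponents (B t)^n of the flow at the times n t would descend
  forever inside the well-ordered S.\<close>

lemma B_ge_1: "1 \<le> B t"
proof (rule ccontr)
  assume lt: "\<not> 1 \<le> B t"
  have pow: "B (real n * t) = B t ^ n" for n
    using group_law by (induction n) (simp_all add: B_0 distrib_right)
  have mem: "Expo (B s) 0 \<in> expo_of ` S" for s
  proof (rule image_eqI[of _ _ "(B s, 0)"])
    have "F s (B s, 0) = A s" unfolding ABV(4)[of s] by (rule fser_simps(1)[OF ABV(1-3)])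
    then have "(B s, 0) \<in> supp (F s)" using ABV(1)[of s] by (simp add: supp_def)
    then show "(B s, 0) \<in> S" using supp by blast
  qed simp
  have "\<exists>m\<in>range (\<lambda>n. Expo (B (real n * t)) 0). \<forall>x\<in>range (\<lambda>n. Expo (B (real n * t)) 0). m \<le> x"
    using S unfolding well_ordered_iff_wo wo_def
    by (elim allE[of _ "range (\<lambda>n. Expo (B (real n * t)) 0)"]) (use mem in auto)
  then have "\<exists>n. \<forall>k. Expo (B (real n * t)) 0 \<le> Expo (B (real k * t)) 0" by simp
  then obtain n where "\<forall>k. Expo (B (real n * t)) 0 \<le> Expo (B (real k * t)) 0" ..
  then have "Expo (B (real n * t)) 0 \<le> Expo (B (real (Suc n) * t)) 0" ..
  then have "B t ^ n \<le> B t ^ Suc n" unfolding pow by (auto dest: xdeg_mono)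
  moreover have "B t * B t ^ n < 1 * B t ^ n"
    using lt ABV(2)[of t] by (intro mult_strict_right_mono) auto
  ultimately show False by simp
qed

text \<open>The lower bound also holds at -t, where B has the reciprocal value.\<close>

lemma B_eq_1: "B t = 1"
proof -
  have "B (- t) * B t = 1" using group_law[of t "- t"] B_0 by simp
  moreover have "1 * B t \<le> B (- t) * B t"
    using B_ge_1[of "- t"] ABV(2)[of t] by (intro mult_right_mono) auto
  ultimately show ?thesis using B_ge_1[of t] by simp
qed

lemma F_eq: "F t = ser (fser (A t) 1 (V t))"
  using ABV(4)[of t] by (simp add: B_eq_1)

lemma A_add: "A (s + t) = A s * A t"
  using group_law[of s t] ABV(1)[of t] by (simp add: B_eq_1)

lemma V_add: "V (s + t) = V t + hcomp (A t) 1 (V t) (V s)"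
  using group_law[of s t] by (simp add: B_eq_1)

lemma cont_A: "continuous_on UNIV A"
proof -
  have "F t (1, 0) = A t" for t
    unfolding F_eq[of t] by (rule fser_simps(1)[OF ABV(1) zero_less_one ABV(3)])
  then show ?thesis using cont[of "(1, 0)"] by simp
qed

text \<open>Division of F t by its leading term shifts S by the exponent of x. The positive part of
  the shifted set contains the support of exp (V t) - 1, so the logarithm V t is supported in the
  monoid generated by it.\<close>

definition W :: "expo set" where
  "W = insert (Expo 0 1) (sumset {- Expo 1 0} (expo_of ` S) \<inter> {0<..})"

lemma exp_monoid_W: "exp_monoid (gen_monoid W)"
proof (rule exp_monoid_gen)
  have "wo (sumset {- Expo 1 0} (expo_of ` S))"
    using S by (intro wo_sumset) (simp_all add: well_ordered_iff_wo)
  then show "wo W" unfolding W_def wo_insert by (rule wo_subset) blast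
qed (auto simp: W_def)

lemma hexp_V: "hexp (V t) = hmonom (1 / A t) (- Expo 1 0) * fser (A t) 1 (V t)"
  unfolding fser_def mult.assoc[symmetric] hmonom_mult
  using ABV(1)[of t] by (simp add: hmonom_1)

lemma hsupp_fser_A: "hsupp (fser (A t) 1 (V t)) \<subseteq> expo_of ` S"
  using supp[of t] expo_of_image_supp[of "fser (A t) 1 (V t)"] unfolding F_eq[of t] by blast

text \<open>The coefficients of exp (V t) are those of F t divided by A t > 0, hence continuous, and
  taking logarithms stays within the algebra of continuous functions.\<close>

lemma V_cont: "hsupp (V t) \<subseteq> gen_monoid W" "continuous_on UNIV (\<lambda>t. hcoeff (V t) p)"
proof -
  interpret exp_monoid "gen_monoid W" by (rule exp_monoid_W)
  interpret c: coeff_algebra "gen_monoid W" cont_funs UNIV by (rule coeff_algebra_cont)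
  have pos: "hpos (hexp (V t) - 1)" for t by (rule hpos_hexp_minus_1[OF ABV(3)])
  have "c.fam (\<lambda>t. hexp (V t) - 1)"
  proof (rule c.famI)
    fix t
    have V: "hsupp (hexp (V t)) \<subseteq> sumset {- Expo 1 0} (expo_of ` S)"
      unfolding hexp_V by (rule order_trans[OF hsupp_hmonom_times sumset_mono[OF order_refl hsupp_fser_A]])
    have "hsupp (hexp (V t) - 1) \<subseteq> W"
    proof
      fix q assume q: "q \<in> hsupp (hexp (V t) - 1)"
      then have "0 < q" using pos[of t] by (auto simp: hpos_def)
      moreover from this have "q \<in> hsupp (hexp (V t))" using q by (auto simp: hsupp_def hcoeff_1 split: if_splits)
      ultimately show "q \<in> W" using V by (auto simp: W_def)
    qed
    then show "hsupp (hexp (V t) - 1) \<subseteq> gen_monoid W" by (rule order_trans[OF _ subset_gen_monoid])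
  next
    fix p
    obtain q where q: "p + Expo 1 0 = expo_of q" using expo_of_surj by blast
    have "hcoeff (hexp (V t) - 1) p = F t q / A t - hcoeff 1 p" for t
      unfolding hcoeff_minus hexp_V[of t] F_eq[of t] by (simp add: hcoeff_hmonom_times ser_def q[symmetric])
    moreover have "continuous_on UNIV (\<lambda>t. F t q / A t - hcoeff 1 p)"
      using ABV(1) by (intro continuous_intros cont cont_A) (auto simp: less_imp_neq[symmetric])
    ultimately show "(\<lambda>t. hcoeff (hexp (V t) - 1) p) \<in> cont_funs" by (simp add: cont_funs_def)
  qed
  then have "c.fam (\<lambda>t. hln (hexp (V t) - 1))" unfolding hln_def by (rule c.fam_hev[OF _ pos])
  then have "c.fam V" by (simp add: hln_hexp ABV(3))
  from c.famD[OF this] show "hsupp (V t) \<subseteq> gen_monoid W" "continuous_on UNIV (\<lambda>t. hcoeff (V t) p)"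
    by (simp_all add: cont_funs_def)
qed

end

lemma continuous_flow_unique:
  assumes F: "continuous_flow F S" and G: "continuous_flow G S" and eq: "F 1 = G 1"
  shows "F = G"
proof -
  interpret F: continuous_flow F S by (rule F)
  interpret G: continuous_flow G S by (rule G)
  interpret exp_monoid "gen_monoid F.W" by (rule F.exp_monoid_W)
  let ?M = "gen_monoid F.W"
  have "fser (F.A 1) 1 (F.V 1) = fser (G.A 1) 1 (G.V 1)"
    using eq F.F_eq[of 1] G.F_eq[of 1] by simp
  from fser_inject[OF F.ABV(1) zero_less_one F.ABV(3) G.ABV(1) zero_less_one G.ABV(3) this]
  have AV1: "F.A 1 = G.A 1" "F.V 1 = G.V 1" by blast+
  have A: "F.A t = G.A t" for t
  proof -
    have "ln (F.A t) - ln (G.A t) = 0"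
    proof (rule additive_continuous_eq_0[where \<phi> = "\<lambda>t. ln (F.A t) - ln (G.A t)"])
      show "continuous_on UNIV (\<lambda>t. ln (F.A t) - ln (G.A t))"
        using F.ABV(1) G.ABV(1)
        by (intro continuous_intros F.cont_A G.cont_A) (auto simp: less_imp_neq[symmetric])
      show "ln (F.A (s + t)) - ln (G.A (s + t)) =
          ln (F.A s) - ln (G.A s) + (ln (F.A t) - ln (G.A t))" for s t
        by (simp add: F.A_add G.A_add ln_mult_pos F.ABV(1) G.ABV(1))
    qed (simp add: AV1)
    then show ?thesis using F.ABV(1) G.ABV(1) by simp
  qed
  have A1: "F.A t = 1" if "F.A 1 = 1" for t
  proof -
    have "ln (F.A t) = 0"
    proof (rule additive_continuous_eq_0[where \<phi> = "\<lambda>t. ln (F.A t)"])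
      show "continuous_on UNIV (\<lambda>t. ln (F.A t))"
        using F.ABV(1) by (intro continuous_intros F.cont_A) (auto simp: less_imp_neq[symmetric])
      show "ln (F.A (s + t)) = ln (F.A s) + ln (F.A t)" for s t
        by (simp add: F.A_add ln_mult_pos F.ABV(1))
    qed (simp add: that)
    then show ?thesis using F.ABV(1)[of t] by simp
  qed
  \<comment> \<open>\<open>W\<close> is determined by S, so the same monoid supports the coordinates
    of both flows.\<close>
  note FM = F.V_cont(1) and GM = G.V_cont(1)
  have V: "\<forall>t. hcoeff (F.V t) r = hcoeff (G.V t) r" if "r \<in> ?M" for r
    using wo_M that
  proof (induction r rule: wo_induct)
    case (less r)
    have IH: "hcoeff (F.V t) s = hcoeff (G.V t) s" if "s < r" for s t
    proof (cases "s \<in> ?M")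
      case True
      from less.IH[OF this that] show ?thesis by (rule spec)
    next
      case False
      show ?thesis unfolding hcoeff_eq_0[OF FM False] hcoeff_eq_0[OF GM False] ..
    qed
    define d where "d t = hcoeff (F.V t) r - hcoeff (G.V t) r" for t
    \<comment> \<open>The group laws of the two flows are subtracted. By induction the arguments
      agree below r, so only the diagonal term of composition remains.\<close>
    have d_add: "d (s + t) = d t + F.A t powr xdeg r * d s" for s t
    proof -
      let ?X = "hcoeff (hcomp (F.A t) 1 (F.V t) (F.V s)) r"
      let ?Y = "hcoeff (hcomp (F.A t) 1 (G.V t) (G.V s)) r"
      have "?X - ?Y = F.A t powr xdeg r * d s"
        unfolding d_def
        by (rule hcoeff_hcomp_diff[OF F.ABV(1,3) FM G.ABV(3) GM F.ABV(3) FM G.ABV(3) GM less.hyps IH IH])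
      moreover have "d (s + t) = (hcoeff (F.V t) r + ?X) - (hcoeff (G.V t) r + ?Y)"
        unfolding d_def F.V_add[of s t] G.V_add[of s t] A[of t, symmetric] hcoeff_add ..
      ultimately show ?thesis by (simp add: d_def)
    qed
    have d1: "d 1 = 0" by (simp add: d_def AV1)
    \<comment> \<open>If the multiplier \<open>F.A t powr xdeg r\<close> is 1 at all times, d is
      additive and continuous. Otherwise it differs from 1 at t = 1, and comparing d (t + 1) with d
      (1 + t) gives an equation whose only solution is d t = 0.\<close>
    have "d t = 0" for t
    proof (cases "F.A 1 = 1 \<or> xdeg r = 0")
      case True
      then have "F.A t powr xdeg r = 1" for t using A1[of t] F.ABV(1)[of t] by auto
      then have "d (s + t) = d s + d t" for s t using d_add[of s t] by simp
      moreover have "continuous_on UNIV d"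
        unfolding d_def by (intro continuous_intros F.V_cont G.V_cont)
      ultimately show ?thesis using d1 by (rule additive_continuous_eq_0)
    next
      case False
      have "F.A 1 powr xdeg r \<noteq> 1" using False F.ABV(1)[of 1] by (simp add: powr_def)
      moreover have "d t = F.A 1 powr xdeg r * d t"
        using d_add[of t 1] d_add[of 1 t] d1 by (simp add: add.commute)
      ultimately show ?thesis by simp
    qed
    then show ?case by (simp add: d_def)
  qed
  have "F.V t = G.V t" for t
  proof (rule hahn_eqI)
    fix p
    show "hcoeff (F.V t) p = hcoeff (G.V t) p"
    proof (cases "p \<in> ?M")
      case True
      from V[OF this] show ?thesis by (rule spec)
    next
      case False
      show ?thesis unfolding hcoeff_eq_0[OF FM False] hcoeff_eq_0[OF GM False] ..
    qed
  qed
  then have "F t = G t" for t unfolding F.F_eq[of t] G.F_eq[of t] A by simp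
  then show ?thesis by (rule ext)
qed

lemma C1_flow_continuous:
  assumes "C1_flow F" "well_ordered S" "\<And>t. supp (F t) \<subseteq> S"
  shows "continuous_flow F S"
proof
  obtain T where T': "\<forall>t. supp (F t) \<subseteq> T" "\<forall>p\<in>T. (\<lambda>t. F t p) C1_differentiable_on UNIV"
    using assms(1) unfolding C1_flow_def by blast
  note T = T'(1)[rule_format] T'(2)[THEN bspec]
  show "continuous_on UNIV (\<lambda>t. F t p)" for p
  proof (cases "p \<in> T")
    case True
    then show ?thesis by (intro C1_differentiable_imp_continuous_on T)
  next
    case False
    have "F t p = 0" for t
    proof -
      have "p \<notin> supp (F t)" using False T(1)[of t] by blast
      then show ?thesis by (simp add: supp_def)
    qed
    then show ?thesis by simp
  qed
  show "flow F" using assms(1) by (simp add: C1_flow_def)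
qed (use assms in auto)

text \<open>Each flow comes with its own well-ordered support; their union is well-ordered and puts
  both flows under \<open>continuous_flow\<close> with one S.\<close>

lemma C1_flow_unique:
  assumes F: "C1_flow F" and G: "C1_flow G" and eq: "F 1 = G 1"
  shows "F = G"
proof -
  obtain S where S: "well_ordered S" "\<forall>t. supp (F t) \<subseteq> S"
    using F unfolding C1_flow_def by blast
  obtain T where T: "well_ordered T" "\<forall>t. supp (G t) \<subseteq> T"
    using G unfolding C1_flow_def by blast
  have ST: "well_ordered (S \<union> T)"
    using S(1) T(1) by (simp add: well_ordered_iff_wo image_Un wo_Un)
  have "continuous_flow F (S \<union> T)" "continuous_flow G (S \<union> T)"
    by (rule C1_flow_continuous[OF F ST], use S(2) in blast)
      (rule C1_flow_continuous[OF G ST], use T(2) in blast)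
  then show ?thesis using eq by (rule continuous_flow_unique)
qed

section \<open>The group of series\<close>

lemma ser_comp_H:
  assumes "f \<in> log_series_H" "g \<in> log_series_H"
  shows "g \<circ>\<^sub>s f \<in> log_series_H"
proof -
  obtain a b v where f: "0 < a" "0 < b" "hpos v" "f = ser (fser a b v)"
    using assms(1) by (rule log_series_H_fser)
  obtain a' b' v' where g: "0 < a'" "0 < b'" "hpos v'" "g = ser (fser a' b' v')"
    using assms(2) by (rule log_series_H_fser)
  show ?thesis
    unfolding f(4) g(4) fser_comp_ser[OF f(1-3) g(3)]
    using f g by (intro fser_in_log_series_H hpos_add hpos_scaleR hpos_hcomp) simp_all
qed

lemma series_comp_assoc:
  assumes "f \<in> log_series_H" "g \<in> log_series_H" "h \<in> log_series_H"
  shows "(h \<circ>\<^sub>s g) \<circ>\<^sub>s f = h \<circ>\<^sub>s (g \<circ>\<^sub>s f)"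
proof -
  obtain a b v where f: "0 < a" "0 < b" "hpos v" "f = ser (fser a b v)"
    using assms(1) by (rule log_series_H_fser)
  obtain a' b' v' where g: "0 < a'" "0 < b'" "hpos v'" "g = ser (fser a' b' v')"
    using assms(2) by (rule log_series_H_fser)
  obtain a'' b'' v'' where h: "h = ser (fser a'' b'' v'')"
    using assms(3) by (rule log_series_H_fser)
  have "0 < a' * a powr b'" "0 < b * b'" "hpos (b' *\<^sub>R v + hcomp a b v v')"
    using f g by (simp_all add: hpos_add hpos_scaleR hpos_hcomp)
  note gf = ser_comp[OF this]
  have "(h \<circ>\<^sub>s g) \<circ>\<^sub>s f = ser (hcomp a b v (hcomp a' b' v' (fser a'' b'' v'')))"
    unfolding f(4) g(4) h ser_comp[OF g(1-3)] ser_comp[OF f(1-3)] ..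
  moreover have "h \<circ>\<^sub>s (g \<circ>\<^sub>s f) =
      ser (hcomp (a' * a powr b') (b * b') (b' *\<^sub>R v + hcomp a b v v') (fser a'' b'' v''))"
    unfolding f(4) g(4) h fser_comp_ser[OF f(1-3) g(3)] gf ..
  ultimately show ?thesis
    unfolding hcomp_comp[OF f(1) g(1) f(2) g(2) f(3) g(3)] by simp
qed

lemma series_comp_id:
  assumes "f \<in> log_series_H"
  shows "f \<circ>\<^sub>s id_series = f" "id_series \<circ>\<^sub>s f = f"
proof -
  obtain a b v where f: "0 < a" "0 < b" "hpos v" "f = ser (fser a b v)"
    using assms by (rule log_series_H_fser)
  show "f \<circ>\<^sub>s id_series = f"
    unfolding f(4) id_series_fser by (subst ser_comp) (simp_all add: hcomp_id)
  show "id_series \<circ>\<^sub>s f = f"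
    unfolding f(4) id_series_fser by (subst fser_comp_ser) (use f in simp_all)
qed

definition xpow :: "real \<Rightarrow> series" where
  "xpow b = ser (fser 1 b 0)"

lemma xpow_H: "0 < b \<Longrightarrow> xpow b \<in> log_series_H"
  unfolding xpow_def by (rule fser_in_log_series_H) simp_all

lemma xpow_comp: "0 < b \<Longrightarrow> xpow c \<circ>\<^sub>s xpow b = xpow (b * c)"
  unfolding xpow_def by (subst fser_comp_ser) simp_all

lemma xpow_1: "xpow 1 = id_series"
  by (simp add: xpow_def id_series_fser)

text \<open>f \<circ> x^(1/b) has b = 1, so the flow through it exists and its value at time -1 is
  an inverse; composing that with x^(1/b) on the left undoes the change of exponent.\<close>

lemma series_left_inverse:
  assumes "f \<in> log_series_H"
  shows "\<exists>g\<in>log_series_H. g \<circ>\<^sub>s f = id_series"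
proof -
  obtain a b v where f: "0 < a" "0 < b" "hpos v" "f = ser (fser a b v)"
    using assms by (rule log_series_H_fser)
  define f1 where "f1 = f \<circ>\<^sub>s xpow (1 / b)"
  have f1: "f1 = ser (fser a 1 (hcomp 1 (1 / b) 0 v))"
    unfolding f1_def xpow_def f(4) using f by (subst fser_comp_ser) simp_all
  interpret near_identity a "hcomp 1 (1 / b) 0 v"
    by unfold_locales (use f in \<open>simp_all add: hpos_hcomp\<close>)
  let ?g = "xpow (1 / b) \<circ>\<^sub>s F (- 1)"
  have F: "F t \<in> log_series_H" for t using flow_F by (simp add: flow_def)
  have inv: "F (- 1) \<circ>\<^sub>s f1 = id_series"
  proof -
    have "F (- 1) \<circ>\<^sub>s F 1 = F 0" using flow_F unfolding flow_def by (metis add.left_inverse)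
    then show ?thesis using flow_F unfolding flow_def F_1 f1 by simp
  qed
  have xH: "xpow (1 / b) \<in> log_series_H" "xpow b \<in> log_series_H" using f by (simp_all add: xpow_H)
  have f1H: "f1 \<in> log_series_H" unfolding f1_def by (intro ser_comp_H xH assms)
  have "f = f1 \<circ>\<^sub>s xpow b"
    unfolding f1_def using f(2)
    by (simp add: series_comp_assoc xH assms xpow_comp xpow_1 series_comp_id)
  then have "?g \<circ>\<^sub>s f = xpow (1 / b) \<circ>\<^sub>s ((F (- 1) \<circ>\<^sub>s f1) \<circ>\<^sub>s xpow b)"
    by (simp add: series_comp_assoc xH F f1H ser_comp_H)
  also have "\<dots> = id_series"
    unfolding inv using f(2) by (simp add: series_comp_id xH xpow_comp xpow_1)
  finally show ?thesis using ser_comp_H[OF F xH(1)] by blast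
qed

lemma series_inverse_commute:
  assumes "f \<in> log_series_H" "g \<in> log_series_H" "g \<circ>\<^sub>s f = id_series"
  shows "f \<circ>\<^sub>s g = id_series"
proof -
  obtain h where h: "h \<in> log_series_H" "h \<circ>\<^sub>s g = id_series"
    using series_left_inverse[OF assms(2)] by blast
  have "h = h \<circ>\<^sub>s (g \<circ>\<^sub>s f)" by (simp add: assms(3) series_comp_id h)
  also have "\<dots> = (h \<circ>\<^sub>s g) \<circ>\<^sub>s f" by (rule series_comp_assoc[symmetric, OF assms(1,2) h(1)])
  also have "\<dots> = f" by (simp add: assms(1) h series_comp_id)
  finally show ?thesis using h(2) by simp
qed

section \<open>Strongly hyperbolic series\<close>

text \<open>Well-founded recursion along W: the equation at p is solved for h p once the values at
  smaller exponents are known.\<close>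

lemma triangular_solve:
  fixes K :: "'a::linorder \<Rightarrow> 'a \<Rightarrow> real"
  assumes W: "wo W" and fin: "\<And>p. p \<in> W \<Longrightarrow> finite {q \<in> W. K p q \<noteq> 0}"
    and tri: "\<And>p q. p \<in> W \<Longrightarrow> q \<in> W \<Longrightarrow> K p q \<noteq> 0 \<Longrightarrow> q \<le> p"
    and diag: "\<And>p. p \<in> W \<Longrightarrow> K p p \<noteq> 0"
  shows "\<exists>h. (\<forall>p. p \<notin> W \<longrightarrow> h p = 0) \<and> (\<forall>p\<in>W. (\<Sum>q\<in>{q \<in> W. K p q \<noteq> 0}. K p q * h q) = c p)"
proof -
  define R where "R = {(q, p). q \<in> W \<and> p \<in> W \<and> q < p}"
  have "wf R" unfolding R_def by (rule wf_less_on_wo[OF W])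
  define \<Phi> where "\<Phi> f p = (if p \<in> W then
      (c p - (\<Sum>q\<in>{q \<in> W. K p q \<noteq> 0} - {p}. K p q * f q)) / K p p else 0)" for f p
  define h where "h = wfrec R \<Phi>"
  have h: "h p = \<Phi> (cut h R p) p" for p unfolding h_def by (rule wfrec[OF \<open>wf R\<close>])
  have "h p = 0" if "p \<notin> W" for p using h[of p] that by (simp add: \<Phi>_def)
  moreover have "(\<Sum>q\<in>{q \<in> W. K p q \<noteq> 0}. K p q * h q) = c p" if p: "p \<in> W" for p
  proof -
    let ?Q = "{q \<in> W. K p q \<noteq> 0}"
    have "cut h R p q = h q" if "q \<in> ?Q - {p}" for q
    proof -
      have "q < p" using tri[OF p, of q] that by auto
      then have "(q, p) \<in> R" using that p by (simp add: R_def)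
      then show ?thesis by (rule cut_apply)
    qed
    then have "h p = (c p - (\<Sum>q\<in>?Q - {p}. K p q * h q)) / K p p"
      using h[of p] p by (simp add: \<Phi>_def)
    moreover have "(\<Sum>q\<in>?Q. K p q * h q) = K p p * h p + (\<Sum>q\<in>?Q - {p}. K p q * h q)"
      using p diag[OF p] by (intro sum.remove fin) simp_all
    ultimately show ?thesis using diag[OF p] by (simp add: field_simps)
  qed
  ultimately show ?thesis by blast
qed

text \<open>Stretching fixes the exponents with real part 0. The positive real parts in E are
  bounded below by some \<delta> > 0, so stretching pushes them past any bound, and below x only
  finitely many n matter.\<close>

lemma wo_tw_orbit:
  assumes E: "wo E" "E \<subseteq> {0<..}" and b: "1 < b"
  shows "wo (\<Union>n. tw (b ^ n) ` E)"
proof (rule wo_if_initial)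
  fix x
  obtain \<delta> where \<delta>: "0 < \<delta>" "\<forall>p\<in>E. 0 < xdeg p \<longrightarrow> \<delta> \<le> xdeg p"
    using wo_xdeg_bounded_below[OF E(1)] by blast
  obtain N where N: "xdeg x / \<delta> < b ^ N" using real_arch_pow[OF b] by blast
  have wo_tw: "wo (tw (b ^ n) ` E)" for n
    using E(1) b by (intro wo_mono_image) (simp_all add: tw_le)
  have "{y \<in> (\<Union>n. tw (b ^ n) ` E). y \<le> x} \<subseteq> E \<union> (\<Union>n\<in>{..N}. tw (b ^ n) ` E)"
  proof
    fix y assume "y \<in> {y \<in> (\<Union>n. tw (b ^ n) ` E). y \<le> x}"
    then obtain n e where e: "e \<in> E" "y = tw (b ^ n) e" "y \<le> x" by blast
    show "y \<in> E \<union> (\<Union>n\<in>{..N}. tw (b ^ n) ` E)"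
    proof (cases "0 < xdeg e")
      case True
      have "b ^ n * \<delta> \<le> b ^ n * xdeg e" using \<delta> e(1) True b by (intro mult_left_mono) auto
      also have "\<dots> \<le> xdeg x" using xdeg_mono[OF e(3)] e(2) by (simp add: tw_def)
      finally have "b ^ n \<le> xdeg x / \<delta>" using \<delta>(1) by (simp add: pos_le_divide_eq)
      with N have "b ^ n < b ^ N" by simp
      then have "n < N" using b by simp
      then show ?thesis using e by auto
    next
      case False
      have "0 < e" using e(1) E(2) by auto
      then have "xdeg e = 0" using False xdeg_mono[of 0 e] by simp
      then have "y = e" using e(2) by (simp add: tw_def expo_eq_iff)
      then show ?thesis using e(1) by simp
    qed
  qed
  then show "wo {y \<in> (\<Union>n. tw (b ^ n) ` E). y \<le> x}"
    by (rule wo_subset[rotated]) (intro wo_Un wo_finite_UN E wo_tw; simp)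
qed

text \<open>
  Passing to logarithms, the Boettcher equation \<open>\<Psi> \<circ> f = \<Psi>\<^sup>b\<close> for \<open>f = a x\<^sup>b exp v\<close> becomes the
  linear equation of the next lemma. Since \<open>b > 1\<close>, composition with \<open>f\<close> does not decrease
  exponents, and on the exponents \<open>(0, k)\<close>, \<open>k > 0\<close>, that it preserves it has the diagonal
  entries \<open>b\<^sup>-\<^sup>k \<noteq> b\<close>.
\<close>

lemma Boettcher_equation:
  assumes a: "0 < a" and b: "1 < b" and v: "hpos v"
  shows "\<exists>u. hpos u \<and> v + hcomp a b v u = b *\<^sub>R u"
proof -
  have b0: "0 < b" using b by simp
  define E where "E = insert (Expo 0 1) (hsupp v)"
  have E: "wo E" "E \<subseteq> {0<..}" using kmonoid_pos[OF v] by (simp_all add: E_def)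
  \<comment> \<open>The generators are closed under stretching by b, so that composition with f maps
    series supported in the generated monoid to such series.\<close>
  define G where "G = (\<Union>n. tw (b ^ n) ` E)"
  have G: "wo G" "G \<subseteq> {0<..}"
    using wo_tw_orbit[OF E b] E(2) b0 by (auto simp: G_def tw_pos)
  have EG: "E \<subseteq> G"
  proof
    fix e assume "e \<in> E"
    then have "e \<in> tw (b ^ 0) ` E" by (simp add: image_iff)
    then show "e \<in> G" unfolding G_def by blast
  qed
  then interpret exp_monoid "gen_monoid G"
    by (intro exp_monoid_gen G) (auto simp: E_def)
  have tw_M: "gen_monoid G \<subseteq> {p. tw b p \<in> gen_monoid G}"
  proof (rule gen_monoid_least)
    show "G \<subseteq> {p. tw b p \<in> gen_monoid G}"
    proof
      fix p assume "p \<in> G"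
      then obtain n e where "e \<in> E" "p = tw (b ^ n) e" by (auto simp: G_def)
      then have "tw b p \<in> tw (b ^ Suc n) ` E" by (simp add: tw_tw)
      then have "tw b p \<in> G" unfolding G_def by blast
      then show "p \<in> {p. tw b p \<in> gen_monoid G}" using subset_gen_monoid by blast
    qed
  qed (simp_all add: tw_add gen_monoid_add)
  have kM: "kmonoid v \<subseteq> gen_monoid G"
    unfolding kmonoid_def E_def[symmetric] by (rule gen_monoid_mono[OF EG])
  define W where "W = gen_monoid G \<inter> {0<..}"
  have W: "wo W" by (rule wo_subset[OF wo_M]) (simp add: W_def)
  have kern_mem: "r \<in> W \<and> q \<le> r \<and> (xdeg q \<noteq> 0 \<longrightarrow> q < r)"
    if q: "q \<in> W" and r: "hcoeff (kern a b v q) r \<noteq> 0" for q r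
  proof -
    have q0: "0 < q" "q \<in> gen_monoid G" using q by (simp_all add: W_def)
    from r have "r \<in> sumset {tw b q} (kmonoid v)" using hsupp_kern[OF v] unfolding hcoeff_nz by blast
    then obtain s where s: "s \<in> kmonoid v" "r = tw b q + s" by (auto simp: sumset_def)
    have s0: "0 \<le> s" using s(1) kmonoid_nonneg[OF v] by auto
    have "0 \<le> xdeg q" using xdeg_mono[of 0 q] q0(1) by simp
    then have tw: "q \<le> tw b q" "xdeg q \<noteq> 0 \<longrightarrow> q < tw b q"
      using b by (auto simp: tw_def less_eq_expo_def less_expo_def)
    have tr: "tw b q \<le> r" using s(2) s0 by simp
    have "tw b q + s \<in> gen_monoid G" using tw_M q0(2) kM s(1) by (intro gen_monoid_add) blast+
    moreover have "q \<le> r" using tw(1) tr by (rule order_trans)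
    moreover have "xdeg q \<noteq> 0 \<longrightarrow> q < r" using tw(2) tr by (meson less_le_trans)
    ultimately show ?thesis using s(2) q0(1) by (simp add: W_def)
  qed
  \<comment> \<open>The matrix of the operator that sends u to u \<circ> f - b u; the equation to
    solve is K u = -v.\<close>
  define K where "K p q = hcoeff (kern a b v q) p - (if q = p then b else 0)" for p q
  let ?Q = "\<lambda>p. {q \<in> W. K p q \<noteq> 0}" and ?P = "\<lambda>p. {q \<in> W. hcoeff (kern a b v q) p \<noteq> 0}"
  have fin: "finite (?Q p)" for p
  proof (rule finite_subset)
    show "?Q p \<subseteq> insert p (?P p)" by (auto simp: K_def)
    show "finite (insert p (?P p))"
      using hcoeff_hcomp_kern(1)[OF b0 v W, of 0] by simp
  qed
  have tri: "q \<le> p" if "p \<in> W" "q \<in> W" "K p q \<noteq> 0" for p q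
    using kern_mem[OF that(2), of p] that(3) by (cases "q = p") (auto simp: K_def)
  have diag: "K p p \<noteq> 0" if p: "p \<in> W" for p
  proof (cases "xdeg p = 0")
    case False
    \<comment> \<open>Stretching moves p strictly upwards here, so composition contributes nothing
      to the diagonal and the entry of K is -b.\<close>
    then have "hcoeff (kern a b v p) p = 0" using kern_mem[OF p, of p] by auto
    then show ?thesis using b0 by (simp add: K_def)
  next
    case True
    then have "tw b p = p" by (simp add: tw_def expo_eq_iff)
    then have "hcoeff (kern a b v p) p = b powr - real_of_int (ldeg p)"
      using True a by (simp add: kern_def hcoeff_hmonom_times hcoeff_hexp_0 hpos_scaleR hpos_hw v)
    moreover have "0 < ldeg p" using p True by (simp add: W_def less_expo_def)
    then have "b powr - real_of_int (ldeg p) < b powr 0" using b by (intro powr_less_mono) simp_all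
    ultimately show ?thesis using b by (simp add: K_def)
  qed
  obtain h where h: "\<forall>p. p \<notin> W \<longrightarrow> h p = 0"
      "\<forall>p\<in>W. (\<Sum>q\<in>?Q p. K p q * h q) = - hcoeff v p"
    using triangular_solve[OF W fin tri diag, of "\<lambda>p. - hcoeff v p"] by blast
  define u where "u = Abs_hahn h"
  have u: "hcoeff u = h" unfolding u_def by (rule hcoeff_Abs[OF W]) (use h(1) in auto)
  have uW: "hsupp u \<subseteq> W" using h(1) by (auto simp: hsupp_def u)
  have "hcoeff (v + hcomp a b v u) p = hcoeff (b *\<^sub>R u) p" for p
  proof (cases "p \<in> W")
    case True
    have fP: "finite (insert p (?P p))" using hcoeff_hcomp_kern(1)[OF b0 v W, of 0] by simp
    have "- hcoeff v p = (\<Sum>q\<in>?Q p. K p q * h q)" using h(2) True by simp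
    also have "\<dots> = (\<Sum>q\<in>insert p (?P p). K p q * h q)"
      using True by (intro sum.mono_neutral_left fP) (auto simp: K_def)
    also have "\<dots> = (\<Sum>q\<in>insert p (?P p). hcoeff (kern a b v q) p * h q) -
        (\<Sum>q\<in>insert p (?P p). (if q = p then b else 0) * h q)"
      by (simp only: K_def left_diff_distrib sum_subtractf)
    also have "(\<Sum>q\<in>insert p (?P p). (if q = p then b else 0) * h q) = b * h p"
      using fP by (simp add: sum.delta mult_delta_left)
    also have "(\<Sum>q\<in>insert p (?P p). hcoeff (kern a b v q) p * h q) =
        (\<Sum>q\<in>?P p. hcoeff (kern a b v q) p * h q)"
      using True by (intro sum.mono_neutral_right fP) auto
    also have "\<dots> = hcoeff (hcomp a b v u) p"
      using hcoeff_hcomp_kern(2)[OF b0 v W uW, of a p] by (simp add: u)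
    finally show ?thesis by (simp add: u)
  next
    case False
    have "hsupp v \<subseteq> W" using hsupp_kmonoid[of v] kM v by (auto simp: W_def hpos_def)
    then have "hcoeff v p = 0" using False by (rule hcoeff_eq_0)
    moreover have "?P p = {}" using kern_mem False by blast
    then have "hcoeff (hcomp a b v u) p = 0"
      unfolding hcoeff_hcomp_kern(2)[OF b0 v W uW] by simp
    ultimately show ?thesis using h(1) False by (simp add: u)
  qed
  then have "v + hcomp a b v u = b *\<^sub>R u" by (rule hahn_eqI)
  moreover have "hpos u" using uW by (auto simp: hpos_def W_def)
  ultimately show ?thesis by blast
qed

lemma Boettcher_coordinate:
  assumes a: "0 < a" and b: "1 < b" and v: "hpos v"
  shows "\<exists>\<Psi>\<in>log_series_H. \<Psi> \<circ>\<^sub>s ser (fser a b v) = xpow b \<circ>\<^sub>s \<Psi>"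
proof -
  obtain u where u: "hpos u" "v + hcomp a b v u = b *\<^sub>R u"
    using Boettcher_equation[OF assms] by blast
  \<comment> \<open>Equality of the leading coefficients of \<Psi> \<circ> f and \<Psi>^b requires c
    a = c^b.\<close>
  define c where "c = a powr (1 / (b - 1))"
  have c: "0 < c" using a by (simp add: c_def)
  have "c * a = a powr (1 / (b - 1) + 1)" using a by (simp add: c_def powr_add)
  also have "1 / (b - 1) + 1 = 1 / (b - 1) * b" using b by (simp add: field_simps)
  finally have ca: "c * a = c powr b" by (simp add: c_def powr_powr)
  have "ser (fser c 1 u) \<circ>\<^sub>s ser (fser a b v) = xpow b \<circ>\<^sub>s ser (fser c 1 u)"
    unfolding xpow_def using a b v c u ca by (simp add: fser_comp_ser)
  moreover have "ser (fser c 1 u) \<in> log_series_H"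
    using c u(1) by (intro fser_in_log_series_H) simp_all
  ultimately show ?thesis by blast
qed

lemma flow_expanding:
  assumes a: "0 < a" and b: "1 < b" and v: "hpos v"
  shows "\<exists>F. flow F \<and> F 1 = ser (fser a b v)"
proof -
  let ?f = "ser (fser a b v)"
  have fH: "?f \<in> log_series_H" using assms by (intro fser_in_log_series_H) simp_all
  obtain \<Psi> where \<Psi>: "\<Psi> \<in> log_series_H" "\<Psi> \<circ>\<^sub>s ?f = xpow b \<circ>\<^sub>s \<Psi>"
    using Boettcher_coordinate[OF assms] by blast
  obtain \<Phi> where \<Phi>: "\<Phi> \<in> log_series_H" "\<Phi> \<circ>\<^sub>s \<Psi> = id_series"
    using series_left_inverse[OF \<Psi>(1)] by blast
  have \<Psi>\<Phi>: "\<Psi> \<circ>\<^sub>s \<Phi> = id_series" by (rule series_inverse_commute[OF \<Psi>(1) \<Phi>])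
  define X where "X t = xpow (b powr t)" for t
  have X: "X t \<in> log_series_H" "X s \<circ>\<^sub>s X t = X (s + t)" for s t
    using b by (simp_all add: X_def xpow_H xpow_comp powr_add mult.commute)
  define F where "F t = \<Phi> \<circ>\<^sub>s (X t \<circ>\<^sub>s \<Psi>)" for t
  have "F s \<circ>\<^sub>s F t = F (s + t)" for s t
  proof -
    have "F s \<circ>\<^sub>s F t = \<Phi> \<circ>\<^sub>s (X s \<circ>\<^sub>s ((\<Psi> \<circ>\<^sub>s \<Phi>) \<circ>\<^sub>s (X t \<circ>\<^sub>s \<Psi>)))"
      by (simp add: F_def series_comp_assoc ser_comp_H \<Psi>(1) \<Phi>(1) X(1))
    also have "\<dots> = \<Phi> \<circ>\<^sub>s ((X s \<circ>\<^sub>s X t) \<circ>\<^sub>s \<Psi>)"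
      by (simp add: \<Psi>\<Phi> series_comp_id series_comp_assoc ser_comp_H \<Psi>(1) X(1))
    finally show ?thesis by (simp add: X(2) F_def)
  qed
  moreover have "F 0 = id_series"
    using b by (simp add: F_def X_def xpow_1 series_comp_id \<Psi>(1) \<Phi>(2))
  moreover have "F t \<in> log_series_H" for t by (simp add: F_def ser_comp_H \<Psi>(1) \<Phi>(1) X(1))
  ultimately have "flow F" by (simp add: flow_def)
  moreover have "F 1 = (\<Phi> \<circ>\<^sub>s \<Psi>) \<circ>\<^sub>s ?f"
    using b by (simp add: F_def X_def \<Psi>(2)[symmetric] series_comp_assoc fH \<Psi>(1) \<Phi>(1))
  then have "F 1 = ?f" by (simp add: \<Phi>(2) series_comp_id fH)
  ultimately show ?thesis by blast
qed

lemma flow_contracting: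
  assumes a: "0 < a" and b: "0 < b" "b < 1" and v: "hpos v"
  shows "\<exists>F. flow F \<and> F 1 = ser (fser a b v)"
proof -
  let ?f = "ser (fser a b v)"
  have fH: "?f \<in> log_series_H" using assms by (intro fser_in_log_series_H)
  obtain g where g: "g \<in> log_series_H" "g \<circ>\<^sub>s ?f = id_series"
    using series_left_inverse[OF fH] by blast
  obtain a' b' v' where g': "0 < a'" "0 < b'" "hpos v'" "g = ser (fser a' b' v')"
    using g(1) by (rule log_series_H_fser)
  have "fser (a' * a powr b') (b * b') (b' *\<^sub>R v + hcomp a b v v') = fser 1 1 0"
    using g(2) unfolding g'(4) id_series_fser fser_comp_ser[OF a b(1) v g'(3)] by simp
  moreover have "0 < a' * a powr b'" "0 < b * b'" "hpos (b' *\<^sub>R v + hcomp a b v v')"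
    using a b v g' by (simp_all add: hpos_add hpos_scaleR hpos_hcomp)
  ultimately have "b * b' = 1" using fser_inject[of _ _ _ 1 1 0] by simp
  then have "b' = 1 / b" using b(1) by (simp add: field_simps)
  then have "1 < b'" using b by simp
  then obtain G where G: "flow G" "G 1 = g"
    using flow_expanding[OF g'(1) _ g'(3)] g'(4) by blast
  have GH: "G t \<in> log_series_H" and G0: "G 0 = id_series" and G_add: "G s \<circ>\<^sub>s G t = G (s + t)" for s t
    using G(1) by (simp_all add: flow_def)
  \<comment> \<open>As g \<circ> f is the identity and g is the time-one map of G, the flow at time
    -1 must be f; reversing time then embeds f.\<close>
  have "G (- 1) = (G (- 1) \<circ>\<^sub>s G 1) \<circ>\<^sub>s ?f"
    using g by (simp add: G(2) series_comp_assoc fH GH series_comp_id)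
  also have "\<dots> = ?f" unfolding G_add by (simp add: G0 series_comp_id fH)
  finally have "G (- 1) = ?f" .
  moreover have "flow (\<lambda>t. G (- t))" by (simp add: flow_def GH G0 G_add)
  ultimately show ?thesis by (intro exI[of _ "\<lambda>t. G (- t)"]) simp
qed

lemma parabolic_or_hyperbolic_fser:
  assumes "0 < a" "0 < b" "hpos v" "parabolic (ser (fser a b v)) \<or> hyperbolic (ser (fser a b v))"
  shows "b = 1"
  using assms(4) by (auto simp: parabolic_def hyperbolic_def starts_with_fser[OF assms(1-3)])

theorem theoremB:
  fixes f :: series
  assumes "f \<in> log_series_H"
  shows "(\<exists>F. flow F \<and> embeds_in f F) \<and>
         (parabolic f \<or> hyperbolic f \<longrightarrow>
           (\<exists>!\<xi>. \<xi> \<in> log_series \<and> (\<exists>F. C1_flow_of \<xi> F \<and> embeds_in f F)))"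
proof -
  obtain a b v where f: "0 < a" "0 < b" "hpos v" "f = ser (fser a b v)"
    using assms by (rule log_series_H_fser)
  have C1: "\<exists>F \<xi>. flow F \<and> F 1 = f \<and> \<xi> \<in> log_series \<and> C1_flow_of \<xi> F" if "b = 1"
  proof -
    interpret near_identity a v by unfold_locales (use f in simp_all)
    obtain \<xi> where "\<xi> \<in> log_series" "C1_flow_of \<xi> F" using C1_flow_of_F by blast
    then show ?thesis using flow_F F_1 f(4) that by blast
  qed
  have "\<exists>F. flow F \<and> F 1 = f"
  proof -
    consider "b = 1" | "1 < b" | "b < 1" by linarith
    then show ?thesis
    proof cases
      case 1
      with C1 show ?thesis by blast
    next
      case 2
      then show ?thesis unfolding f(4) by (rule flow_expanding[OF f(1) _ f(3)])
    next
      case 3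
      then show ?thesis unfolding f(4) by (rule flow_contracting[OF f(1,2) _ f(3)])
    qed
  qed
  moreover have "\<exists>!\<xi>. \<xi> \<in> log_series \<and> (\<exists>F. C1_flow_of \<xi> F \<and> F 1 = f)"
    if "parabolic f \<or> hyperbolic f"
  proof -
    have "b = 1" using parabolic_or_hyperbolic_fser[OF f(1-3)] that f(4) by blast
    then obtain F \<xi> where F: "F 1 = f" "\<xi> \<in> log_series" "C1_flow_of \<xi> F" using C1 by blast
    show ?thesis
    proof (rule ex1I[of _ \<xi>])
      show "\<xi> \<in> log_series \<and> (\<exists>F. C1_flow_of \<xi> F \<and> F 1 = f)" using F by blast
      fix \<eta> assume "\<eta> \<in> log_series \<and> (\<exists>F. C1_flow_of \<eta> F \<and> F 1 = f)"
      then obtain G where G: "C1_flow_of \<eta> G" "G 1 = f" by blast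
      \<comment> \<open>Flows with the same time-one map coincide, and the vector field is recovered
        as the derivative at time 0.\<close>
      have "G = F"
        using C1_flow_unique[of G F] G F unfolding C1_flow_of_def by simp
      then show "\<eta> = \<xi>"
        using G(1) F(3) DERIV_unique unfolding C1_flow_of_def by blast
    qed
  qed
  ultimately show ?thesis unfolding embeds_in_def by blast
qed

end
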